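(* Let $\phi:\mathbb{R}^d\to[0,+\infty]$ be a finite-range, repulsive pair potential and let $\Delta_\phi$ be its potential-weighted connective constant. Then for every $\lambda\in[0,e/\Delta_\phi)$, the family of Gibbs point processes defined by $\phi$ exhibits strong spatial mixing with activities bounded by $\lambda$; that is, there exist constants $\alpha,\beta>0$ such that for every bounded measurable $\Lambda\subset\mathbb{R}^d$ and every two activity functions $\boldsymbol{\lambda},\boldsymbol{\lambda}'$ bounded by $\lambda$, $$\|\mu_{\boldsymbol{\lambda}}-\mu_{\boldsymbol{\lambda}'}\|_\Lambda\le \alpha|\Lambda|\,e^{-\beta\,\mathrm{dist}(\Lambda,\supp(\boldsymbol{\lambda}-\boldsymbol{\lambda}'))}.$$
   Context: A pair potential is a measurable $\phi:\mathbb{R}^d\to(-\infty,+\infty]$ with $\phi(x)=\phi(-x)$; it is repulsive if $\phi\ge0$ and of finite range if there is $r\ge 0$ with $\phi(x)=0$ for $\|x\|>r$. Write $H(x_1,\dots,x_k)=\sum_{i<j}\phi(x_i-x_j)$. An activity function is an integrable $\boldsymbol{\lambda}:\mathbb{R}^d\to[0,\infty)$; it is bounded by $\lambda$ if $\|\boldsymbol{\lambda}\|_\infty\le\lambda$. For $\boldsymbol{\lambda}$ with bounded support, $Z(\boldsymbol{\lambda})=1+\sum_{k\ge1}\frac1{k!}\int_{(\mathbb{R}^d)^k}\prod_i\boldsymbol{\lambda}(x_i)e^{-H(x_1,\dots,x_k)}dx$, and the Gibbs point process $\mu_{\boldsymbol{\lambda}}$ is the law on finite point sets with $\mu_{\boldsymbol{\lambda}}(A)=\sum_{k\ge0}\frac1{k!}\int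 \mathbf 1_{\{x_1,\dots,x_k\}\in A}\frac{\prod_i\boldsymbol{\lambda}(x_i)}{Z(\boldsymbol{\lambda})}e^{-H(x_1,\dots,x_k)}dx$. For $\Lambda\subset\mathbb{R}^d$, $\|\mu_{\boldsymbol{\lambda}}-\mu_{\boldsymbol{\lambda}'}\|_\Lambda=\sup_A|\mu_{\boldsymbol{\lambda}}(A_\Lambda)-\mu_{\boldsymbol{\lambda}'}(A_\Lambda)|$, the supremum over events $A$ in the $\sigma$-field of finite point sets in $\Lambda$, where $A_\Lambda=\{\eta:\eta\cap\Lambda\in A\}$; $|\Lambda|$ is Lebesgue volume and $\supp(f)=\{x:f(x)\neq0\}$. The potential-weighted connective constant is $\Delta_\phi=\lim_{k\to\infty}V_k^{1/k}=\inf_{k\ge1}V_k^{1/k}$ where, with $v_0=0$, $$V_k=\int_{(\mathbb{R}^d)^k}\prod_{j=1}^k\Big(\exp\Big(-\sum_{i=0}^{j-2}\mathbf 1_{|v_j-v_i|<|v_i-v_{i+1}|}\phi(v_j-v_i)\Big)\big(1-e^{-\phi(v_j-v_{j-1})}\big)\Big)dv_1\cdots dv_k.$$ *)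

theory Defs
  imports "HOL-Analysis.Analysis"
begin

text \<open>Points live in a Euclidean space 'a (standing for R^d, d = DIM('a)).
  A repulsive pair potential takes values in [0,+\<infinity>], modelled as ennreal.\<close>

definition pair_potential :: "('a::euclidean_space \<Rightarrow> ennreal) \<Rightarrow> bool" where
  "pair_potential \<phi> \<longleftrightarrow> \<phi> \<in> borel_measurable borel \<and> (\<forall>x. \<phi> (-x) = \<phi> x)"

definition finite_range :: "('a::euclidean_space \<Rightarrow> ennreal) \<Rightarrow> bool" where
  "finite_range \<phi> \<longleftrightarrow> (\<exists>r\<ge>0. \<forall>x. norm x > r \<longrightarrow> \<phi> x = 0)"

definition boltz :: "('a \<Rightarrow> ennreal) \<Rightarrow> 'a \<Rightarrow> real" where
  "boltz \<phi> x = (if \<phi> x = \<infinity> then 0 else exp (- enn2real (\<phi> x)))"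

definition activity_bounded :: "('a::euclidean_space \<Rightarrow> real) \<Rightarrow> real \<Rightarrow> bool" where
  "activity_bounded l lam \<longleftrightarrow> integrable lborel l \<and> (\<forall>x. l x \<ge> 0) \<and>
      (AE x in lborel. l x \<le> lam)"

text \<open>Unnormalised Gibbs weight of a set A of finite point sets (A = UNIV gives Z).
  The k-th term integrates over (R^d)^k, a point being x :: nat \<Rightarrow> 'a on {..<k};
  exp(-H) is written as a product of Boltzmann factors.\<close>
definition gibbs_weight :: "('a::euclidean_space \<Rightarrow> ennreal) \<Rightarrow> ('a \<Rightarrow> real) \<Rightarrow> 'a set set \<Rightarrow> ennreal" where
  "gibbs_weight \<phi> l A = (\<Sum>k. ennreal (1 / fact k) *
     (\<integral>\<^sup>+ x. indicator A (x ` {..<k}) *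
          ennreal (\<Prod>i<k. l (x i)) *
          ennreal (\<Prod>i<k. \<Prod>j\<in>{i<..<k}. boltz \<phi> (x i - x j))
        \<partial>(PiM {..<k} (\<lambda>_. lborel))))"

definition partition_fn :: "('a::euclidean_space \<Rightarrow> ennreal) \<Rightarrow> ('a \<Rightarrow> real) \<Rightarrow> real" where
  "partition_fn \<phi> l = enn2real (gibbs_weight \<phi> l UNIV)"

definition gibbs_prob :: "('a::euclidean_space \<Rightarrow> ennreal) \<Rightarrow> ('a \<Rightarrow> real) \<Rightarrow> 'a set set \<Rightarrow> real" where
  "gibbs_prob \<phi> l A = enn2real (gibbs_weight \<phi> l A) / partition_fn \<phi> l"

definition point_sets :: "'a::euclidean_space set \<Rightarrow> 'a set measure" where
  "point_sets \<Lambda> = sigma {\<eta>. finite \<eta> \<and> \<eta> \<subseteq> \<Lambda>}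
     {{\<eta>. finite \<eta> \<and> \<eta> \<subseteq> \<Lambda> \<and> card (\<eta> \<inter> B) = n} | B n. B \<in> sets borel}"

definition tv_local :: "('a::euclidean_space \<Rightarrow> ennreal) \<Rightarrow> ('a \<Rightarrow> real) \<Rightarrow> ('a \<Rightarrow> real) \<Rightarrow> 'a set \<Rightarrow> real" where
  "tv_local \<phi> l l' \<Lambda> = (SUP A \<in> sets (point_sets \<Lambda>).
      \<bar>gibbs_prob \<phi> l {\<eta>. \<eta> \<inter> \<Lambda> \<in> A} - gibbs_prob \<phi> l' {\<eta>. \<eta> \<inter> \<Lambda> \<in> A}\<bar>)"

definition walk_V :: "('a::euclidean_space \<Rightarrow> ennreal) \<Rightarrow> nat \<Rightarrow> ennreal" where
  "walk_V \<phi> k = (\<integral>\<^sup>+ x. ennreal (let v = (\<lambda>j. if j = 0 then 0 else x j) in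
       \<Prod>j\<in>{1..k}. (\<Prod>i\<in>{0..<j-1}.
            (if norm (v j - v i) < norm (v i - v (Suc i)) then boltz \<phi> (v j - v i) else 1))
          * (1 - boltz \<phi> (v j - v (j - 1))))
     \<partial>(PiM {1..k} (\<lambda>_. lborel)))"

definition connective_const :: "('a::euclidean_space \<Rightarrow> ennreal) \<Rightarrow> real" where
  "connective_const \<phi> = (INF k\<in>{1..}. enn2real (walk_V \<phi> k) powr (1 / real k))"

end

theory Submission
  imports Defs
begin

text \<open>
  Write \<open>Z\<close> for the partition function and put \<open>r\<^sub>l(v) = Z(l exp(- \<phi>(v - \<cdot>))) / Z(l)\<close>, so that
  \<open>l(v) r\<^sub>l(v)\<close> is the one-point density. Switching on the interaction with \<open>v\<close> from the inside outwards
  gives the exact recursion \<open>r\<^sub>l(v) = exp (- \<integral> l(w) (1 - exp (- \<phi>(v - w))) r\<^sub>m(w) dw)\<close>, where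
  \<open>m\<close> is \<open>l\<close> damped by \<open>v\<close> on the ball around \<open>v\<close> of radius \<open>|w - v|\<close>. In the variable \<open>y = sqrt r\<close>
  the right-hand side depends only on an \<open>L\<^sup>2\<close> norm of \<open>y\<close>, and \<open>p \<mapsto> exp (- p\<^sup>2 / 2)\<close> is Lipschitz with
  constant \<open>exp (- 1 / 2)\<close>; hence squared differences contract by \<open>lam / e\<close> per generation, weighted exactly
  as in the walk integrals \<open>V\<^sub>k\<close>. As \<open>(lam / e)\<^sup>k V\<^sub>k < 1\<close> for some \<open>k\<close>, the ratios \<open>r\<close> depend
  exponentially little on distant activities. Revealing the configuration in \<open>\<Lambda>\<close> cell by cell then costs
  in total variation at most the difference of the one-point densities times the volume of the cell, up to
  second-order terms that vanish as the cells shrink.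
\<close>

subsection \<open>Estimates for real integrals\<close>

text \<open>The bound \<open>|exp (- s) - exp (- s')| \<le> |s - s'|\<close> alone would lose the
  factor e in the threshold; working with \<open>y\<close> recovers it. Squared differences also add
  up linearly under the integral, so the weights of successive generations simply multiply. Any
  order of switching on the interaction would give some recursion; the order by distance is what
  produces the condition |v_j - v_i| < |v_i - v_(i+1)| in V_k. The obstacle is that the recursion
  leaves the given activity: each generation sees a further damped one. The induction therefore runs
  over all activities bounded by \<open>lam\<close> at once. Both compared activities are always
  damped by the same factor, so they keep agreeing wherever they agreed. No derivative of ln Z is
  formed. Series of nonnegative terms give two-sided bounds for Z(a + m) whose gap is quadratic in
  the mass of \<open>m\<close>; a function whose increments over thin shells are quadratic in the
  shell volume is constant, which yields the exact recursion. The same bounds control the revealing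
  of one cell. Sums and integrals take extended nonnegative values, so that they may be exchanged
  before finiteness is known.\<close>

lemma ln_one_plus_bound:
  assumes "0 \<le> (x::real)" shows "\<bar>ln (1 + x) - x\<bar> \<le> x\<^sup>2"
proof -
  have "x - x\<^sup>2 \<le> ln (1 + x)" using ln_one_plus_pos_lower_bound[of x] assms
    by (cases "x \<le> 1") (auto simp: power2_eq_square intro: order_trans[of _ 0] mult_left_mono[of 1 x x, simplified])
  moreover have "ln (1 + x) \<le> x" using assms by (rule ln_add_one_self_le_self)
  ultimately show ?thesis by auto
qed

text \<open>Arithmetic of a normalised expectation: \<open>e\<close> is the value with an empty
  cell, \<open>p\<close> the first-order weight of one point in it, \<open>Q\<close> the
  contribution of that point, and \<open>\<theta>\<close>, \<open>\<theta>1\<close> are the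
  second-order remainders of numerator and denominator. The error has numerator
  \<open>\<theta> + e * p\<^sup>2 - (Q * p + F * \<theta>1)\<close>; both groups lie between 0 and
  \<open>3 * \<mu>\<^sup>2\<close>, hence so does the modulus of their difference.\<close>

lemma first_order_expectation_bound:
  fixes e Q p \<theta> \<theta>1 :: real
  assumes "0 \<le> e" "e \<le> 1" "0 \<le> Q" "Q \<le> p" "p \<le> \<mu>" "\<mu> \<le> 1/2" "0 \<le> \<theta>" "\<theta> \<le> 2 * \<mu>\<^sup>2" "0 \<le> \<theta>1" "\<theta>1 \<le> 2 * \<mu>\<^sup>2"
  shows "\<bar>(e + Q + \<theta>) / (1 + p + \<theta>1) - (e * (1 - p) + Q)\<bar> \<le> 3 * \<mu>\<^sup>2"
proof -
  define F where "F = e * (1 - p) + Q"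
  define num where "num = \<theta> + e * p\<^sup>2 - (Q * p + F * \<theta>1)"
  have p0: "0 \<le> p" "p \<le> 1" using assms by auto
  have "F \<le> 1 * (1 - p) + p"
    unfolding F_def using assms p0 by (intro add_mono mult_right_mono) auto
  then have F: "0 \<le> F" "F \<le> 1"
    using assms p0 unfolding F_def by auto
  have pp: "p\<^sup>2 \<le> \<mu>\<^sup>2" using assms p0 by (intro power_mono) auto
  have "e * p\<^sup>2 \<le> 1 * p\<^sup>2" using assms by (intro mult_right_mono) auto
  then have up: "\<theta> + e * p\<^sup>2 \<le> 3 * \<mu>\<^sup>2" using pp assms by linarith
  have "Q * p \<le> p * p" using assms p0 by (intro mult_right_mono) auto
  moreover have "F * \<theta>1 \<le> 1 * \<theta>1" using F assms by (intro mult_right_mono) auto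
  ultimately have lo: "Q * p + F * \<theta>1 \<le> 3 * \<mu>\<^sup>2" using pp assms by (simp add: power2_eq_square)
  have "0 \<le> \<theta> + e * p\<^sup>2" "0 \<le> Q * p + F * \<theta>1" using assms p0 F by auto
  then have num: "\<bar>num\<bar> \<le> 3 * \<mu>\<^sup>2" unfolding num_def using up lo by linarith
  have D: "1 \<le> 1 + p + \<theta>1" using p0 assms by simp
  have "(e + Q + \<theta>) / (1 + p + \<theta>1) - F = num / (1 + p + \<theta>1)"
    using D unfolding num_def F_def by (simp add: field_simps power2_eq_square)
  then have "\<bar>(e + Q + \<theta>) / (1 + p + \<theta>1) - F\<bar> = \<bar>num\<bar> / (1 + p + \<theta>1)"
    using D by simp
  also have "\<dots> \<le> \<bar>num\<bar> / 1" using D by (intro divide_left_mono) auto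
  finally show ?thesis using num unfolding F_def by simp
qed

text \<open>Cutting the ball of radius \<open>R\<close> into \<open>N\<close> shells of equal volume
  leaves a total change of at most \<open>N * K * (c / N)\<^sup>2\<close>, which tends to 0.
  Increments are measured by \<open>t ^ d\<close> because that is how the volume of a shell grows;
  the threshold \<open>\<eta>\<close> only demands that \<open>N\<close> be large.\<close>

lemma constant_by_quadratic_increments:
  fixes F :: "real \<Rightarrow> real"
  assumes R: "0 < R" and d: "0 < d" and \<kappa>: "0 \<le> \<kappa>" and \<eta>: "0 < \<eta>" 
    and F: "\<And>s t. 0 \<le> s \<Longrightarrow> s \<le> t \<Longrightarrow> \<kappa> * (t ^ d - s ^ d) \<le> \<eta> \<Longrightarrow> \<bar>F t - F s\<bar> \<le> K * (\<kappa> * (t ^ d - s ^ d))\<^sup>2"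
  shows "F R = F 0"
proof -
  define c where "c = \<kappa> * R ^ d"
  have bound: "\<bar>F R - F 0\<bar> \<le> K * c\<^sup>2 * inverse (real (Suc N))" if N: "c / \<eta> \<le> real N" for N
  proof -
    let ?n = "Suc N"
    \<comment> \<open>These radii make all increments of \<open>\<kappa> t\<^sup>d\<close> equal.\<close>
    define t where "t i = R * root d (real i / real ?n)" for i :: nat
    have tpow: "t i ^ d = R ^ d * (real i / real ?n)" for i
      unfolding t_def power_mult_distrib using d by (simp add: real_root_pow_pos2)
    have t0: "t 0 = 0" "t ?n = R" using d unfolding t_def by (simp_all del: of_nat_Suc)
    have tmono: "0 \<le> t i" "t i \<le> t (Suc i)" for i
      using R d unfolding t_def by (auto intro!: mult_left_mono divide_right_mono simp: real_root_le_iff)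
    have inc: "\<kappa> * (t (Suc i) ^ d - t i ^ d) = c / real ?n" for i
      unfolding tpow c_def by (simp add: mult.assoc right_diff_distrib[symmetric] diff_divide_distrib[symmetric])
    have "c \<le> \<eta> * real N" using N \<eta> by (simp add: pos_divide_le_eq mult.commute)
    also have "\<dots> \<le> \<eta> * real ?n" using \<eta> by (intro mult_left_mono) auto
    finally have "c / real ?n \<le> \<eta>" by (simp add: pos_divide_le_eq del: of_nat_Suc)
    then have step: "\<bar>F (t (Suc i)) - F (t i)\<bar> \<le> K * (c / real ?n)\<^sup>2" for i
      using F[OF tmono(1)[of i] tmono(2)[of i]] unfolding inc by simp
    have "\<bar>F R - F 0\<bar> = \<bar>\<Sum>i<?n. F (t (Suc i)) - F (t i)\<bar>"
      by (simp only: sum_lessThan_telescope[of "\<lambda>i. F (t i)" ?n] t0)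
    also have "\<dots> \<le> (\<Sum>i<?n. \<bar>F (t (Suc i)) - F (t i)\<bar>)" by (rule sum_abs)
    also have "\<dots> \<le> (\<Sum>i<?n. K * (c / real ?n)\<^sup>2)" by (intro sum_mono step)
    also have "\<dots> = K * c\<^sup>2 * inverse (real ?n)"
      by (simp add: power2_eq_square divide_simps del: of_nat_Suc)
    finally show ?thesis .
  qed
  have "(\<lambda>N. K * c\<^sup>2 * inverse (real (Suc N))) \<longlonglongrightarrow> K * c\<^sup>2 * 0"
    by (intro tendsto_mult_left LIMSEQ_inverse_real_of_nat)
  moreover have "eventually (\<lambda>N. \<bar>F R - F 0\<bar> \<le> K * c\<^sup>2 * inverse (real (Suc N))) sequentially"
  proof (rule eventually_sequentiallyI[of "nat \<lceil>c / \<eta>\<rceil>"])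
    fix N assume "nat \<lceil>c / \<eta>\<rceil> \<le> N"
    then show "\<bar>F R - F 0\<bar> \<le> K * c\<^sup>2 * inverse (real (Suc N))"
      by (intro bound) linarith
  qed
  ultimately have "\<bar>F R - F 0\<bar> \<le> K * c\<^sup>2 * 0"
    by (intro tendsto_lowerbound[where F=sequentially]) auto
  then show ?thesis by simp
qed

text \<open>The modulus of the derivative, \<open>|x| * exp (- x\<^sup>2 / 2)\<close>, peaks at
  \<open>x = 1\<close>. The square of this sharp constant is the factor 1/e per generation, hence
  the e in the threshold.\<close>

lemma exp_neg_half_square_lipschitz:
  "\<bar>exp (- (p::real)\<^sup>2 / 2) - exp (- q\<^sup>2 / 2)\<bar> \<le> exp (- 1 / 2) * \<bar>p - q\<bar>"
proof -
  have bd: "\<bar>x * exp (- x\<^sup>2 / 2)\<bar> \<le> exp (- 1 / 2)" for x :: real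
  proof -
    \<comment> \<open>The tangent bound \<open>1 + u \<le> exp u\<close> at
      \<open>u = x\<^sup>2 - 1\<close>, with equality exactly at the maximiser.\<close>
    have "x\<^sup>2 \<le> exp (x\<^sup>2 - 1)" using exp_ge_add_one_self[of "x\<^sup>2 - 1"] by simp
    then have "(x * exp (- x\<^sup>2 / 2))\<^sup>2 \<le> exp (x\<^sup>2 - 1) * (exp (- x\<^sup>2 / 2))\<^sup>2"
      unfolding power_mult_distrib by (intro mult_right_mono) auto
    also have "\<dots> = exp (- 1 / 2) ^ 2"
      unfolding exp_double[symmetric] exp_add[symmetric] by (simp add: exp_add[symmetric])
    finally show ?thesis by (simp add: abs_le_square_iff[symmetric])
  qed
  have "norm (exp (- p\<^sup>2 / 2) - exp (- q\<^sup>2 / 2)) \<le> exp (- 1 / 2) * norm (p - q)"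
  proof (rule field_differentiable_bound[of UNIV _ "\<lambda>x. - (x * exp (- x\<^sup>2 / 2))"])
    show "((\<lambda>x. exp (- x\<^sup>2 / 2)) has_field_derivative - (x * exp (- x\<^sup>2 / 2))) (at x within UNIV)" for x :: real
      by (auto intro!: derivative_eq_intros)
  qed (use bd in auto)
  then show ?thesis by simp
qed

lemma Cauchy_Schwarz_integral_bounded:
  fixes y y' :: "'b \<Rightarrow> real"
  assumes "finite_measure N" and [measurable]: "y \<in> borel_measurable N" "y' \<in> borel_measurable N"
    and y: "\<And>w. 0 \<le> y w" "\<And>w. y w \<le> 1" and y': "\<And>w. 0 \<le> y' w" "\<And>w. y' w \<le> 1"
  shows "(LINT w|N. y w * y' w)\<^sup>2 \<le> (LINT w|N. (y w)\<^sup>2) * (LINT w|N. (y' w)\<^sup>2)"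
proof -
  interpret finite_measure N by fact
  have int: "integrable N (\<lambda>w. y w * y' w)" "integrable N (\<lambda>w. (y w)\<^sup>2)" "integrable N (\<lambda>w. (y' w)\<^sup>2)"
    using y y' by (auto intro!: integrable_const_bound[of _ 1] AE_I2 mult_le_one power_le_one)
  have "(\<integral>\<^sup>+ w. ennreal (y w) * ennreal (y' w) \<partial>N)\<^sup>2 \<le> (\<integral>\<^sup>+ w. (ennreal (y w))\<^sup>2 \<partial>N) * (\<integral>\<^sup>+ w. (ennreal (y' w))\<^sup>2 \<partial>N)"
    by (rule Cauchy_Schwarz_nn_integral) auto
  also have "(\<integral>\<^sup>+ w. ennreal (y w) * ennreal (y' w) \<partial>N) = ennreal (LINT w|N. y w * y' w)"
    using y y' by (subst nn_integral_eq_integral[OF int(1), symmetric]) (auto simp: ennreal_mult)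
  also have "(\<integral>\<^sup>+ w. (ennreal (y w))\<^sup>2 \<partial>N) = ennreal (LINT w|N. (y w)\<^sup>2)"
    using y by (subst nn_integral_eq_integral[OF int(2), symmetric]) (auto simp: ennreal_power)
  also have "(\<integral>\<^sup>+ w. (ennreal (y' w))\<^sup>2 \<partial>N) = ennreal (LINT w|N. (y' w)\<^sup>2)"
    using y' by (subst nn_integral_eq_integral[OF int(3), symmetric]) (auto simp: ennreal_power)
  finally show ?thesis
    using y y' by (simp add: ennreal_power ennreal_mult[symmetric] integral_nonneg_AE)
qed

text \<open>With \<open>p\<close> and \<open>q\<close> the L2 norms of \<open>y\<close> and
  \<open>y'\<close>, the left side is a squared difference of \<open>exp (- p\<^sup>2 / 2)\<close>.
  The Lipschitz bound reduces it to \<open>(p - q)\<^sup>2\<close>, and the reverse triangle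
  inequality, here obtained from Cauchy-Schwarz, to the squared norm of
  \<open>y - y'\<close>.\<close>

lemma exp_integral_square_contraction:
  fixes y y' :: "'b \<Rightarrow> real"
  assumes "finite_measure N" and [measurable]: "y \<in> borel_measurable N" "y' \<in> borel_measurable N"
    and y: "\<And>w. 0 \<le> y w" "\<And>w. y w \<le> 1" and y': "\<And>w. 0 \<le> y' w" "\<And>w. y' w \<le> 1"
  shows "(exp (- (LINT w|N. (y w)\<^sup>2) / 2) - exp (- (LINT w|N. (y' w)\<^sup>2) / 2))\<^sup>2
    \<le> exp (- 1) * (LINT w|N. (y w - y' w)\<^sup>2)"
proof -
  interpret finite_measure N by fact
  define s s' c where "s = (LINT w|N. (y w)\<^sup>2)" and "s' = (LINT w|N. (y' w)\<^sup>2)" and "c = (LINT w|N. y w * y' w)"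
  have int: "integrable N (\<lambda>w. y w * y' w)" "integrable N (\<lambda>w. (y w)\<^sup>2)" "integrable N (\<lambda>w. (y' w)\<^sup>2)"
    using y y' by (auto intro!: integrable_const_bound[of _ 1] AE_I2 mult_le_one power_le_one)
  have nn: "0 \<le> s" "0 \<le> s'" unfolding s_def s'_def by (auto intro: integral_nonneg_AE)
  have "c\<^sup>2 \<le> s * s'" unfolding s_def s'_def c_def by (rule Cauchy_Schwarz_integral_bounded) fact+
  then have "c \<le> sqrt (s * s')" by (rule real_le_rsqrt)
  then have "(sqrt s - sqrt s')\<^sup>2 \<le> s + s' - 2 * c"
    using nn by (simp add: power2_diff real_sqrt_mult)
  also have "\<dots> = (LINT w|N. (y w)\<^sup>2 + (y' w)\<^sup>2 - 2 * (y w * y' w))"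
    unfolding s_def s'_def c_def using int by simp
  also have "\<dots> = (LINT w|N. (y w - y' w)\<^sup>2)"
    by (simp add: power2_diff mult.assoc)
  finally have 1: "(sqrt s - sqrt s')\<^sup>2 \<le> (LINT w|N. (y w - y' w)\<^sup>2)" .
  have "\<bar>exp (- s / 2) - exp (- s' / 2)\<bar> \<le> exp (- 1 / 2) * \<bar>sqrt s - sqrt s'\<bar>"
    using exp_neg_half_square_lipschitz[of "sqrt s" "sqrt s'"] nn by simp
  then have "\<bar>exp (- s / 2) - exp (- s' / 2)\<bar>\<^sup>2 \<le> (exp (- 1 / 2) * \<bar>sqrt s - sqrt s'\<bar>)\<^sup>2"
    by (rule power_mono) simp
  also have "\<dots> = exp (- 1) * (sqrt s - sqrt s')\<^sup>2"
    by (simp add: power_mult_distrib exp_double[symmetric])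
  also have "\<dots> \<le> exp (- 1) * (LINT w|N. (y w - y' w)\<^sup>2)" using 1 by simp
  finally show ?thesis unfolding s_def s'_def by simp
qed

lemma small_partition:
  fixes L :: "'a::euclidean_space set"
  assumes L: "L \<in> sets borel" "bounded L" and \<delta>: "0 < \<delta>"
  obtains C :: "nat \<Rightarrow> 'a set" and n :: nat
  where "\<And>i. C i \<in> sets borel" "\<And>i. C i \<subseteq> L" "\<And>i. measure lborel (C i) \<le> \<delta>"
    "L = (\<Union>i<n. C i)" "disjoint_family C"
proof -
  define v where "v = unit_ball_vol (real DIM('a))"
  have v: "0 < v" unfolding v_def by simp
  \<comment> \<open>Since \<open>r \<le> 1\<close>, the ball volume \<open>v * r ^ d\<close> is at
    most \<open>v * r \<le> \<delta>\<close>; no d-th root has to be taken.\<close>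
  define r where "r = min 1 (\<delta> / v)"
  have r: "0 < r" "r \<le> 1" "r \<le> \<delta> / v" using \<delta> v by (auto simp: r_def)
  have "v * r ^ DIM('a) \<le> v * r ^ 1"
    using r v by (intro mult_left_mono power_decreasing) (auto simp: Suc_leI)
  also have "\<dots> \<le> \<delta>" using r v by (simp add: pos_le_divide_eq mult.commute)
  finally have vr: "v * r ^ DIM('a) \<le> \<delta>" .
  have "compact (closure L)" using L by simp
  then obtain K where K: "finite K" "closure L \<subseteq> (\<Union>x\<in>K. ball x r)"
    using seq_compact_imp_totally_bounded[of "closure L"] r(1) by (auto simp: compact_eq_seq_compact_metric)
  obtain xs where xs: "set xs = K" using finite_list[OF K(1)] by blast
  define A where "A j = (if j < length xs then L \<inter> ball (xs ! j) r else {})" for j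
  have A: "A j \<in> sets borel" "A j \<subseteq> L" for j unfolding A_def using L by auto
  have Am: "measure lborel (disjointed A j) \<le> \<delta>" for j
  proof (cases "j < length xs")
    case True
    have "measure lborel (disjointed A j) \<le> measure lborel (ball (xs ! j) r)"
      using A disjointed_subset[of A j] True emeasure_bounded_finite[OF bounded_ball, of "xs ! j" r]
      by (intro measure_mono_fmeasurable fmeasurableI) (auto simp: A_def emeasure_lborel_ball_finite intro!: sets.range_disjointed_sets[unfolded image_subset_iff, rule_format])
    also have "\<dots> = v * r ^ DIM('a)" using r by (simp add: content_ball v_def)
    finally show ?thesis using vr by simp
  next
    case False
    then have "disjointed A j = {}" using disjointed_subset[of A j] by (simp add: A_def)
    then show ?thesis using \<delta> by simp
  qed
  show ?thesis
  proof (rule that[of "disjointed A" "length xs"])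
    show "disjointed A i \<in> sets borel" for i
      using sets.range_disjointed_sets[of A borel] A by auto
    show "disjointed A i \<subseteq> L" for i using disjointed_subset[of A i] A by blast
    show "L = (\<Union>i<length xs. disjointed A i)"
    proof -
      have "L \<subseteq> (\<Union>i<length xs. A i)"
      proof
        fix x assume x: "x \<in> L"
        then obtain y where "y \<in> set xs" "x \<in> ball y r" using K(2) closure_subset xs by blast
        then obtain i where "i < length xs" "x \<in> ball (xs ! i) r" by (metis in_set_conv_nth)
        then show "x \<in> (\<Union>i<length xs. A i)" using x by (auto simp: A_def)
      qed
      then have "L = (\<Union>i<length xs. A i)" using A by blast
      then show ?thesis using finite_UN_disjointed_eq[of A "length xs"] by (simp add: atLeast0LessThan)
    qed
  qed (use Am disjoint_family_disjointed in auto)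
qed

subsection \<open>Grand-canonical sums as iterated integrals\<close>

abbreviation conf_space :: "nat \<Rightarrow> (nat \<Rightarrow> 'a::euclidean_space) measure" where
  "conf_space k \<equiv> PiM {..<k} (\<lambda>_. lborel)"

text \<open>Functionals live on point sets, but integration takes place over tuples; so
  measurability, jointly in the parameter, is asked of the composition with the image map for every
  number of points, and \<open>'a set\<close> needs no sigma-algebra.\<close>

definition measurable_family :: "'p measure \<Rightarrow> ('p \<Rightarrow> 'a::euclidean_space set \<Rightarrow> ennreal) \<Rightarrow> bool" where
  "measurable_family M h \<longleftrightarrow>
    (\<forall>k. (\<lambda>(p, x). h p (x ` {..<k})) \<in> borel_measurable (M \<Otimes>\<^sub>M conf_space k))"

abbreviation measurable_functional :: "('a::euclidean_space set \<Rightarrow> ennreal) \<Rightarrow> bool" where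
  "measurable_functional h \<equiv> \<forall>k. (\<lambda>x. h (x ` {..<k})) \<in> borel_measurable (conf_space k)"

lemma measurable_family_const:
  "measurable_functional h \<Longrightarrow> measurable_family M (\<lambda>_. h)"
  unfolding measurable_family_def split_beta
  by (intro allI) (rule measurable_compose[OF measurable_snd], blast)

lemma measurable_family_at:
  assumes "measurable_family M h" "p \<in> space M"
  shows "measurable_functional (h p)"
proof
  fix k :: nat
  have "(\<lambda>x. case (p, x) of (p, x) \<Rightarrow> h p (x ` {..<k})) \<in> borel_measurable (conf_space k)"
    using assms unfolding measurable_family_def by (intro measurable_compose[OF measurable_Pair1']) auto
  then show "(\<lambda>x. h p (x ` {..<k})) \<in> borel_measurable (conf_space k)" by simp
qed

text \<open>Adding the point \<open>g p\<close> to \<open>k\<close> points is evaluating the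
  functional of \<open>k + 1\<close> coordinates with coordinate \<open>k\<close> set to
  \<open>g p\<close>, a measurable update.\<close>

lemma measurable_family_insert:
  assumes "measurable_family M h" "g \<in> M \<rightarrow>\<^sub>M lborel"
  shows "measurable_family M (\<lambda>p \<eta>. h p (insert (g p) \<eta>))"
  unfolding measurable_family_def
proof
  fix k :: nat
  let ?T = "\<lambda>(p, x). (p, x(k := g p))"
  have g[measurable]: "g \<in> M \<rightarrow>\<^sub>M lborel" by fact
  have eq: "{..<Suc k} = insert k {..<k}" by auto
  have "?T \<in> (M \<Otimes>\<^sub>M conf_space k) \<rightarrow>\<^sub>M (M \<Otimes>\<^sub>M conf_space (Suc k))"
    unfolding eq by measurable
  moreover have "(\<lambda>(p, x). h p (x ` {..<Suc k})) \<in> borel_measurable (M \<Otimes>\<^sub>M conf_space (Suc k))"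
    using assms unfolding measurable_family_def by blast
  ultimately have comp: "(\<lambda>z. (\<lambda>(p, x). h p (x ` {..<Suc k})) (?T z)) \<in> borel_measurable (M \<Otimes>\<^sub>M conf_space k)"
    by (rule measurable_compose)
  have upd: "(x(k := g p)) ` {..<Suc k} = insert (g p) (x ` {..<k})" for x p
    unfolding eq by auto
  have "(\<lambda>z. (\<lambda>(p, x). h p (x ` {..<Suc k})) (?T z)) =
      (\<lambda>(p, x). h p (insert (g p) (x ` {..<k})))"
    by (auto simp: fun_eq_iff upd simp del: fun_upd_apply)
  with comp show "(\<lambda>(p, x). h p (insert (g p) (x ` {..<k}))) \<in> borel_measurable (M \<Otimes>\<^sub>M conf_space k)"
    by (simp only:)
qed

text \<open>\<open>b\<close> stands for exp(-\<phi>). The bounds 0 and 1 encode repulsion; the value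
  0 is allowed and means a hard core.\<close>

locale boltzmann_factor =
  fixes b :: "'a::euclidean_space \<Rightarrow> real"
  assumes b_measurable[measurable]: "b \<in> borel_measurable borel"
    and b_nonneg: "0 \<le> b x" and b_le_1: "b x \<le> 1" and b_minus: "b (- x) = b x"
begin

definition B :: "'a \<Rightarrow> 'a \<Rightarrow> ennreal" where "B w x = ennreal (b (w - x))"

lemma B_le_1: "B w x \<le> 1" unfolding B_def using b_le_1 by (simp add: ennreal_le_1)

lemma B_commute: "B w x = B x w" unfolding B_def using b_minus[of "w - x"] by simp

lemma B_measurable[measurable]: "(\<lambda>p. B (f p) (g p)) \<in> borel_measurable M"
  if [measurable]: "f \<in> borel_measurable M" "g \<in> borel_measurable M"
  unfolding B_def by measurable

abbreviation damp :: "('a \<Rightarrow> ennreal) \<Rightarrow> 'a \<Rightarrow> 'a \<Rightarrow> ennreal" where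
  "damp a w \<equiv> \<lambda>x. a x * B w x"

abbreviation add_point :: "('a set \<Rightarrow> ennreal) \<Rightarrow> 'a \<Rightarrow> 'a set \<Rightarrow> ennreal" where
  "add_point h w \<equiv> \<lambda>\<eta>. h (insert w \<eta>)"

text \<open>
  The points are integrated out one at a time, each damping the activity seen by the later ones. This
  makes it immediate that any of the points may be taken first, so no permutation of coordinates is needed.
\<close>

primrec W :: "nat \<Rightarrow> ('a \<Rightarrow> ennreal) \<Rightarrow> ('a set \<Rightarrow> ennreal) \<Rightarrow> ennreal" where
  "W 0 a h = h {}"
| "W (Suc k) a h = (\<integral>\<^sup>+ w. a w * W k (damp a w) (add_point h w) \<partial>lborel)"

definition Z :: "('a \<Rightarrow> ennreal) \<Rightarrow> ('a set \<Rightarrow> ennreal) \<Rightarrow> ennreal" where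
  "Z a h = (\<Sum>k. ennreal (1 / fact k) * W k a h)"

text \<open>Coordinate \<open>k\<close> is integrated last in the product and first in
  \<open>W\<close>; its interactions with the other coordinates are absorbed by
  \<open>damp a y\<close>, using the symmetry of \<open>B\<close>. The closed form links
  \<open>W\<close> to the Gibbs weight and turns measurability in parameters into a statement about
  one product integral.\<close>

lemma W_eq_integral:
  assumes "a \<in> borel_measurable borel" "measurable_functional h"
  shows "W k a h = (\<integral>\<^sup>+ x. h (x ` {..<k}) * (\<Prod>i<k. a (x i)) *
    (\<Prod>i<k. \<Prod>j\<in>{i<..<k}. B (x i) (x j)) \<partial>conf_space k)"
  using assms
proof (induction k arbitrary: a h)
  case 0
  interpret product_sigma_finite "\<lambda>_. lborel :: 'a measure" ..
  show ?case
    unfolding lessThan_0 by (subst nn_integral_empty) auto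
next
  case (Suc k)
  interpret product_sigma_finite "\<lambda>_. lborel :: 'a measure" ..
  have [measurable]: "a \<in> borel_measurable borel" by fact
  have fam: "measurable_family lborel (\<lambda>w. add_point h w)"
    by (rule measurable_family_insert[OF measurable_family_const]) (use Suc.prems in auto)
  define F where "F x = h (x ` {..<Suc k}) * (\<Prod>i<Suc k. a (x i)) *
    (\<Prod>i<Suc k. \<Prod>j\<in>{i<..<Suc k}. B (x i) (x j))" for x :: "nat \<Rightarrow> 'a"
  have eq: "{..<Suc k} = insert k {..<k}" by auto
  have F: "F \<in> borel_measurable (PiM (insert k {..<k}) (\<lambda>_. lborel))"
    unfolding eq[symmetric] F_def
    by (intro borel_measurable_times_ennreal) (use Suc.prems in simp, measurable)
  have Fupd: "F (x(k := y)) = a y * (h (insert y (x ` {..<k})) * (\<Prod>i<k. damp a y (x i)) *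
    (\<Prod>i<k. \<Prod>j\<in>{i<..<k}. B (x i) (x j)))" for x y
  proof -
    have 1: "(x(k := y)) ` {..<Suc k} = insert y (x ` {..<k})"
      unfolding eq by auto
    have 2: "(\<Prod>i<Suc k. a ((x(k := y)) i)) = (\<Prod>i<k. a (x i)) * a y"
      by simp
    have "(\<Prod>i<Suc k. \<Prod>j\<in>{i<..<Suc k}. B ((x(k := y)) i) ((x(k := y)) j))
      = (\<Prod>i<k. \<Prod>j\<in>{i<..<Suc k}. B ((x(k := y)) i) ((x(k := y)) j))"
      by simp
    also have "\<dots> = (\<Prod>i<k. B y (x i) * (\<Prod>j\<in>{i<..<k}. B (x i) (x j)))"
    proof (rule prod.cong)
      fix i assume "i \<in> {..<k}"
      then have "{i<..<Suc k} = insert k {i<..<k}" by auto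
      with \<open>i \<in> {..<k}\<close> show "(\<Prod>j\<in>{i<..<Suc k}. B ((x(k := y)) i) ((x(k := y)) j))
        = B y (x i) * (\<Prod>j\<in>{i<..<k}. B (x i) (x j))"
        by (auto simp: B_commute[of y "x i"] intro!: prod.cong)
    qed simp
    finally show ?thesis unfolding F_def 1 2 by (simp add: prod.distrib mult_ac)
  qed
  have "(\<integral>\<^sup>+ x. F x \<partial>conf_space (Suc k)) = (\<integral>\<^sup>+ y. \<integral>\<^sup>+ x. F (x(k := y)) \<partial>conf_space k \<partial>lborel)"
    unfolding eq by (rule product_nn_integral_insert_rev[OF _ _ F]) auto
  also have "\<dots> = (\<integral>\<^sup>+ y. a y * W k (damp a y) (add_point h y) \<partial>lborel)"
  proof (rule nn_integral_cong)
    fix y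
    have h: "measurable_functional (add_point h y)" using measurable_family_at[OF fam, of y] by simp
    have "W k (damp a y) (add_point h y) = (\<integral>\<^sup>+ x. h (insert y (x ` {..<k})) * (\<Prod>i<k. damp a y (x i)) *
      (\<Prod>i<k. \<Prod>j\<in>{i<..<k}. B (x i) (x j)) \<partial>conf_space k)"
      by (rule Suc.IH) (measurable, rule h)
    moreover have "(\<lambda>x. h (insert y (x ` {..<k})) * (\<Prod>i<k. damp a y (x i)) *
      (\<Prod>i<k. \<Prod>j\<in>{i<..<k}. B (x i) (x j))) \<in> borel_measurable (conf_space k)"
      by (intro borel_measurable_times_ennreal) (use h in simp, measurable)
    ultimately show "(\<integral>\<^sup>+ x. F (x(k := y)) \<partial>conf_space k) = a y * W k (damp a y) (add_point h y)"
      unfolding Fupd by (simp add: nn_integral_cmult del: W.simps)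
  qed
  finally show ?case unfolding F_def by simp
qed

lemma W_measurable:
  assumes A: "(\<lambda>(p, x). A p x) \<in> borel_measurable (M \<Otimes>\<^sub>M lborel)" and h: "measurable_family M h"
  shows "(\<lambda>p. W k (A p) (h p)) \<in> borel_measurable M"
proof -
  interpret product_sigma_finite "\<lambda>_. lborel :: 'a measure" ..
  interpret C: sigma_finite_measure "conf_space k :: (nat \<Rightarrow> 'a) measure" by (rule sigma_finite) simp
  note A[measurable]
  have h': "(\<lambda>z. h (fst z) (snd z ` {..<k})) \<in> borel_measurable (M \<Otimes>\<^sub>M conf_space k)"
    using h unfolding measurable_family_def split_beta by (rule spec)
  have "W k (A p) (h p) = (\<integral>\<^sup>+ x. h p (x ` {..<k}) * (\<Prod>i<k. A p (x i)) *
    (\<Prod>i<k. \<Prod>j\<in>{i<..<k}. B (x i) (x j)) \<partial>conf_space k)" if p: "p \<in> space M" for p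
    by (rule W_eq_integral[OF _ measurable_family_at[OF h p]])
      (use measurable_compose[OF measurable_Pair1'[OF p] A] in simp)
  moreover have "(\<lambda>p. \<integral>\<^sup>+ x. h p (x ` {..<k}) * (\<Prod>i<k. A p (x i)) *
    (\<Prod>i<k. \<Prod>j\<in>{i<..<k}. B (x i) (x j)) \<partial>conf_space k) \<in> borel_measurable M"
    by (intro C.borel_measurable_nn_integral, unfold split_beta, intro borel_measurable_times_ennreal h')
      measurable
  ultimately show ?thesis by (simp cong: measurable_cong)
qed

lemma Z_measurable:
  assumes "(\<lambda>(p, x). A p x) \<in> borel_measurable (M \<Otimes>\<^sub>M lborel)" "measurable_family M h"
  shows "(\<lambda>p. Z (A p) (h p)) \<in> borel_measurable M"
proof -
  note [measurable] = W_measurable[OF assms]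
  show ?thesis unfolding Z_def by measurable
qed

lemma W_mono:
  assumes "\<And>x. a x \<le> a' x" "\<And>\<eta>. h \<eta> \<le> h' \<eta>"
  shows "W k a h \<le> W k a' h'"
  using assms
proof (induction k arbitrary: a a' h h')
  case (Suc k)
  show ?case unfolding W.simps
    by (intro nn_integral_mono mult_mono Suc.IH Suc.prems) (auto intro!: mult_right_mono Suc.prems)
qed simp

lemma Z_mono:
  assumes "\<And>x. a x \<le> a' x" "\<And>\<eta>. h \<eta> \<le> h' \<eta>"
  shows "Z a h \<le> Z a' h'"
  unfolding Z_def by (intro suminf_le mult_left_mono W_mono assms) auto

lemma W_cmult:
  assumes [measurable]: "a \<in> borel_measurable borel" and "measurable_functional h"
  shows "W k a (\<lambda>\<eta>. c * h \<eta>) = c * W k a h"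
  using assms
proof (induction k arbitrary: a h)
  case (Suc k)
  have [measurable]: "a \<in> borel_measurable borel" by fact
  have fam: "measurable_family lborel (\<lambda>w. add_point h w)"
    by (rule measurable_family_insert[OF measurable_family_const]) (use Suc.prems in auto)
  have [measurable]: "(\<lambda>w. W k (damp a w) (add_point h w)) \<in> borel_measurable lborel"
    by (rule W_measurable[OF _ fam]) measurable
  have "W k (damp a w) (\<lambda>\<eta>. c * h (insert w \<eta>)) = c * W k (damp a w) (add_point h w)" for w
    by (rule Suc.IH) (use measurable_family_at[OF fam] in auto)
  then show ?case unfolding W.simps
    by (subst nn_integral_cmult[symmetric]) (auto simp: mult_ac)
qed simp

text \<open>Multiply out the factors \<open>a + m\<close> and keep the terms with at most one point
  drawn from \<open>m\<close>; the rest is nonnegative. The factor \<open>Suc k\<close> counts the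
  positions of that point. It can be moved to the front by exchanging integrals, since successive
  dampings and insertions commute.\<close>

lemma W_add_ge:
  assumes "a \<in> borel_measurable borel" "m \<in> borel_measurable borel" "measurable_functional h"
  shows "W (Suc k) a h + of_nat (Suc k) * (\<integral>\<^sup>+ w. m w * W k (damp a w) (add_point h w) \<partial>lborel)
    \<le> W (Suc k) (\<lambda>x. a x + m x) h"
  using assms
proof (induction k arbitrary: a m h)
  case 0
  have [measurable]: "a \<in> borel_measurable borel" "m \<in> borel_measurable borel" by fact+
  have fam: "measurable_family lborel (\<lambda>w. add_point h w)"
    by (rule measurable_family_insert[OF measurable_family_const]) (use 0 in auto)
  have [measurable]: "(\<lambda>w. h {w}) \<in> borel_measurable lborel"
    using W_measurable[OF _ fam, of "\<lambda>_ _. 0" 0] by simp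
  show ?case
    by (simp add: distrib_right nn_integral_add)
next
  case (Suc k)
  have [measurable]: "a \<in> borel_measurable borel" "m \<in> borel_measurable borel" by fact+
  let ?K = "of_nat (Suc k) :: ennreal"
  have fam: "measurable_family lborel (\<lambda>w. add_point h w)"
    by (rule measurable_family_insert[OF measurable_family_const]) (use Suc.prems in auto)
  have fam2: "measurable_family (lborel \<Otimes>\<^sub>M lborel) (\<lambda>z. add_point (add_point h (fst z)) (snd z))"
    by (rule measurable_family_insert, rule measurable_family_insert[OF measurable_family_const])
      (use Suc.prems in auto)
  have [measurable]: "(\<lambda>w. W (Suc k) (damp a w) (add_point h w)) \<in> borel_measurable lborel"
    by (rule W_measurable[OF _ fam]) measurable
  have mm: "(\<lambda>z. W k (damp (damp a (fst z)) (snd z)) (add_point (add_point h (fst z)) (snd z)))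
      \<in> borel_measurable (lborel \<Otimes>\<^sub>M lborel)"
    by (rule W_measurable[OF _ fam2]) measurable
  have [measurable]: "(\<lambda>(w, u). W k (damp (damp a w) u) (add_point (add_point h w) u))
      \<in> borel_measurable (lborel \<Otimes>\<^sub>M lborel)"
    using mm by (simp add: split_beta)
  have sw: "W k (damp (damp a w) u) (add_point (add_point h w) u)
      = W k (damp (damp a u) w) (add_point (add_point h u) w)" for w u
    by (simp add: mult_ac insert_commute)
  have "(\<integral>\<^sup>+ w. a w * (\<integral>\<^sup>+ u. damp m w u * W k (damp (damp a w) u) (add_point (add_point h w) u) \<partial>lborel) \<partial>lborel)
      = (\<integral>\<^sup>+ w. \<integral>\<^sup>+ u. a w * (damp m w u * W k (damp (damp a w) u) (add_point (add_point h w) u)) \<partial>lborel \<partial>lborel)"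
    by (subst nn_integral_cmult) auto
  also have "\<dots> = (\<integral>\<^sup>+ u. \<integral>\<^sup>+ w. a w * (damp m w u * W k (damp (damp a w) u) (add_point (add_point h w) u)) \<partial>lborel \<partial>lborel)"
    by (rule lborel_pair.Fubini'[symmetric]) measurable
  also have "\<dots> = (\<integral>\<^sup>+ u. \<integral>\<^sup>+ w. m u * (damp a u w * W k (damp (damp a u) w) (add_point (add_point h u) w)) \<partial>lborel \<partial>lborel)"
  proof (intro nn_integral_cong)
    fix u w :: 'a
    show "a w * (damp m w u * W k (damp (damp a w) u) (add_point (add_point h w) u))
       = m u * (damp a u w * W k (damp (damp a u) w) (add_point (add_point h u) w))"
      unfolding sw[of w u] B_commute[of w u] by (simp only: mult_ac)
  qed
  also have "\<dots> = (\<integral>\<^sup>+ u. m u * W (Suc k) (damp a u) (add_point h u) \<partial>lborel)"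
    by (subst nn_integral_cmult) auto
  finally have swap: "(\<integral>\<^sup>+ w. a w * (\<integral>\<^sup>+ u. damp m w u * W k (damp (damp a w) u) (add_point (add_point h w) u) \<partial>lborel) \<partial>lborel)
      = (\<integral>\<^sup>+ u. m u * W (Suc k) (damp a u) (add_point h u) \<partial>lborel)" .
  have "W (Suc (Suc k)) a h + of_nat (Suc (Suc k)) * (\<integral>\<^sup>+ w. m w * W (Suc k) (damp a w) (add_point h w) \<partial>lborel)
    = (\<integral>\<^sup>+ w. a w * W (Suc k) (damp a w) (add_point h w) \<partial>lborel)
       + ?K * (\<integral>\<^sup>+ w. m w * W (Suc k) (damp a w) (add_point h w) \<partial>lborel)
       + (\<integral>\<^sup>+ w. m w * W (Suc k) (damp a w) (add_point h w) \<partial>lborel)"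
    by (simp only: W.simps(2)[of "Suc k"] of_nat_Suc[of "Suc k"] distrib_right mult_1) (simp only: add_ac)
  also have "\<dots> = (\<integral>\<^sup>+ w. a w * (W (Suc k) (damp a w) (add_point h w)
       + ?K * (\<integral>\<^sup>+ u. damp m w u * W k (damp (damp a w) u) (add_point (add_point h w) u) \<partial>lborel))
       + m w * W (Suc k) (damp a w) (add_point h w) \<partial>lborel)"
    by (simp add: nn_integral_add distrib_left nn_integral_cmult mult.left_commute[of _ ?K] swap del: W.simps of_nat_Suc)
  also have "\<dots> \<le> (\<integral>\<^sup>+ w. a w * W (Suc k) (damp (\<lambda>x. a x + m x) w) (add_point h w)
       + m w * W (Suc k) (damp (\<lambda>x. a x + m x) w) (add_point h w) \<partial>lborel)"
  proof (intro nn_integral_mono add_mono mult_left_mono)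
    fix w
    have "W (Suc k) (damp a w) (add_point h w) + ?K * (\<integral>\<^sup>+ u. damp m w u * W k (damp (damp a w) u) (add_point (add_point h w) u) \<partial>lborel)
      \<le> W (Suc k) (\<lambda>x. damp a w x + damp m w x) (add_point h w)"
      by (rule Suc.IH) (use measurable_family_at[OF fam] in auto)
    then show "W (Suc k) (damp a w) (add_point h w) + ?K * (\<integral>\<^sup>+ u. damp m w u * W k (damp (damp a w) u) (add_point (add_point h w) u) \<partial>lborel)
      \<le> W (Suc k) (damp (\<lambda>x. a x + m x) w) (add_point h w)"
      by (simp only: distrib_right)
    show "W (Suc k) (damp a w) (add_point h w) \<le> W (Suc k) (damp (\<lambda>x. a x + m x) w) (add_point h w)"
      by (intro W_mono mult_right_mono) auto
  qed auto
  also have "\<dots> = W (Suc (Suc k)) (\<lambda>x. a x + m x) h"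
    unfolding W.simps(2)[of "Suc k"] by (simp only: distrib_right)
  finally show ?case .
qed

text \<open>The last term marks one point drawn from \<open>m\<close> and lets all others see
  \<open>a + m\<close>. A configuration with several points from \<open>m\<close> is counted once
  per such point, so at least once, and those without any are covered by the first term.\<close>

lemma W_add_le:
  assumes "a \<in> borel_measurable borel" "m \<in> borel_measurable borel" "measurable_functional h"
  shows "W (Suc k) (\<lambda>x. a x + m x) h \<le>
    W (Suc k) a h + of_nat (Suc k) * (\<integral>\<^sup>+ w. m w * W k (damp (\<lambda>x. a x + m x) w) (add_point h w) \<partial>lborel)"
  using assms
proof (induction k arbitrary: a m h)
  case 0
  have [measurable]: "a \<in> borel_measurable borel" "m \<in> borel_measurable borel" by fact+
  have fam: "measurable_family lborel (\<lambda>w. add_point h w)"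
    by (rule measurable_family_insert[OF measurable_family_const]) (use 0 in auto)
  have [measurable]: "(\<lambda>w. h {w}) \<in> borel_measurable lborel"
    using W_measurable[OF _ fam, of "\<lambda>_ _. 0" 0] by simp
  show ?case
    by (simp add: distrib_right nn_integral_add)
next
  case (Suc k)
  have [measurable]: "a \<in> borel_measurable borel" "m \<in> borel_measurable borel" by fact+
  let ?K = "of_nat (Suc k) :: ennreal"
  let ?s = "\<lambda>x. a x + m x"
  have fam: "measurable_family lborel (\<lambda>w. add_point h w)"
    by (rule measurable_family_insert[OF measurable_family_const]) (use Suc.prems in auto)
  have fam2: "measurable_family (lborel \<Otimes>\<^sub>M lborel) (\<lambda>z. add_point (add_point h (fst z)) (snd z))"
    by (rule measurable_family_insert, rule measurable_family_insert[OF measurable_family_const])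
      (use Suc.prems in auto)
  have [measurable]: "(\<lambda>w. W (Suc k) (damp a w) (add_point h w)) \<in> borel_measurable lborel"
      "(\<lambda>w. W (Suc k) (damp ?s w) (add_point h w)) \<in> borel_measurable lborel"
    by (rule W_measurable[OF _ fam]; measurable)+
  have mm: "(\<lambda>z. W k (damp (damp ?s (fst z)) (snd z)) (add_point (add_point h (fst z)) (snd z)))
      \<in> borel_measurable (lborel \<Otimes>\<^sub>M lborel)"
    by (rule W_measurable[OF _ fam2]) measurable
  have [measurable]: "(\<lambda>(w, u). W k (damp (damp ?s w) u) (add_point (add_point h w) u))
      \<in> borel_measurable (lborel \<Otimes>\<^sub>M lborel)"
    using mm by (simp add: split_beta)
  have sw: "W k (damp (damp ?s w) u) (add_point (add_point h w) u)
      = W k (damp (damp ?s u) w) (add_point (add_point h u) w)" for w u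
    by (simp add: mult_ac insert_commute)
  \<comment> \<open>Enlarging the outer \<open>a\<close> to \<open>a + m\<close> is what makes the
    inner integral, after the exchange, a complete \<open>W (Suc k)\<close> with activity
    \<open>damp ?s u\<close>.\<close>
  have "(\<integral>\<^sup>+ w. a w * (\<integral>\<^sup>+ u. damp m w u * W k (damp (damp ?s w) u) (add_point (add_point h w) u) \<partial>lborel) \<partial>lborel)
      \<le> (\<integral>\<^sup>+ w. \<integral>\<^sup>+ u. ?s w * (damp m w u * W k (damp (damp ?s w) u) (add_point (add_point h w) u)) \<partial>lborel \<partial>lborel)"
    by (subst nn_integral_cmult[symmetric]) (auto intro!: nn_integral_mono mult_right_mono)
  also have "\<dots> = (\<integral>\<^sup>+ u. \<integral>\<^sup>+ w. ?s w * (damp m w u * W k (damp (damp ?s w) u) (add_point (add_point h w) u)) \<partial>lborel \<partial>lborel)"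
    by (rule lborel_pair.Fubini'[symmetric]) measurable
  also have "\<dots> = (\<integral>\<^sup>+ u. \<integral>\<^sup>+ w. m u * (damp ?s u w * W k (damp (damp ?s u) w) (add_point (add_point h u) w)) \<partial>lborel \<partial>lborel)"
  proof (intro nn_integral_cong)
    fix u w :: 'a
    show "?s w * (damp m w u * W k (damp (damp ?s w) u) (add_point (add_point h w) u))
       = m u * (damp ?s u w * W k (damp (damp ?s u) w) (add_point (add_point h u) w))"
      unfolding sw[of w u] B_commute[of w u] by (simp only: mult_ac)
  qed
  also have "\<dots> = (\<integral>\<^sup>+ u. m u * W (Suc k) (damp ?s u) (add_point h u) \<partial>lborel)"
    by (subst nn_integral_cmult) auto
  finally have swap: "(\<integral>\<^sup>+ w. a w * (\<integral>\<^sup>+ u. damp m w u * W k (damp (damp ?s w) u) (add_point (add_point h w) u) \<partial>lborel) \<partial>lborel)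
      \<le> (\<integral>\<^sup>+ u. m u * W (Suc k) (damp ?s u) (add_point h u) \<partial>lborel)" .
  have "W (Suc (Suc k)) ?s h = (\<integral>\<^sup>+ w. a w * W (Suc k) (damp ?s w) (add_point h w)
       + m w * W (Suc k) (damp ?s w) (add_point h w) \<partial>lborel)"
    unfolding W.simps(2)[of "Suc k"] by (simp only: distrib_right)
  also have "\<dots> \<le> (\<integral>\<^sup>+ w. a w * (W (Suc k) (damp a w) (add_point h w)
       + ?K * (\<integral>\<^sup>+ u. damp m w u * W k (damp (damp ?s w) u) (add_point (add_point h w) u) \<partial>lborel))
       + m w * W (Suc k) (damp ?s w) (add_point h w) \<partial>lborel)"
  proof (intro nn_integral_mono add_mono mult_left_mono)
    fix w
    have "W (Suc k) (\<lambda>x. damp a w x + damp m w x) (add_point h w) \<le> W (Suc k) (damp a w) (add_point h w) +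
       ?K * (\<integral>\<^sup>+ u. damp m w u * W k (damp (\<lambda>x. damp a w x + damp m w x) u) (add_point (add_point h w) u) \<partial>lborel)"
      by (rule Suc.IH) (use measurable_family_at[OF fam] in auto)
    then show "W (Suc k) (damp ?s w) (add_point h w) \<le> W (Suc k) (damp a w) (add_point h w) +
       ?K * (\<integral>\<^sup>+ u. damp m w u * W k (damp (damp ?s w) u) (add_point (add_point h w) u) \<partial>lborel)"
      by (simp only: distrib_right)
  qed auto
  also have "\<dots> = (\<integral>\<^sup>+ w. a w * W (Suc k) (damp a w) (add_point h w) \<partial>lborel)
       + ?K * (\<integral>\<^sup>+ w. a w * (\<integral>\<^sup>+ u. damp m w u * W k (damp (damp ?s w) u) (add_point (add_point h w) u) \<partial>lborel) \<partial>lborel)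
       + (\<integral>\<^sup>+ w. m w * W (Suc k) (damp ?s w) (add_point h w) \<partial>lborel)"
    by (simp add: nn_integral_add distrib_left nn_integral_cmult mult.left_commute[of _ ?K] del: W.simps of_nat_Suc)
  also have "\<dots> \<le> (\<integral>\<^sup>+ w. a w * W (Suc k) (damp a w) (add_point h w) \<partial>lborel)
       + ?K * (\<integral>\<^sup>+ w. m w * W (Suc k) (damp ?s w) (add_point h w) \<partial>lborel)
       + (\<integral>\<^sup>+ w. m w * W (Suc k) (damp ?s w) (add_point h w) \<partial>lborel)"
    using swap by (intro add_mono mult_left_mono) auto
  also have "\<dots> = W (Suc (Suc k)) a h + of_nat (Suc (Suc k)) * (\<integral>\<^sup>+ w. m w * W (Suc k) (damp ?s w) (add_point h w) \<partial>lborel)"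
    by (simp only: W.simps(2)[of "Suc k"] of_nat_Suc[of "Suc k"] distrib_right mult_1) (simp only: add_ac)
  finally show ?case .
qed

section \<open>Summation over the number of points\<close>

lemma Z_split: "Z a h = h {} + (\<Sum>k. ennreal (1 / fact (Suc k)) * W (Suc k) a h)"
proof -
  have "(\<lambda>k. ennreal (1 / fact k) * W k a h) sums
      (h {} + (\<Sum>k. ennreal (1 / fact (Suc k)) * W (Suc k) a h))"
    using sums_Suc[OF summable_sums[OF summableI[of "\<lambda>k. ennreal (1 / fact (Suc k)) * W (Suc k) a h"]]]
    by (simp add: add.commute del: W.simps(2))
  then show ?thesis unfolding Z_def by (rule sums_unique[symmetric])
qed

text \<open>The choice of the marked point among \<open>Suc k\<close> turns the weight of
  \<open>Suc k\<close> points into that of the \<open>k\<close> remaining ones, so that these sum to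
  a \<open>Z\<close> again.\<close>

lemma fact_Suc_cancel:
  "ennreal (1 / fact (Suc k)) * (of_nat (Suc k) * x) = ennreal (1 / fact k) * x"
proof -
  have "ennreal (1 / fact (Suc k)) * of_nat (Suc k) = ennreal (1 / fact k)"
  proof -
    have "1 / fact (Suc k) * real (Suc k) = 1 / fact k"
      unfolding fact_Suc of_nat_mult by (metis mult.commute mult.right_neutral nonzero_mult_divide_mult_cancel_left nat.simps(3) of_nat_eq_0_iff times_divide_eq_left of_nat_fact)
    then show ?thesis
      by (subst ennreal_of_nat_eq_real_of_nat, subst ennreal_mult[symmetric]) (auto simp del: of_nat_Suc fact_Suc)
  qed
  then show ?thesis by (simp only: mult.assoc[symmetric])
qed

lemma nn_integral_Z:
  assumes [measurable]: "m \<in> borel_measurable borel" "a \<in> borel_measurable borel" and h: "measurable_functional h"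
  shows "(\<Sum>k. ennreal (1 / fact k) * (\<integral>\<^sup>+ w. m w * W k (damp a w) (add_point h w) \<partial>lborel))
    = (\<integral>\<^sup>+ w. m w * Z (damp a w) (add_point h w) \<partial>lborel)"
proof -
  have fam: "measurable_family lborel (\<lambda>w. add_point h w)"
    by (rule measurable_family_insert[OF measurable_family_const]) (use h in auto)
  have [measurable]: "(\<lambda>w. W k (damp a w) (add_point h w)) \<in> borel_measurable lborel" for k
    by (rule W_measurable[OF _ fam]) measurable
  have "(\<integral>\<^sup>+ w. m w * Z (damp a w) (add_point h w) \<partial>lborel)
    = (\<integral>\<^sup>+ w. (\<Sum>k. ennreal (1 / fact k) * (m w * W k (damp a w) (add_point h w))) \<partial>lborel)"
    unfolding Z_def by (subst ennreal_suminf_cmult[symmetric]) (simp only: mult.left_commute)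
  also have "\<dots> = (\<Sum>k. \<integral>\<^sup>+ w. ennreal (1 / fact k) * (m w * W k (damp a w) (add_point h w)) \<partial>lborel)"
    by (rule nn_integral_suminf) measurable
  also have "\<dots> = (\<Sum>k. ennreal (1 / fact k) * (\<integral>\<^sup>+ w. m w * W k (damp a w) (add_point h w) \<partial>lborel))"
    by (intro suminf_cong nn_integral_cmult) measurable
  finally show ?thesis ..
qed

text \<open>Together with \<open>Z_add_le\<close> this encloses the change of \<open>Z\<close>
  caused by an added activity \<open>m\<close>. The two bounds differ only in whether the remaining
  points see \<open>a\<close> or \<open>a + m\<close>, an effect of second order in
  \<open>m\<close>.\<close>

lemma Z_add_ge:
  assumes [measurable]: "a \<in> borel_measurable borel" "m \<in> borel_measurable borel" and h: "measurable_functional h"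
  shows "Z a h + (\<integral>\<^sup>+ w. m w * Z (damp a w) (add_point h w) \<partial>lborel) \<le> Z (\<lambda>x. a x + m x) h"
proof -
  have "Z a h + (\<integral>\<^sup>+ w. m w * Z (damp a w) (add_point h w) \<partial>lborel) = h {} +
    (\<Sum>k. ennreal (1 / fact (Suc k)) * (W (Suc k) a h + of_nat (Suc k) *
       (\<integral>\<^sup>+ w. m w * W k (damp a w) (add_point h w) \<partial>lborel)))"
    unfolding nn_integral_Z[OF assms(2,1,3), symmetric] Z_split[of a] distrib_left fact_Suc_cancel
    by (subst suminf_add[symmetric]) (auto simp: add.assoc)
  also have "\<dots> \<le> Z (\<lambda>x. a x + m x) h"
    unfolding Z_split[of "\<lambda>x. a x + m x"] 
    by (intro add_left_mono suminf_le mult_left_mono W_add_ge assms) auto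
  finally show ?thesis .
qed

lemma Z_add_le:
  assumes [measurable]: "a \<in> borel_measurable borel" "m \<in> borel_measurable borel" and h: "measurable_functional h"
  shows "Z (\<lambda>x. a x + m x) h \<le> Z a h + (\<integral>\<^sup>+ w. m w * Z (damp (\<lambda>x. a x + m x) w) (add_point h w) \<partial>lborel)"
proof -
  have m: "(\<lambda>x. a x + m x) \<in> borel_measurable borel" by measurable
  have "Z (\<lambda>x. a x + m x) h \<le> h {} + (\<Sum>k. ennreal (1 / fact (Suc k)) * (W (Suc k) a h + of_nat (Suc k) *
       (\<integral>\<^sup>+ w. m w * W k (damp (\<lambda>x. a x + m x) w) (add_point h w) \<partial>lborel)))"
    unfolding Z_split[of "\<lambda>x. a x + m x"] 
    by (intro add_left_mono suminf_le mult_left_mono W_add_le assms) auto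
  also have "\<dots> = Z a h + (\<integral>\<^sup>+ w. m w * Z (damp (\<lambda>x. a x + m x) w) (add_point h w) \<partial>lborel)"
    unfolding nn_integral_Z[OF assms(2) m h, symmetric] Z_split[of a] distrib_left fact_Suc_cancel
    by (subst suminf_add[symmetric]) (auto simp: add.assoc)
  finally show ?thesis .
qed

section \<open>Integrable activities and finiteness\<close>

abbreviation Z1 :: "('a \<Rightarrow> ennreal) \<Rightarrow> ennreal" where "Z1 a \<equiv> Z a (\<lambda>_. 1)"

definition activity :: "('a \<Rightarrow> ennreal) \<Rightarrow> bool" where
  "activity a \<longleftrightarrow> a \<in> borel_measurable borel \<and> (\<integral>\<^sup>+ x. a x \<partial>lborel) < \<infinity>"

lemma activity_measurable[measurable_dest]: "activity a \<Longrightarrow> a \<in> borel_measurable borel"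
  unfolding activity_def by simp

lemma activity_mono:
  "activity a \<Longrightarrow> c \<in> borel_measurable borel \<Longrightarrow> (\<And>x. c x \<le> a x) \<Longrightarrow> activity c"
  unfolding activity_def by (auto intro: le_less_trans[OF nn_integral_mono])

lemma damp_le: "damp a w x \<le> a x"
  using mult_left_mono[OF B_le_1, of "a x"] by simp

lemma activity_damp: "activity a \<Longrightarrow> activity (damp a w)"
  by (rule activity_mono) (auto simp: activity_def damp_le)

lemma activity_add: "activity a \<Longrightarrow> activity m \<Longrightarrow> activity (\<lambda>x. a x + m x)"
  unfolding activity_def by (auto simp: nn_integral_add)

lemma W_le_power:
  assumes "activity a"
  shows "W k a (\<lambda>_. 1) \<le> (\<integral>\<^sup>+ x. a x \<partial>lborel) ^ k"
  using assms
proof (induction k arbitrary: a)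
  case (Suc k)
  note [measurable] = Suc.prems
  let ?I = "\<integral>\<^sup>+ x. a x \<partial>lborel"
  have "W k (damp a w) (\<lambda>_. 1) \<le> ?I ^ k" for w
  proof -
    have "W k (damp a w) (\<lambda>_. 1) \<le> (\<integral>\<^sup>+ x. damp a w x \<partial>lborel) ^ k"
      by (rule Suc.IH) (rule activity_damp[OF Suc.prems])
    also have "\<dots> \<le> ?I ^ k"
      by (intro power_mono nn_integral_mono) (auto intro: damp_le)
    finally show ?thesis .
  qed
  then have "W (Suc k) a (\<lambda>_. 1) \<le> (\<integral>\<^sup>+ w. a w * ?I ^ k \<partial>lborel)"
    unfolding W.simps by (intro nn_integral_mono mult_left_mono) auto
  also have "\<dots> = ?I ^ Suc k" by (simp add: nn_integral_multc)
  finally show ?case .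
qed (simp only: W.simps power_0 order_refl)

lemma Z1_ge_1: "1 \<le> Z1 a"
  unfolding Z_split by (simp del: W.simps)

text \<open>Repulsion only lowers the weights, so the ideal gas value \<open>exp r\<close>
  dominates.\<close>

lemma Z1_finite: assumes "activity a" shows "Z1 a < \<infinity>"
proof -
  define r where "r = enn2real (\<integral>\<^sup>+ x. a x \<partial>lborel)"
  have r: "(\<integral>\<^sup>+ x. a x \<partial>lborel) = ennreal r" "0 \<le> r"
    using assms unfolding r_def activity_def by auto
  have "Z1 a \<le> (\<Sum>k. ennreal (1 / fact k) * ennreal r ^ k)"
    unfolding Z_def using W_le_power[OF assms] r by (intro suminf_le mult_left_mono) auto
  also have "\<dots> = (\<Sum>k. ennreal (r ^ k /\<^sub>R fact k))"
    using r by (simp add: ennreal_power ennreal_mult[symmetric] field_simps)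
  also have "\<dots> = ennreal (exp r)"
    using exp_converges[of r] r by (intro suminf_ennreal_eq) auto
  finally show ?thesis by (auto simp: less_top[symmetric] top_unique)
qed

lemma Z_le_Z1: "(\<And>\<eta>. h \<eta> \<le> 1) \<Longrightarrow> Z a h \<le> Z1 a"
  by (intro Z_mono) auto

lemma measurable_functional_const: "measurable_functional (\<lambda>_. c)" by simp

lemma W_const_on_support:
  assumes "a \<in> borel_measurable borel" "\<And>x. x \<in> L \<Longrightarrow> a x = 0" "\<And>\<eta>. h \<eta> = h (\<eta> \<inter> L)"
  shows "W k a h = W k a (\<lambda>_. h {})"
  using assms
proof (induction k arbitrary: a h)
  case (Suc k)
  note [measurable] = Suc.prems(1)
  show ?case unfolding W.simps
  proof (rule nn_integral_cong)
    fix w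
    show "a w * W k (damp a w) (add_point h w) = a w * W k (damp a w) (\<lambda>_. h {})"
    proof (cases "w \<in> L")
      case False
      have 1: "h (insert w \<eta>) = h (insert w (\<eta> \<inter> L))" for \<eta>
        using False Suc.prems(3)[of "insert w \<eta>"] Suc.prems(3)[of "insert w (\<eta> \<inter> L)"] by (simp add: Int_insert_left_if0 Int_assoc)
      have 2: "h {w} = h {}" using Suc.prems(3)[of "{w}"] False by (simp add: Int_insert_left_if0)
      have "W k (damp a w) (add_point h w) = W k (damp a w) (\<lambda>_. h {w})"
        by (rule Suc.IH) (use Suc.prems(2) 1 in auto)
      with 2 show ?thesis by simp
    qed (simp add: Suc.prems(2))
  qed
qed (simp only: W.simps)

text \<open>No point can fall into \<open>L\<close>, so a functional local to \<open>L\<close> only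
  ever sees the empty set. This ends the revealing of cells.\<close>

lemma Z_const_on_support:
  assumes "a \<in> borel_measurable borel" "\<And>x. x \<in> L \<Longrightarrow> a x = 0" "\<And>\<eta>. h \<eta> = h (\<eta> \<inter> L)"
  shows "Z a h = h {} * Z1 a"
proof -
  have "W k a h = h {} * W k a (\<lambda>_. 1)" for k
    using W_const_on_support[of a L h k, OF assms] W_cmult[OF assms(1) measurable_functional_const[of 1], of k "h {}"] by simp
  then show ?thesis unfolding Z_def by (simp add: mult.left_commute[of "ennreal _"])
qed

text \<open>A second use of \<open>Z_add_le\<close>, now inside the first-order term, makes the
  quadratic gap between the two bounds for \<open>Z\<close> explicit.\<close>

lemma nn_integral_Z_le:
  assumes [measurable]: "a \<in> borel_measurable borel" "m \<in> borel_measurable borel"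
    and h: "measurable_functional h" and h1: "\<And>\<eta>. h \<eta> \<le> 1"
  shows "(\<integral>\<^sup>+ w. m w * Z (damp (\<lambda>x. a x + m x) w) (add_point h w) \<partial>lborel) \<le>
    (\<integral>\<^sup>+ w. m w * Z (damp a w) (add_point h w) \<partial>lborel)
      + (\<integral>\<^sup>+ x. m x \<partial>lborel) * ((\<integral>\<^sup>+ x. m x \<partial>lborel) * Z1 (\<lambda>x. a x + m x))"
proof -
  let ?M = "\<integral>\<^sup>+ x. m x \<partial>lborel"
  have fam: "measurable_family lborel (\<lambda>w. add_point h w)"
    by (rule measurable_family_insert[OF measurable_family_const]) (use h in auto)
  have [measurable]: "(\<lambda>w. Z (damp a w) (add_point h w)) \<in> borel_measurable lborel"
    by (rule Z_measurable[OF _ fam]) measurable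
  have "Z (damp (\<lambda>x. a x + m x) w) (add_point h w) \<le> Z (damp a w) (add_point h w) + ?M * Z1 (\<lambda>x. a x + m x)" for w
  proof -
    have "Z (\<lambda>x. damp a w x + damp m w x) (add_point h w) \<le> Z (damp a w) (add_point h w) +
      (\<integral>\<^sup>+ u. damp m w u * Z (damp (\<lambda>x. damp a w x + damp m w x) u) (add_point (add_point h w) u) \<partial>lborel)"
      by (rule Z_add_le) (use measurable_family_at[OF fam] in auto)
    also have "\<dots> \<le> Z (damp a w) (add_point h w) + (\<integral>\<^sup>+ u. m u * Z1 (\<lambda>x. a x + m x) \<partial>lborel)"
      by (intro add_left_mono nn_integral_mono mult_mono Z_mono add_mono h1)
        (auto intro!: damp_le add_mono order_trans[OF damp_le[of "\<lambda>x. damp a w x + damp m w x"]])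
    also have "\<dots> = Z (damp a w) (add_point h w) + ?M * Z1 (\<lambda>x. a x + m x)"
      by (simp add: nn_integral_multc)
    finally show ?thesis by (simp only: distrib_right)
  qed
  then have "(\<integral>\<^sup>+ w. m w * Z (damp (\<lambda>x. a x + m x) w) (add_point h w) \<partial>lborel) \<le>
    (\<integral>\<^sup>+ w. m w * (Z (damp a w) (add_point h w) + ?M * Z1 (\<lambda>x. a x + m x)) \<partial>lborel)"
    by (intro nn_integral_mono mult_left_mono) auto
  then show ?thesis
    by (simp add: distrib_left nn_integral_add nn_integral_multc)
qed

section \<open>Normalised expectations and density ratios\<close>

definition partition_sum :: "('a \<Rightarrow> ennreal) \<Rightarrow> real" where "partition_sum a = enn2real (Z1 a)"

definition expec :: "('a \<Rightarrow> ennreal) \<Rightarrow> ('a set \<Rightarrow> ennreal) \<Rightarrow> real" where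
  "expec a h = enn2real (Z a h) / partition_sum a"

definition ratio :: "('a \<Rightarrow> ennreal) \<Rightarrow> 'a \<Rightarrow> real" where
  "ratio a w = partition_sum (damp a w) / partition_sum a"

lemma ennreal_partition: "activity a \<Longrightarrow> ennreal (partition_sum a) = Z1 a"
  unfolding partition_sum_def using Z1_finite by simp

lemma partition_sum_ge_1: "activity a \<Longrightarrow> 1 \<le> partition_sum a"
  using Z1_ge_1[of a] by (simp add: ennreal_partition[symmetric])

lemma partition_sum_pos: "activity a \<Longrightarrow> 0 < partition_sum a"
  using partition_sum_ge_1 by force

lemma partition_sum_mono: "activity a' \<Longrightarrow> activity a \<Longrightarrow> (\<And>x. a x \<le> a' x) \<Longrightarrow> partition_sum a \<le> partition_sum a'"
  unfolding partition_sum_def by (intro enn2real_mono Z_mono) (auto simp: Z1_finite[simplified])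

lemma ennreal_Z:
  assumes "activity a" "\<And>\<eta>. h \<eta> \<le> 1"
  shows "ennreal (partition_sum a * expec a h) = Z a h"
proof -
  have "Z a h < \<infinity>" using Z_le_Z1[of h a] assms Z1_finite[of a] by (auto intro: le_less_trans)
  then show ?thesis unfolding expec_def using partition_sum_pos[OF assms(1)] by simp
qed

lemma expec_nonneg: "activity a \<Longrightarrow> 0 \<le> expec a h"
  unfolding expec_def using partition_sum_pos[of a] by simp

lemma expec_le_1: "activity a \<Longrightarrow> (\<And>\<eta>. h \<eta> \<le> 1) \<Longrightarrow> expec a h \<le> 1"
  unfolding expec_def using partition_sum_pos[of a] Z_le_Z1[of h a] Z1_finite[of a]
  by (simp add: partition_sum_def enn2real_mono)

lemma ratio_nonneg: "activity a \<Longrightarrow> 0 < ratio a w"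
  unfolding ratio_def by (intro divide_pos_pos partition_sum_pos activity_damp)

lemma ratio_le_1: "activity a \<Longrightarrow> ratio a w \<le> 1"
  unfolding ratio_def using partition_sum_pos[of a] by (auto intro!: partition_sum_mono activity_damp damp_le simp: field_simps)

lemma partition_sum_measurable:
  assumes "(\<lambda>(p, x). A p x) \<in> borel_measurable (M \<Otimes>\<^sub>M lborel)"
  shows "(\<lambda>p. partition_sum (A p)) \<in> borel_measurable M"
proof -
  have "(\<lambda>p. Z1 (A p)) \<in> borel_measurable M"
    by (rule Z_measurable[OF assms measurable_family_const]) simp
  then show ?thesis unfolding partition_sum_def by measurable
qed

lemma ratio_measurable:
  assumes [measurable]: "(\<lambda>(p, x). A p x) \<in> borel_measurable (M \<Otimes>\<^sub>M lborel)" "g \<in> M \<rightarrow>\<^sub>M borel"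
  shows "(\<lambda>p. ratio (A p) (g p)) \<in> borel_measurable M"
proof -
  have "(\<lambda>p. partition_sum (damp (A p) (g p))) \<in> borel_measurable M"
    by (rule partition_sum_measurable) measurable
  moreover have "(\<lambda>p. partition_sum (A p)) \<in> borel_measurable M"
    by (rule partition_sum_measurable) measurable
  ultimately show ?thesis unfolding ratio_def by measurable
qed

lemma expec_measurable:
  assumes "(\<lambda>(p, x). A p x) \<in> borel_measurable (M \<Otimes>\<^sub>M lborel)" "measurable_family M h"
  shows "(\<lambda>p. expec (A p) (h p)) \<in> borel_measurable M"
proof -
  have "(\<lambda>p. Z (A p) (h p)) \<in> borel_measurable M" "(\<lambda>p. partition_sum (A p)) \<in> borel_measurable M"
    by (rule Z_measurable[OF assms], rule partition_sum_measurable[OF assms(1)])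
  then show ?thesis unfolding expec_def by measurable
qed

lemma finite_measure_activity:
  assumes "activity m" shows "finite_measure (density lborel m)"
  using assms by (intro finite_measureI) (auto simp: emeasure_density activity_def)

lemma integrable_unit_interval:
  assumes "activity m" "g \<in> borel_measurable borel" "\<And>w. 0 \<le> g w" "\<And>w. g w \<le> 1"
  shows "integrable (density lborel m) (g :: 'a \<Rightarrow> real)"
  using assms by (intro finite_measure.integrable_const_bound[OF finite_measure_activity, of _ _ 1]) auto

lemma nn_integral_unit_interval:
  assumes m: "activity m" and g: "g \<in> borel_measurable borel" "\<And>w. 0 \<le> g w" "\<And>w. g w \<le> 1"
  shows "(\<integral>\<^sup>+ w. m w * ennreal (g w) \<partial>lborel) = ennreal (LINT w|density lborel m. g w)"
proof -
  have [measurable]: "m \<in> borel_measurable borel" "g \<in> borel_measurable borel"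
    using m g by (auto simp: activity_def)
  have "(\<integral>\<^sup>+ w. m w * ennreal (g w) \<partial>lborel) = (\<integral>\<^sup>+ w. ennreal (g w) \<partial>density lborel m)"
    by (subst nn_integral_density) auto
  also have "\<dots> = ennreal (LINT w|density lborel m. g w)"
    by (rule nn_integral_eq_integral[OF integrable_unit_interval[OF assms]]) (use g in auto)
  finally show ?thesis .
qed

lemma integral_const_le:
  assumes m: "activity m" "(\<integral>\<^sup>+ x. m x \<partial>lborel) \<le> ennreal \<mu>" "0 \<le> \<mu>"
    and g: "g \<in> borel_measurable borel" "\<And>w. 0 \<le> g w" "\<And>w. g w \<le> K"
  shows "(LINT w|density lborel m. g w) \<le> K * \<mu>"
proof -
  interpret finite_measure "density lborel m" by (rule finite_measure_activity[OF m(1)])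
  have [measurable]: "m \<in> borel_measurable borel" using m by (simp add: activity_def)
  have K: "0 \<le> K" using g(2,3) order_trans by blast
  have "ennreal (measure (density lborel m) UNIV) \<le> ennreal \<mu>"
    using m(2) emeasure_eq_measure[of UNIV] by (simp add: emeasure_density)
  then have "measure (density lborel m) UNIV \<le> \<mu>" using m(3) by simp
  moreover have "(LINT w|density lborel m. g w) \<le> (LINT w|density lborel m. K)"
    using g by (intro integral_mono integrable_const_bound[of _ K] integrable_const) auto
  ultimately show ?thesis using K by (simp add: mult.commute mult_left_mono order_trans)
qed

section \<open>Expansion to first order in a small added activity\<close>

lemma partition_sum_expec_expand:
  assumes c: "activity c" and m: "activity m"
    and mu: "(\<integral>\<^sup>+ x. m x \<partial>lborel) \<le> ennreal \<mu>" "0 \<le> \<mu>"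
    and h: "measurable_functional h" and h1: "\<And>\<eta>. h \<eta> \<le> 1"
  defines "Q \<equiv> LINT w|density lborel m. ratio c w * expec (damp c w) (add_point h w)"
  shows "partition_sum c * (expec c h + Q) \<le> partition_sum (\<lambda>x. c x + m x) * expec (\<lambda>x. c x + m x) h"
    and "partition_sum (\<lambda>x. c x + m x) * expec (\<lambda>x. c x + m x) h \<le> partition_sum c * (expec c h + Q) + \<mu>\<^sup>2 * partition_sum (\<lambda>x. c x + m x)"
    and "0 \<le> Q"
proof -
  let ?a = "\<lambda>x. c x + m x"
  have [measurable]: "c \<in> borel_measurable borel" "m \<in> borel_measurable borel" using c m by (auto simp: activity_def)
  have a: "activity ?a" by (rule activity_add[OF c m])
  have fam: "measurable_family lborel (\<lambda>w. add_point h w)"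
    by (rule measurable_family_insert[OF measurable_family_const]) (use h in auto)
  have mr: "(\<lambda>w. ratio c w) \<in> borel_measurable lborel"
    by (rule ratio_measurable) measurable
  have me: "(\<lambda>w. expec (damp c w) (add_point h w)) \<in> borel_measurable lborel"
    by (rule expec_measurable[OF _ fam]) measurable
  have g: "(\<lambda>w. ratio c w * expec (damp c w) (add_point h w)) \<in> borel_measurable borel"
      "0 \<le> ratio c w * expec (damp c w) (add_point h w)" "ratio c w * expec (damp c w) (add_point h w) \<le> 1" for w
    using mr me ratio_nonneg[OF c, of w] ratio_le_1[OF c, of w] expec_nonneg[OF activity_damp[OF c], of w "add_point h w"]
     expec_le_1[OF activity_damp[OF c], of "add_point h w" w] h1
    by (auto intro: mult_le_one less_imp_le)
  show Q0: "0 \<le> Q" unfolding Q_def by (intro integral_nonneg_AE) (use g(2) in auto)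
  have "(\<integral>\<^sup>+ w. m w * Z (damp c w) (add_point h w) \<partial>lborel)
     = (\<integral>\<^sup>+ w. ennreal (partition_sum c) * (m w * ennreal (ratio c w * expec (damp c w) (add_point h w))) \<partial>lborel)"
  proof (rule nn_integral_cong)
    fix w
    have "Z (damp c w) (add_point h w) = ennreal (partition_sum (damp c w) * expec (damp c w) (add_point h w))"
      by (rule ennreal_Z[OF activity_damp[OF c], symmetric]) (rule h1)
    also have "partition_sum (damp c w) = partition_sum c * ratio c w"
      using partition_sum_pos[OF c] by (simp add: ratio_def)
    finally show "m w * Z (damp c w) (add_point h w) = ennreal (partition_sum c) * (m w * ennreal (ratio c w * expec (damp c w) (add_point h w)))"
      using partition_sum_pos[OF c] g(2)[of w] by (simp add: ennreal_mult mult.assoc mult.left_commute[of "m w"] del: ennreal_mult'')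
  qed
  also have "\<dots> = ennreal (partition_sum c) * ennreal Q"
    unfolding Q_def using g(1) by (subst nn_integral_cmult) (auto simp: nn_integral_unit_interval[OF m g])
  finally have J: "(\<integral>\<^sup>+ w. m w * Z (damp c w) (add_point h w) \<partial>lborel) = ennreal (partition_sum c * Q)"
    using partition_sum_pos[OF c] Q0 by (simp add: ennreal_mult[symmetric])
  have Zc: "Z c h = ennreal (partition_sum c * expec c h)" and Za: "Z ?a h = ennreal (partition_sum ?a * expec ?a h)"
    by (rule ennreal_Z[OF _ h1, symmetric]; fact)+
  note nn = partition_sum_pos[OF c] partition_sum_pos[OF a] expec_nonneg[OF c, of h] expec_nonneg[OF a, of h]
  have "ennreal (partition_sum c * expec c h + partition_sum c * Q) \<le> ennreal (partition_sum ?a * expec ?a h)"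
    using Z_add_ge[of c m h] h nn Q0 unfolding J Zc Za by (subst ennreal_plus) auto
  then show "partition_sum c * (expec c h + Q) \<le> partition_sum ?a * expec ?a h"
    using nn by (simp add: distrib_left)
  have "Z ?a h \<le> Z c h + (\<integral>\<^sup>+ w. m w * Z (damp ?a w) (add_point h w) \<partial>lborel)"
    using h by (intro Z_add_le) auto
  also have "\<dots> \<le> Z c h + ((\<integral>\<^sup>+ w. m w * Z (damp c w) (add_point h w) \<partial>lborel)
      + (\<integral>\<^sup>+ x. m x \<partial>lborel) * ((\<integral>\<^sup>+ x. m x \<partial>lborel) * Z1 ?a))"
    using h h1 by (intro add_left_mono nn_integral_Z_le) auto
  also have "\<dots> \<le> ennreal (partition_sum c * expec c h) + (ennreal (partition_sum c * Q) + ennreal \<mu> * (ennreal \<mu> * ennreal (partition_sum ?a)))"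
    unfolding Zc J ennreal_partition[OF a] by (intro add_left_mono mult_mono mu) auto
  also have "\<dots> = ennreal (partition_sum c * expec c h + (partition_sum c * Q + \<mu> * (\<mu> * partition_sum ?a)))"
    using nn Q0 mu(2) by (simp add: ennreal_mult[symmetric] ennreal_plus[symmetric] del: ennreal_plus)
  finally have "partition_sum ?a * expec ?a h \<le> partition_sum c * expec c h + (partition_sum c * Q + \<mu> * (\<mu> * partition_sum ?a))"
    unfolding Za using nn Q0 mu(2) by (subst (asm) ennreal_le_iff) (auto intro!: add_nonneg_nonneg mult_nonneg_nonneg)
  then show "partition_sum ?a * expec ?a h \<le> partition_sum c * (expec c h + Q) + \<mu>\<^sup>2 * partition_sum ?a"
    by (simp add: algebra_simps power2_eq_square)
qed

lemma expec_one: "activity a \<Longrightarrow> expec a (\<lambda>_. 1) = 1"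
  using partition_sum_pos[of a] by (simp add: expec_def partition_sum_def)

lemma partition_sum_expec_add_le:
  assumes c: "activity c" and m: "activity m" and mu: "(\<integral>\<^sup>+ x. m x \<partial>lborel) \<le> ennreal \<mu>" "0 \<le> \<mu>"
    and h: "measurable_functional h" and h1: "\<And>\<eta>. h \<eta> \<le> 1"
  shows "partition_sum (\<lambda>x. c x + m x) * expec (\<lambda>x. c x + m x) h \<le> partition_sum c * expec c h + \<mu> * partition_sum (\<lambda>x. c x + m x)"
proof -
  let ?a = "\<lambda>x. c x + m x"
  have [measurable]: "c \<in> borel_measurable borel" "m \<in> borel_measurable borel" using c m by (auto simp: activity_def)
  have a: "activity ?a" by (rule activity_add[OF c m])
  have Zc: "Z c h = ennreal (partition_sum c * expec c h)" and Za: "Z ?a h = ennreal (partition_sum ?a * expec ?a h)"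
    by (rule ennreal_Z[OF _ h1, symmetric]; fact)+
  note nn = partition_sum_pos[OF c] partition_sum_pos[OF a] expec_nonneg[OF c, of h] expec_nonneg[OF a, of h]
  have "Z ?a h \<le> Z c h + (\<integral>\<^sup>+ w. m w * Z (damp ?a w) (add_point h w) \<partial>lborel)"
    using h by (intro Z_add_le) auto
  also have "\<dots> \<le> Z c h + (\<integral>\<^sup>+ w. m w * Z1 ?a \<partial>lborel)"
    by (intro add_left_mono nn_integral_mono mult_left_mono Z_mono damp_le h1) auto
  also have "\<dots> \<le> ennreal (partition_sum c * expec c h) + ennreal \<mu> * ennreal (partition_sum ?a)"
    unfolding ennreal_partition[OF a] Zc using mu by (auto simp: nn_integral_multc intro!: mult_right_mono add_left_mono)
  also have "\<dots> = ennreal (partition_sum c * expec c h + \<mu> * partition_sum ?a)"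
    using nn mu(2) by (simp add: ennreal_mult[symmetric] ennreal_plus[symmetric] del: ennreal_plus)
  finally show ?thesis
    unfolding Za using nn mu(2) by (subst (asm) ennreal_le_iff) auto
qed

text \<open>The larger partition sum reappears on the right with factor \<open>\<mu>\<close>. For
  \<open>\<mu> \<le> 1/2\<close> it can be absorbed, so the partition sum at most doubles; this is
  the source of the bound \<open>1/2\<close> and of the constants 2 below.\<close>

lemma partition_sum_add_le:
  assumes c: "activity c" and m: "activity m" and mu: "(\<integral>\<^sup>+ x. m x \<partial>lborel) \<le> ennreal \<mu>" "0 \<le> \<mu>"
  shows "partition_sum (\<lambda>x. c x + m x) \<le> partition_sum c + \<mu> * partition_sum (\<lambda>x. c x + m x)"
  using partition_sum_expec_add_le[OF assms, of "\<lambda>_. 1"] by (simp add: expec_one c activity_add[OF c m])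

lemma partition_sum_expand:
  assumes c: "activity c" and m: "activity m"
    and mu: "(\<integral>\<^sup>+ x. m x \<partial>lborel) \<le> ennreal \<mu>" "0 \<le> \<mu>" "\<mu> \<le> 1/2"
  shows "\<exists>\<theta>. 0 \<le> \<theta> \<and> \<theta> \<le> 2 * \<mu>\<^sup>2 \<and>
    partition_sum (\<lambda>x. c x + m x) = partition_sum c * (1 + (LINT w|density lborel m. ratio c w) + \<theta>)"
proof -
  let ?a = "\<lambda>x. c x + m x"
  define Q where "Q = (LINT w|density lborel m. ratio c w)"
  have a: "activity ?a" by (rule activity_add[OF c m])
  have Q: "Q = (LINT w|density lborel m. ratio c w * expec (damp c w) (\<lambda>_. 1))"
    unfolding Q_def by (simp add: expec_one activity_damp c)
  have 1: "partition_sum c * (1 + Q) \<le> partition_sum ?a" "partition_sum ?a \<le> partition_sum c * (1 + Q) + \<mu>\<^sup>2 * partition_sum ?a"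
    using partition_sum_expec_expand(1,2)[OF c m mu(1,2), of "\<lambda>_. 1"] by (simp_all add: expec_one a c Q)
  have "\<mu> * partition_sum ?a \<le> 1/2 * partition_sum ?a" using mu partition_sum_pos[OF a] by (intro mult_right_mono) auto
  then have 2: "partition_sum ?a \<le> 2 * partition_sum c" using partition_sum_add_le[OF c m mu(1,2)] by simp
  have "\<mu>\<^sup>2 * partition_sum ?a \<le> \<mu>\<^sup>2 * (2 * partition_sum c)" using 2 by (intro mult_left_mono) auto
  with 1 have "partition_sum ?a - partition_sum c * (1 + Q) \<le> 2 * \<mu>\<^sup>2 * partition_sum c" by simp
  then have "(partition_sum ?a - partition_sum c * (1 + Q)) / partition_sum c \<le> 2 * \<mu>\<^sup>2" using partition_sum_pos[OF c] by (simp add: pos_divide_le_eq)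
  moreover have "0 \<le> (partition_sum ?a - partition_sum c * (1 + Q)) / partition_sum c" using 1 partition_sum_pos[OF c] by simp
  moreover have "partition_sum ?a = partition_sum c * (1 + Q + (partition_sum ?a - partition_sum c * (1 + Q)) / partition_sum c)"
    using partition_sum_pos[OF c] by (simp add: field_simps)
  ultimately show ?thesis unfolding Q_def by blast
qed

text \<open>Partition sums, plain or damped, are monotone in the activity, whereas a ratio need not
  be. So numerator and denominator of \<open>ratio d w\<close> are enclosed separately by those for
  \<open>c\<close> and \<open>c + m\<close>, each at relative cost of order
  \<open>\<mu>\<close>.\<close>

lemma ratio_between:
  assumes c: "activity c" and m: "activity m"
    and mu: "(\<integral>\<^sup>+ x. m x \<partial>lborel) \<le> ennreal \<mu>" "0 \<le> \<mu>" "\<mu> \<le> 1/2"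
    and d: "d \<in> borel_measurable borel" "\<And>x. c x \<le> d x" "\<And>x. d x \<le> c x + m x"
  shows "\<bar>ratio d w - ratio c w\<bar> \<le> 2 * \<mu>"
proof -
  let ?a = "\<lambda>x. c x + m x"
  have a: "activity ?a" by (rule activity_add[OF c m])
  have dact: "activity d" by (rule activity_mono[OF a d(1,3)])
  have Pa: "partition_sum ?a \<le> partition_sum c + \<mu> * partition_sum ?a" by (rule partition_sum_add_le[OF c m mu(1,2)])
  have "\<mu> * partition_sum ?a \<le> 1/2 * partition_sum ?a" using mu partition_sum_pos[OF a] by (intro mult_right_mono) auto
  then have 2: "partition_sum ?a \<le> 2 * partition_sum c" using Pa by simp
  have "(\<integral>\<^sup>+ x. damp m w x \<partial>lborel) \<le> (\<integral>\<^sup>+ x. m x \<partial>lborel)"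
    by (intro nn_integral_mono damp_le)
  then have mu': "(\<integral>\<^sup>+ x. damp m w x \<partial>lborel) \<le> ennreal \<mu>" using mu(1) by (rule order_trans)
  have Paw: "partition_sum (damp ?a w) \<le> partition_sum (damp c w) + \<mu> * partition_sum (damp ?a w)"
    using partition_sum_add_le[OF activity_damp[OF c] activity_damp[OF m] mu' mu(2)] by (simp only: distrib_right)
  have mono: "partition_sum c \<le> partition_sum d" "partition_sum d \<le> partition_sum ?a" "partition_sum (damp c w) \<le> partition_sum (damp d w)" "partition_sum (damp d w) \<le> partition_sum (damp ?a w)"
    "partition_sum (damp ?a w) \<le> partition_sum ?a"
    by (intro partition_sum_mono activity_damp c a dact d mult_right_mono damp_le; simp)+
  note pos = partition_sum_pos[OF c] partition_sum_pos[OF dact] partition_sum_pos[OF a] partition_sum_pos[OF activity_damp[OF c], of w] partition_sum_pos[OF activity_damp[OF dact], of w]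
  have "partition_sum (damp d w) \<le> partition_sum (damp c w) + \<mu> * partition_sum ?a"
    using mono Paw mu(2) mult_left_mono[OF mono(5) mu(2)] by linarith
  also have "\<dots> \<le> partition_sum (damp c w) + \<mu> * (2 * partition_sum c)" using 2 mu(2) by (intro add_left_mono mult_left_mono) auto
  finally have "partition_sum (damp d w) / partition_sum c \<le> ratio c w + 2 * \<mu>"
    unfolding ratio_def using pos by (simp add: field_simps)
  moreover have "ratio d w \<le> partition_sum (damp d w) / partition_sum c"
    unfolding ratio_def using mono pos by (intro divide_left_mono) auto
  ultimately have up: "ratio d w \<le> ratio c w + 2 * \<mu>" by simp
  have "(1 - \<mu>) * partition_sum d \<le> partition_sum c"
  proof -
    have "(1 - \<mu>) * partition_sum d \<le> (1 - \<mu>) * partition_sum ?a" using mono mu(3) by (intro mult_left_mono) auto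
    also have "\<dots> \<le> partition_sum c" using Pa by (simp add: algebra_simps)
    finally show ?thesis .
  qed
  then have "(1 - \<mu>) \<le> partition_sum c / partition_sum d" using pos by (simp add: pos_le_divide_eq)
  then have "ratio c w * (1 - \<mu>) \<le> ratio c w * (partition_sum c / partition_sum d)"
    using ratio_nonneg[OF c, of w] by (intro mult_left_mono) auto
  also have "\<dots> = partition_sum (damp c w) / partition_sum d" unfolding ratio_def using pos by simp
  also have "\<dots> \<le> ratio d w" unfolding ratio_def using mono pos by (intro divide_right_mono) auto
  finally have "ratio c w - \<mu> * ratio c w \<le> ratio d w" by (simp add: algebra_simps)
  moreover have "\<mu> * ratio c w \<le> \<mu> * 1" using ratio_le_1[OF c, of w] mu(2) by (intro mult_left_mono) auto
  ultimately show ?thesis using up mu(2) by auto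
qed

lemma ln_partition_step:
  assumes c: "activity c" and m: "activity m"
    and mu: "(\<integral>\<^sup>+ x. m x \<partial>lborel) \<le> ennreal \<mu>" "0 \<le> \<mu>" "\<mu> \<le> 1/2"
    and g: "g \<in> borel_measurable borel" "\<And>w. 0 \<le> g w" "\<And>w. g w \<le> 1"
    and close: "\<And>w. m w \<noteq> 0 \<Longrightarrow> \<bar>g w - ratio c w\<bar> \<le> 2 * \<mu>"
  shows "\<bar>ln (partition_sum (\<lambda>x. c x + m x)) - ln (partition_sum c) - (LINT w|density lborel m. g w)\<bar> \<le> 8 * \<mu>\<^sup>2"
proof -
  let ?a = "\<lambda>x. c x + m x" and ?N = "density lborel m"
  have [measurable]: "c \<in> borel_measurable borel" "m \<in> borel_measurable borel" "g \<in> borel_measurable borel"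
    using c m g by (auto simp: activity_def)
  have a: "activity ?a" by (rule activity_add[OF c m])
  define Q where "Q = (LINT w|?N. ratio c w)"
  have mr: "(\<lambda>w. ratio c w) \<in> borel_measurable lborel"
    by (rule ratio_measurable) measurable
  then have [measurable]: "ratio c \<in> borel_measurable borel" by simp
  note r = ratio_nonneg[OF c, THEN less_imp_le] ratio_le_1[OF c]
  have Q: "0 \<le> Q" "Q \<le> 1 * \<mu>"
    unfolding Q_def by (intro integral_nonneg_AE, use r in simp, intro integral_const_le[OF m mu(1,2) _ r], simp)
  obtain \<theta> where th: "0 \<le> \<theta>" "\<theta> \<le> 2 * \<mu>\<^sup>2" "partition_sum ?a = partition_sum c * (1 + Q + \<theta>)"
    using partition_sum_expand[OF c m mu] unfolding Q_def by blast
  have "ln (partition_sum ?a) = ln (partition_sum c) + ln (1 + (Q + \<theta>))"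
    unfolding th(3) using partition_sum_pos[OF c] Q th by (subst ln_mult) (auto simp: add.assoc)
  moreover have "\<bar>ln (1 + (Q + \<theta>)) - (Q + \<theta>)\<bar> \<le> (Q + \<theta>)\<^sup>2"
    by (rule ln_one_plus_bound) (use Q th in auto)
  moreover have "(Q + \<theta>)\<^sup>2 \<le> (2 * \<mu>)\<^sup>2"
  proof (rule power_mono)
    have "2 * \<mu>\<^sup>2 \<le> \<mu>" using mu(2,3) mult_right_mono[of "2 * \<mu>" 1 \<mu>] by (simp add: power2_eq_square)
    then show "Q + \<theta> \<le> 2 * \<mu>" using Q th by simp
  qed (use Q th in auto)
  moreover have "\<bar>(LINT w|?N. g w) - Q\<bar> \<le> 2 * \<mu> * \<mu>"
  proof -
    have ig: "integrable ?N g" "integrable ?N (ratio c)"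
      by (intro integrable_unit_interval[OF m] g r; simp)+
    have "\<bar>(LINT w|?N. g w) - Q\<bar> = \<bar>LINT w|?N. g w - ratio c w\<bar>"
      unfolding Q_def using ig by simp
    also have "\<dots> \<le> (LINT w|?N. \<bar>g w - ratio c w\<bar>)" by (rule integral_abs_bound)
    \<comment> \<open>Closeness is known only where \<open>m\<close> does not vanish; truncation by
      \<open>min\<close> gives a bound at every point without changing the integral.\<close>
    also have "\<dots> = (LINT w|?N. min \<bar>g w - ratio c w\<bar> (2 * \<mu>))"
    proof (rule integral_cong_AE)
      show "AE w in ?N. \<bar>g w - ratio c w\<bar> = min \<bar>g w - ratio c w\<bar> (2 * \<mu>)"
        using close by (subst AE_density) (auto intro!: AE_I2 simp: min_def)
    qed auto
    also have "\<dots> \<le> 2 * \<mu> * \<mu>"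
      by (rule integral_const_le[OF m mu(1,2)]) (use mu(2) in auto)
    finally show ?thesis .
  qed
  ultimately have "\<bar>ln (partition_sum ?a) - ln (partition_sum c) - (LINT w|?N. g w)\<bar> \<le> (2 * \<mu>)\<^sup>2 + 2 * \<mu> * \<mu> + 2 * \<mu>\<^sup>2"
    using th by linarith
  also have "\<dots> = 8 * \<mu>\<^sup>2" by (simp add: power2_eq_square)
  finally show ?thesis .
qed

text \<open>To first order the cell carrying \<open>m\<close> is either empty, with weight one minus
  the integrated ratio, or holds a single point \<open>w\<close>, which then damps the rest and is
  handed to \<open>h\<close>; two points cost order \<open>\<mu>\<^sup>2\<close>.\<close>

lemma expec_expand:
  assumes c: "activity c" and m: "activity m"
    and mu: "(\<integral>\<^sup>+ x. m x \<partial>lborel) \<le> ennreal \<mu>" "0 \<le> \<mu>" "\<mu> \<le> 1/2"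
    and h: "measurable_functional h" and h1: "\<And>\<eta>. h \<eta> \<le> 1"
  shows "\<bar>expec (\<lambda>x. c x + m x) h - (expec c h * (1 - (LINT w|density lborel m. ratio c w))
    + (LINT w|density lborel m. ratio c w * expec (damp c w) (add_point h w)))\<bar> \<le> 3 * \<mu>\<^sup>2"
proof -
  let ?a = "\<lambda>x. c x + m x"
  define p where "p = (LINT w|density lborel m. ratio c w)"
  define Q where "Q = (LINT w|density lborel m. ratio c w * expec (damp c w) (add_point h w))"
  have [measurable]: "c \<in> borel_measurable borel" "m \<in> borel_measurable borel" using c m by (auto simp: activity_def)
  have a: "activity ?a" by (rule activity_add[OF c m])
  note pos = partition_sum_pos[OF c] partition_sum_pos[OF a]
  obtain \<theta>1 where th1: "0 \<le> \<theta>1" "\<theta>1 \<le> 2 * \<mu>\<^sup>2" and Pa: "partition_sum ?a = partition_sum c * (1 + p + \<theta>1)"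
    using partition_sum_expand[OF c m mu] unfolding p_def by blast
  have ex: "partition_sum c * (expec c h + Q) \<le> partition_sum ?a * expec ?a h"
      "partition_sum ?a * expec ?a h \<le> partition_sum c * (expec c h + Q) + \<mu>\<^sup>2 * partition_sum ?a" and Q0: "0 \<le> Q"
    unfolding Q_def by (rule partition_sum_expec_expand[OF c m mu(1,2) h h1])+
  define \<theta> where "\<theta> = (partition_sum ?a * expec ?a h - partition_sum c * (expec c h + Q)) / partition_sum c"
  have "\<mu> * partition_sum ?a \<le> 1/2 * partition_sum ?a" using mu pos by (intro mult_right_mono) auto
  then have "partition_sum ?a \<le> 2 * partition_sum c" using partition_sum_add_le[OF c m mu(1,2)] by simp
  then have "\<mu>\<^sup>2 * partition_sum ?a \<le> \<mu>\<^sup>2 * (2 * partition_sum c)" by (intro mult_left_mono) auto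
  with ex(2) have "partition_sum ?a * expec ?a h - partition_sum c * (expec c h + Q) \<le> 2 * \<mu>\<^sup>2 * partition_sum c" by simp
  then have th: "0 \<le> \<theta>" "\<theta> \<le> 2 * \<mu>\<^sup>2"
    unfolding \<theta>_def using ex(1) pos by (auto simp: pos_divide_le_eq)
  have "partition_sum ?a * expec ?a h = partition_sum c * (expec c h + Q + \<theta>)"
    unfolding \<theta>_def using pos by (simp add: field_simps)
  then have quot: "expec ?a h = (expec c h + Q + \<theta>) / (1 + p + \<theta>1)"
  proof -
    assume "partition_sum ?a * expec ?a h = partition_sum c * (expec c h + Q + \<theta>)"
    then have "(1 + p + \<theta>1) * expec ?a h = expec c h + Q + \<theta>"
      using pos unfolding Pa by simp
    moreover have "0 < 1 + p + \<theta>1" using pos unfolding Pa by (simp add: zero_less_mult_iff)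
    ultimately show ?thesis by (simp add: eq_divide_eq mult.commute)
  qed
  have fam: "measurable_family lborel (\<lambda>w. add_point h w)"
    by (rule measurable_family_insert[OF measurable_family_const]) (use h in auto)
  have mr: "(\<lambda>w. ratio c w) \<in> borel_measurable lborel"
    by (rule ratio_measurable) measurable
  have me: "(\<lambda>w. expec (damp c w) (add_point h w)) \<in> borel_measurable lborel"
    by (rule expec_measurable[OF _ fam]) measurable
  note r = ratio_nonneg[OF c, THEN less_imp_le] ratio_le_1[OF c]
  note x = expec_nonneg[OF activity_damp[OF c]] expec_le_1[OF activity_damp[OF c], of "add_point h _", OF h1]
  have "Q \<le> p" unfolding Q_def p_def
    by (intro integral_mono integrable_unit_interval[OF m] mult_nonneg_nonneg mult_le_one mult_left_le r x)
      (use mr me in auto)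
  moreover have "p \<le> 1 * \<mu>" unfolding p_def
    by (intro integral_const_le[OF m mu(1,2) _ r]) (use mr in simp)
  ultimately show ?thesis
    unfolding quot p_def[symmetric] Q_def[symmetric]
    using expec_nonneg[OF c, of h] expec_le_1[OF c, of h, OF h1] Q0 mu(3) th th1
    by (intro first_order_expectation_bound) auto
qed

text \<open>Comparing the content of one cell under both activities: an empty cell and a common
  point each continue with an error \<open>\<delta>\<close>, with weights adding up to 1, so
  \<open>\<delta>\<close> is not amplified. The mismatch of the densities adds
  \<open>\<epsilon> * \<mu>\<close>, and each of the two expansions adds
  \<open>3 * \<mu>\<^sup>2\<close>.\<close>

lemma expec_reveal_cell:
  assumes c: "activity c" and c': "activity c'" and m: "activity m"
    and mu: "(\<integral>\<^sup>+ x. m x \<partial>lborel) \<le> ennreal \<mu>" "0 \<le> \<mu>" "\<mu> \<le> 1/2"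
    and h: "measurable_functional h" and h1: "\<And>\<eta>. h \<eta> \<le> 1"
    and \<epsilon>: "0 \<le> \<epsilon>"
    and e: "\<bar>expec c h - expec c' h\<bar> \<le> \<delta>"
    and x: "\<And>w. m w \<noteq> 0 \<Longrightarrow> \<bar>expec (damp c w) (add_point h w) - expec (damp c' w) (add_point h w)\<bar> \<le> \<delta>"
    and r: "\<And>w. m w \<noteq> 0 \<Longrightarrow> \<bar>ratio c w - ratio c' w\<bar> \<le> \<epsilon>"
  shows "\<bar>expec (\<lambda>x. c x + m x) h - expec (\<lambda>x. c' x + m x) h\<bar> \<le> \<delta> + \<epsilon> * \<mu> + 6 * \<mu>\<^sup>2"
proof -
  let ?N = "density lborel m"
  interpret finite_measure ?N by (rule finite_measure_activity[OF m])
  have [measurable]: "c \<in> borel_measurable borel" "c' \<in> borel_measurable borel" "m \<in> borel_measurable borel"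
    using c c' m by (auto simp: activity_def)
  define X where "X c w = expec (damp c w) (add_point h w)" for c w
  define p where "p c = (LINT w|?N. ratio c w)" for c
  define Q where "Q c = (LINT w|?N. ratio c w * X c w)" for c
  have fam: "measurable_family lborel (\<lambda>w. add_point h w)"
    by (rule measurable_family_insert[OF measurable_family_const]) (use h in auto)
  have "(\<lambda>w. ratio c w) \<in> borel_measurable lborel" "(\<lambda>w. ratio c' w) \<in> borel_measurable lborel"
    by (rule ratio_measurable; measurable)+
  then have [measurable]: "ratio c \<in> borel_measurable borel" "ratio c' \<in> borel_measurable borel" by simp_all
  have "(\<lambda>w. X c w) \<in> borel_measurable lborel" "(\<lambda>w. X c' w) \<in> borel_measurable lborel"
    unfolding X_def by (rule expec_measurable[OF _ fam]; measurable)+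
  then have [measurable]: "X c \<in> borel_measurable borel" "X c' \<in> borel_measurable borel" by simp_all
  have rb: "0 \<le> ratio c w" "ratio c w \<le> 1" "0 \<le> ratio c' w" "ratio c' w \<le> 1" for w
    using ratio_nonneg c c' ratio_le_1 by (auto intro: less_imp_le)
  have xb: "0 \<le> X c w" "X c w \<le> 1" "0 \<le> X c' w" "X c' w \<le> 1" for w
    unfolding X_def using expec_nonneg expec_le_1 activity_damp c c' h1 by auto
  have eb: "0 \<le> expec c' h" "expec c' h \<le> 1" using expec_nonneg expec_le_1 c' h1 by auto
  have int: "integrable ?N (ratio c)" "integrable ?N (ratio c')"
      "integrable ?N (\<lambda>w. ratio c w * X c w)" "integrable ?N (\<lambda>w. ratio c' w * X c' w)"
    by (intro integrable_unit_interval[OF m] mult_nonneg_nonneg mult_le_one rb xb; measurable)+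
  have p: "0 \<le> p c" "p c \<le> 1 * \<mu>" unfolding p_def
    by (intro integral_nonneg_AE, use rb in simp, intro integral_const_le[OF m mu(1,2) _ rb(1,2)], simp)
  have \<delta>: "0 \<le> \<delta>" using e by linarith
  have "measure ?N UNIV = (LINT w|?N. 1)" by simp
  also have "\<dots> \<le> 1 * \<mu>" by (rule integral_const_le[OF m mu(1,2)]) auto
  finally have N: "measure ?N UNIV \<le> \<mu>" by simp
  \<comment> \<open>Subtracting \<open>expec c' h * (p c - p c')\<close> centres the integrand: the
    difference of ratios is then multiplied by \<open>X c' w - expec c' h\<close>, whose modulus is
    at most 1.\<close>
  have "\<bar>Q c - Q c' - expec c' h * (p c - p c')\<bar>
    = \<bar>LINT w|?N. ratio c w * X c w - ratio c' w * X c' w - expec c' h * (ratio c w - ratio c' w)\<bar>"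
    unfolding Q_def p_def using int by simp
  also have "\<dots> \<le> (LINT w|?N. \<bar>ratio c w * X c w - ratio c' w * X c' w - expec c' h * (ratio c w - ratio c' w)\<bar>)"
    by (rule integral_abs_bound)
  also have "\<dots> \<le> (LINT w|?N. \<delta> * ratio c w + \<epsilon>)"
  proof (rule integral_mono_AE)
    show "AE w in ?N. \<bar>ratio c w * X c w - ratio c' w * X c' w - expec c' h * (ratio c w - ratio c' w)\<bar> \<le> \<delta> * ratio c w + \<epsilon>"
    proof (subst AE_density, simp, rule AE_I2, intro impI)
      fix w assume "0 < m w"
      then have xw: "\<bar>X c w - X c' w\<bar> \<le> \<delta>" and rw: "\<bar>ratio c w - ratio c' w\<bar> \<le> \<epsilon>"
        using x[of w] r[of w] unfolding X_def by auto
      have "\<bar>ratio c w * X c w - ratio c' w * X c' w - expec c' h * (ratio c w - ratio c' w)\<bar>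
        = \<bar>ratio c w * (X c w - X c' w) + (ratio c w - ratio c' w) * (X c' w - expec c' h)\<bar>"
        by (simp add: algebra_simps)
      also have "\<dots> \<le> \<bar>ratio c w * (X c w - X c' w)\<bar> + \<bar>(ratio c w - ratio c' w) * (X c' w - expec c' h)\<bar>"
        by (rule abs_triangle_ineq)
      also have "\<dots> \<le> ratio c w * \<delta> + \<epsilon> * 1"
      proof (rule add_mono)
        show "\<bar>ratio c w * (X c w - X c' w)\<bar> \<le> ratio c w * \<delta>"
          unfolding abs_mult using rb(1)[of w] xw by (auto intro: mult_left_mono)
        have "\<bar>X c' w - expec c' h\<bar> \<le> 1" using xb[of w] eb by linarith
        then show "\<bar>(ratio c w - ratio c' w) * (X c' w - expec c' h)\<bar> \<le> \<epsilon> * 1"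
          unfolding abs_mult using rw \<epsilon> by (intro mult_mono) auto
      qed
      finally show "\<bar>ratio c w * X c w - ratio c' w * X c' w - expec c' h * (ratio c w - ratio c' w)\<bar> \<le> \<delta> * ratio c w + \<epsilon>"
        by (simp add: mult.commute)
    qed
  qed (use int in auto)
  also have "\<dots> = \<delta> * p c + \<epsilon> * measure ?N UNIV"
    unfolding p_def using int by simp
  also have "\<dots> \<le> \<delta> * p c + \<epsilon> * \<mu>"
    using N \<epsilon> by (intro add_left_mono mult_left_mono) auto
  finally have 1: "\<bar>Q c - Q c' - expec c' h * (p c - p c')\<bar> \<le> \<delta> * p c + \<epsilon> * \<mu>" .
  have 2: "\<bar>(1 - p c) * (expec c h - expec c' h)\<bar> \<le> (1 - p c) * \<delta>"
    unfolding abs_mult using e p mu by (auto intro: mult_left_mono)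
  have "(expec c h * (1 - p c) + Q c) - (expec c' h * (1 - p c') + Q c')
    = (1 - p c) * (expec c h - expec c' h) + (Q c - Q c' - expec c' h * (p c - p c'))"
    by (simp add: algebra_simps)
  then have "\<bar>(expec c h * (1 - p c) + Q c) - (expec c' h * (1 - p c') + Q c')\<bar> \<le> (1 - p c) * \<delta> + (\<delta> * p c + \<epsilon> * \<mu>)"
    using 1 2 by linarith
  also have "\<dots> = \<delta> + \<epsilon> * \<mu>" by (simp add: algebra_simps)
  finally have "\<bar>(expec c h * (1 - p c) + Q c) - (expec c' h * (1 - p c') + Q c')\<bar> \<le> \<delta> + \<epsilon> * \<mu>" .
  moreover have "\<bar>expec (\<lambda>x. c x + m x) h - (expec c h * (1 - p c) + Q c)\<bar> \<le> 3 * \<mu>\<^sup>2"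
    unfolding p_def Q_def X_def by (rule expec_expand[OF c m mu h h1])
  moreover have "\<bar>expec (\<lambda>x. c' x + m x) h - (expec c' h * (1 - p c') + Q c')\<bar> \<le> 3 * \<mu>\<^sup>2"
    unfolding p_def Q_def X_def by (rule expec_expand[OF c' m mu h h1])
  ultimately show ?thesis by linarith
qed

lemma expec_const_on_support:
  assumes a: "activity a" "\<And>x. x \<in> L \<Longrightarrow> a x = 0" "\<And>\<eta>. h \<eta> = h (\<eta> \<inter> L)"
  shows "expec a h = enn2real (h {})"
proof -
  have "Z a h = h {} * Z1 a"
    by (rule Z_const_on_support[of a L h]) (use a in \<open>auto simp: activity_def\<close>)
  then show ?thesis using partition_sum_pos[OF a(1)] by (simp add: expec_def enn2real_mult partition_sum_def)
qed

end

subsection \<open>The recursion for one-point densities\<close>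

locale finite_range_boltzmann = boltzmann_factor b for b :: "'a::euclidean_space \<Rightarrow> real" +
  fixes R :: real
  assumes R_pos: "0 < R" and b_range: "R \<le> norm x \<Longrightarrow> b x = 1"
begin

definition mayer :: "'a \<Rightarrow> 'a \<Rightarrow> ennreal" where "mayer v w = ennreal (1 - b (v - w))"

lemma mayer_measurable[measurable]: "(\<lambda>p. mayer (f p) (g p)) \<in> borel_measurable M"
  if [measurable]: "f \<in> borel_measurable M" "g \<in> borel_measurable M"
  unfolding mayer_def by measurable

lemma B_plus_mayer: "B v w + mayer v w = 1"
  unfolding B_def mayer_def using b_nonneg b_le_1 by (simp add: ennreal_plus[symmetric] del: ennreal_plus)

lemma mayer_le_1: "mayer v w \<le> 1"
  unfolding mayer_def using b_nonneg by (simp add: ennreal_le_1)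

lemma mayer_range: "R \<le> norm (w - v) \<Longrightarrow> mayer v w = 0"
  unfolding mayer_def using b_range[of "v - w"] by (simp add: norm_minus_commute)

lemma B_range: "R \<le> norm (w - v) \<Longrightarrow> B v w = 1"
  unfolding B_def using b_range[of "v - w"] by (simp add: norm_minus_commute)

text \<open>The interaction with \<open>v\<close> is switched on only inside the open ball of radius
  \<open>t\<close>: an interpolation from \<open>a\<close> at \<open>t = 0\<close> to
  \<open>damp a v\<close> at \<open>t = R\<close>.\<close>

definition cut :: "('a \<Rightarrow> ennreal) \<Rightarrow> 'a \<Rightarrow> real \<Rightarrow> 'a \<Rightarrow> ennreal" where
  "cut a v t x = a x * (if norm (x - v) < t then B v x else 1)"

text \<open>The activity \<open>m\<close> in the recursion for \<open>r\<^sub>l(v)\<close>.\<close>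

definition branch :: "('a \<Rightarrow> ennreal) \<Rightarrow> 'a \<Rightarrow> 'a \<Rightarrow> 'a \<Rightarrow> ennreal" where
  "branch a v w = cut a v (norm (w - v))"

lemma cut_le: "cut a v t x \<le> a x"
  unfolding cut_def by (simp add: damp_le)

lemma activity_cut: "activity a \<Longrightarrow> activity (cut a v t)"
  by (rule activity_mono[OF _ _ cut_le]) (auto simp: cut_def[abs_def] activity_def)

lemma activity_branch: "activity a \<Longrightarrow> activity (branch a v w)"
  unfolding branch_def by (rule activity_cut)

lemma branch_ratio_measurable:
  assumes "activity a"
  shows "(\<lambda>w. ratio (branch a v w) w) \<in> borel_measurable borel"
proof -
  have [measurable]: "a \<in> borel_measurable borel" using assms by (simp add: activity_def)
  have "(\<lambda>w. ratio (branch a v w) w) \<in> borel_measurable lborel"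
    unfolding branch_def cut_def[abs_def] by (rule ratio_measurable) measurable
  then show ?thesis by simp
qed

definition bounded_activity :: "real \<Rightarrow> ('a \<Rightarrow> ennreal) \<Rightarrow> bool" where
  "bounded_activity lam a \<longleftrightarrow> activity a \<and> (AE x in lborel. a x \<le> ennreal lam)"

lemma bounded_activity_mono:
  "bounded_activity lam a \<Longrightarrow> c \<in> borel_measurable borel \<Longrightarrow> (\<And>x. c x \<le> a x) \<Longrightarrow> bounded_activity lam c"
  unfolding bounded_activity_def by (auto elim!: eventually_mono intro: activity_mono order_trans)

text \<open>The quantity - ln \<open>ratio a v\<close> is collected shell by shell along the
  interpolation \<open>cut a v t\<close>. A point \<open>w\<close> is affected when the radius
  passes \<open>norm (w - v)\<close>, so the ratio there is taken at the activity of just that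
  radius, \<open>branch a v w\<close>. The bound \<open>lam\<close> controls the mass of a shell by
  its volume.\<close>

lemma ratio_recursion:
  assumes bd: "bounded_activity lam a" and lam: "0 \<le> lam"
  shows "ratio a v = exp (- (LINT w|density lborel (\<lambda>w. a w * mayer v w). ratio (branch a v w) w))"
proof -
  define n where "n w = a w * mayer v w" for w
  define g where "g w = ratio (branch a v w) w" for w
  define J where "J t = (LINT w|density lborel n. indicator {w. norm (w - v) < t} w * g w)" for t
  \<comment> \<open>Across a thin shell the two summands change by opposite amounts, up to second order.\<close>
  define F where "F t = ln (partition_sum (cut a v t)) + J t" for t
  have a: "activity a" and alam: "AE x in lborel. a x \<le> ennreal lam"
    using bd by (auto simp: bounded_activity_def)
  note [measurable] = a
  have n: "activity n" unfolding n_def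
    by (rule activity_mono[OF a]) (auto intro: mult_left_mono[OF mayer_le_1, of "a _", simplified])
  note [measurable] = n
  have g: "g \<in> borel_measurable borel" "\<And>w. 0 \<le> g w" "\<And>w. g w \<le> 1"
    using branch_ratio_measurable[OF a] ratio_nonneg ratio_le_1 activity_branch[OF a]
    unfolding g_def by (auto intro: less_imp_le)
  note [measurable] = g(1)
  have ind: "(\<lambda>w. indicator S w * g w) \<in> borel_measurable borel" "0 \<le> indicator S w * g w" "indicator S w * g w \<le> 1"
    if [measurable]: "S \<in> sets borel" for S w
    using g by (auto simp: indicator_def)
  have "F R = F 0"
  \<comment> \<open>With this \<open>\<kappa>\<close> the increment
    \<open>\<kappa> * (t ^ d - s ^ d)\<close> is \<open>lam\<close> times the volume of the shell, a
    bound for the mass of \<open>m\<close>; \<open>1/2\<close> and \<open>8\<close> are the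
    threshold and the constant of \<open>ln_partition_step\<close>.\<close>
  proof (rule constant_by_quadratic_increments[where d="DIM('a)" and \<eta>="1/2" and
        \<kappa>="lam * unit_ball_vol (real DIM('a))" and K=8])
    fix s t :: real assume st: "0 \<le> s" "s \<le> t"
    define S where "S = ball v t - ball v s"
    define m where "m w = indicator S w * n w" for w
    define \<mu> where "\<mu> = lam * unit_ball_vol (real DIM('a)) * (t ^ DIM('a) - s ^ DIM('a))"
    assume "lam * unit_ball_vol (real DIM('a)) * (t ^ DIM('a) - s ^ DIM('a)) \<le> 1/2"
    then have mu: "\<mu> \<le> 1/2" unfolding \<mu>_def .
    have mu0: "0 \<le> \<mu>" unfolding \<mu>_def using lam st by (intro mult_nonneg_nonneg) (auto intro: power_mono)
    have S[measurable]: "S \<in> sets borel" unfolding S_def by simp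
    have m: "activity m" unfolding m_def
      by (rule activity_mono[OF n]) (auto simp: indicator_def)
    have c: "activity (cut a v t)" by (rule activity_cut[OF a])
    have "(\<integral>\<^sup>+ x. m x \<partial>lborel) \<le> (\<integral>\<^sup>+ x. ennreal lam * indicator S x \<partial>lborel)"
    proof (rule nn_integral_mono_AE)
      show "AE x in lborel. m x \<le> ennreal lam * indicator S x"
        using alam
      proof eventually_elim
        case (elim x)
        then show ?case
          unfolding m_def n_def using mult_mono[OF elim mayer_le_1[of v x]] by (auto simp: indicator_def)
      qed
    qed
    also have "\<dots> = ennreal lam * emeasure lborel S"
      by (simp add: nn_integral_cmult_indicator)
    also have "emeasure lborel S = emeasure lborel (ball v t) - emeasure lborel (ball v s)"
      unfolding S_def using st by (intro emeasure_Diff) (use emeasure_lborel_ball_finite[of v s] in \<open>auto intro: subset_ball\<close>)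
    also have "\<dots> = ennreal (unit_ball_vol (real DIM('a)) * (t ^ DIM('a) - s ^ DIM('a)))"
      using st by (simp add: emeasure_ball ennreal_minus right_diff_distrib)
    finally have mint: "(\<integral>\<^sup>+ x. m x \<partial>lborel) \<le> ennreal \<mu>"
      unfolding \<mu>_def using lam st by (simp add: ennreal_mult[symmetric] mult.assoc power_mono)
    have eq: "cut a v s = (\<lambda>x. cut a v t x + m x)"
    proof
      fix x
      have "a x * B v x + a x * mayer v x = a x"
        using B_plus_mayer[of v x] by (simp add: distrib_left[symmetric])
      then show "cut a v s x = cut a v t x + m x"
        using st unfolding cut_def m_def n_def S_def by (auto simp: dist_norm norm_minus_commute)
    qed
    \<comment> \<open>A point of the shell lies at a distance between \<open>s\<close> and
      \<open>t\<close>, so \<open>branch a v w\<close> is enclosed by \<open>cut a v t\<close> and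
      \<open>cut a v s\<close>, which differ by \<open>m\<close>.\<close>
    have close: "\<bar>g w - ratio (cut a v t) w\<bar> \<le> 2 * \<mu>" if "m w \<noteq> 0" for w
      unfolding g_def
    proof (rule ratio_between[OF c m mint mu0 mu])
      have w: "s \<le> norm (w - v)" "norm (w - v) < t"
        using that unfolding m_def S_def by (auto simp: dist_norm norm_minus_commute split: split_indicator_asm)
      show "branch a v w \<in> borel_measurable borel"
        using activity_branch[OF a] by (simp add: activity_def)
      fix x
      show "cut a v t x \<le> branch a v w x"
        unfolding branch_def cut_def using w by (auto simp: damp_le)
      have "branch a v w x \<le> cut a v s x"
        unfolding branch_def cut_def using w by (auto simp: damp_le)
      then show "branch a v w x \<le> cut a v t x + m x" unfolding eq .
    qed
    have "ennreal (LINT w|density lborel m. g w) = (\<integral>\<^sup>+ w. n w * ennreal (indicator S w * g w) \<partial>lborel)"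
      unfolding nn_integral_unit_interval[OF m g, symmetric] m_def
      by (intro nn_integral_cong) (auto simp: indicator_def)
    also have "\<dots> = ennreal (LINT w|density lborel n. indicator S w * g w)"
      by (rule nn_integral_unit_interval[OF n ind[OF S]])
    finally have "(LINT w|density lborel m. g w) = (LINT w|density lborel n. indicator S w * g w)"
      using g by (subst (asm) ennreal_inj) (auto intro!: integral_nonneg_AE)
    also have "\<dots> = (LINT w|density lborel n. indicator {w. norm (w - v) < t} w * g w - indicator {w. norm (w - v) < s} w * g w)"
      using st by (intro Bochner_Integration.integral_cong) (auto simp: S_def indicator_def dist_norm norm_minus_commute)
    also have "\<dots> = J t - J s"
      unfolding J_def by (intro Bochner_Integration.integral_diff integrable_unit_interval[OF n] ind) measurable
    finally have Jm: "(LINT w|density lborel m. g w) = J t - J s" .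
    show "\<bar>F t - F s\<bar> \<le> 8 * (lam * unit_ball_vol (real DIM('a)) * (t ^ DIM('a) - s ^ DIM('a)))\<^sup>2"
      using ln_partition_step[OF c m mint mu0 mu g close] unfolding Jm eq[symmetric] F_def \<mu>_def by linarith
  qed (use R_pos lam in auto)
  moreover have "cut a v 0 = a" by (auto simp: cut_def)
  moreover have "cut a v R = damp a v" by (auto simp: cut_def B_range not_less)
  moreover have "J 0 = 0" unfolding J_def by simp
  moreover have "J R = (LINT w|density lborel n. g w)"
  proof -
    have "ennreal (J R) = (\<integral>\<^sup>+ w. n w * ennreal (indicator {w. norm (w - v) < R} w * g w) \<partial>lborel)"
      unfolding J_def by (rule nn_integral_unit_interval[OF n ind, symmetric]) measurable
    also have "\<dots> = (\<integral>\<^sup>+ w. n w * ennreal (g w) \<partial>lborel)"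
      by (intro nn_integral_cong) (auto simp: indicator_def n_def mayer_range not_less)
    also have "\<dots> = ennreal (LINT w|density lborel n. g w)" by (rule nn_integral_unit_interval[OF n g])
    finally show ?thesis unfolding J_def
      using g by (subst (asm) ennreal_inj) (auto intro!: integral_nonneg_AE)
  qed
  ultimately have "ln (partition_sum (damp a v)) - ln (partition_sum a) = - (LINT w|density lborel n. g w)"
    unfolding F_def by simp
  then have "ln (ratio a v) = - (LINT w|density lborel n. g w)"
    unfolding ratio_def using partition_sum_pos[OF a] partition_sum_pos[OF activity_damp[OF a], of v] by (simp add: ln_div)
  then have "exp (ln (ratio a v)) = exp (- (LINT w|density lborel n. g w))" by (simp only:)
  then show ?thesis using ratio_nonneg[OF a, of v] unfolding n_def g_def by simp
qed

subsection \<open>Contraction along walks\<close>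

definition sqrt_ratio :: "('a \<Rightarrow> ennreal) \<Rightarrow> 'a \<Rightarrow> real" where "sqrt_ratio a v = sqrt (ratio a v)"

lemma sqrt_ratio_bounds: "activity a \<Longrightarrow> 0 \<le> sqrt_ratio a v" "activity a \<Longrightarrow> sqrt_ratio a v \<le> 1"
  unfolding sqrt_ratio_def using ratio_nonneg[of a v] ratio_le_1[of a v] by auto

definition agree :: "('a \<Rightarrow> ennreal) \<Rightarrow> ('a \<Rightarrow> ennreal) \<Rightarrow> 'a \<Rightarrow> real \<Rightarrow> bool" where
  "agree a a' v s \<longleftrightarrow> (\<forall>x. norm (x - v) < s \<longrightarrow> a x = a' x)"

text \<open>Agreement within the range \<open>R\<close> makes both recursions integrate against one
  measure, \<open>a w * mayer v w\<close>. Only then are the two exponents squared norms in the same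
  L2 space; beyond that the activities differ only through their branches.\<close>

lemma sqrt_ratio_contraction:
  assumes a: "bounded_activity lam a" and a': "bounded_activity lam a'" and lam: "0 \<le> lam"
    and ag: "agree a a' v R"
  shows "ennreal ((sqrt_ratio a v - sqrt_ratio a' v)\<^sup>2) \<le> ennreal (exp (- 1)) *
    (\<integral>\<^sup>+ w. a w * mayer v w * ennreal ((sqrt_ratio (branch a v w) w - sqrt_ratio (branch a' v w) w)\<^sup>2) \<partial>lborel)"
proof -
  define n where "n w = a w * mayer v w" for w
  define y where "y w = sqrt_ratio (branch a v w) w" for w
  define y' where "y' w = sqrt_ratio (branch a' v w) w" for w
  have act: "activity a" "activity a'" using a a' by (auto simp: bounded_activity_def)
  note [measurable] = act
  have n: "activity n" unfolding n_def
    by (rule activity_mono[OF act(1)]) (auto intro: mult_left_mono[OF mayer_le_1, of "a _", simplified])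
  note [measurable] = n
  have n': "(\<lambda>w. a' w * mayer v w) = n"
  proof
    fix w show "a' w * mayer v w = n w"
      using ag mayer_range[of w v] by (cases "norm (w - v) < R") (auto simp: n_def agree_def)
  qed
  have m[measurable]: "y \<in> borel_measurable borel" "y' \<in> borel_measurable borel"
    using branch_ratio_measurable act unfolding y_def y'_def sqrt_ratio_def by auto
  have b: "0 \<le> y w" "y w \<le> 1" "0 \<le> y' w" "y' w \<le> 1" for w
    unfolding y_def y'_def using sqrt_ratio_bounds activity_branch act by auto
  have sq: "ratio (branch a v w) w = (y w)\<^sup>2" "ratio (branch a' v w) w = (y' w)\<^sup>2" for w
    using ratio_nonneg[OF activity_branch[OF act(1)]] ratio_nonneg[OF activity_branch[OF act(2)]]
    unfolding y_def y'_def sqrt_ratio_def by (auto simp: less_imp_le)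
  have sqrt_exp: "sqrt (exp (- x)) = exp (- x / 2)" for x :: real
    by (rule real_sqrt_unique) (auto simp: exp_double[symmetric])
  have "sqrt_ratio a v = exp (- (LINT w|density lborel n. (y w)\<^sup>2) / 2)"
    unfolding sqrt_ratio_def ratio_recursion[OF a lam, of v] sq n_def[symmetric] sqrt_exp ..
  moreover have "sqrt_ratio a' v = exp (- (LINT w|density lborel n. (y' w)\<^sup>2) / 2)"
    unfolding sqrt_ratio_def ratio_recursion[OF a' lam, of v] sq n' sqrt_exp ..
  ultimately have "(sqrt_ratio a v - sqrt_ratio a' v)\<^sup>2 \<le> exp (- 1) * (LINT w|density lborel n. (y w - y' w)\<^sup>2)"
    using exp_integral_square_contraction[OF finite_measure_activity[OF n], of y y'] b by simp
  then have "ennreal ((sqrt_ratio a v - sqrt_ratio a' v)\<^sup>2) \<le> ennreal (exp (- 1)) * ennreal (LINT w|density lborel n. (y w - y' w)\<^sup>2)"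
    by (subst ennreal_mult[symmetric]) (auto intro: ennreal_leI)
  also have "ennreal (LINT w|density lborel n. (y w - y' w)\<^sup>2) = (\<integral>\<^sup>+ w. n w * ennreal ((y w - y' w)\<^sup>2) \<partial>lborel)"
  proof (rule nn_integral_unit_interval[OF n, symmetric])
    fix w
    have "\<bar>y w - y' w\<bar> \<le> 1" using b[of w] by linarith
    then show "(y w - y' w)\<^sup>2 \<le> 1" by (simp add: abs_square_le_1)
  qed auto
  finally show ?thesis unfolding n_def y_def y'_def .
qed

text \<open>With \<open>m = j - 1\<close> and \<open>x\<close> as vertex \<open>j\<close> this is
  the exponential factor of vertex \<open>j\<close> in V_k. Vertex \<open>m\<close> has no successor
  yet, hence no radius, so the product stops before it.\<close>

definition history_weight :: "nat \<Rightarrow> (nat \<Rightarrow> 'a) \<Rightarrow> 'a \<Rightarrow> real" where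
  "history_weight m h x = (\<Prod>i<m. if norm (x - h i) < norm (h i - h (Suc i)) then b (x - h i) else 1)"

definition step_weight :: "nat \<Rightarrow> (nat \<Rightarrow> 'a) \<Rightarrow> 'a \<Rightarrow> real" where
  "step_weight m h w = history_weight m h w * (1 - b (w - h m))"

text \<open>
  \<open>walk_integral j m h\<close> integrates over the remaining \<open>j\<close> vertices of a walk whose vertices
  \<open>h 0, \<dots>, h m\<close> are already fixed; the later values of \<open>h\<close> are irrelevant.
\<close>

primrec walk_integral :: "nat \<Rightarrow> nat \<Rightarrow> (nat \<Rightarrow> 'a) \<Rightarrow> ennreal" where
  "walk_integral 0 m h = 1"
| "walk_integral (Suc j) m h = (\<integral>\<^sup>+ w. ennreal (step_weight m h w) * walk_integral j (Suc m) (h(Suc m := w)) \<partial>lborel)"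

lemma history_weight_bounds: "0 \<le> history_weight m h x" "history_weight m h x \<le> 1"
  unfolding history_weight_def using b_nonneg b_le_1 by (auto intro!: prod_nonneg prod_le_1)

lemma history_weight_cong: "(\<And>i. i \<le> m \<Longrightarrow> h i = h' i) \<Longrightarrow> history_weight m h x = history_weight m h' x"
  unfolding history_weight_def by (intro prod.cong) auto

lemma step_weight_cong: "(\<And>i. i \<le> m \<Longrightarrow> h i = h' i) \<Longrightarrow> step_weight m h x = step_weight m h' x"
  unfolding step_weight_def using history_weight_cong[of m h h' x] by simp

lemma step_weight_nonneg: "0 \<le> step_weight m h w"
  unfolding step_weight_def using history_weight_bounds b_le_1 by simp

lemma step_weight_measurable:
  assumes "\<And>i. i \<le> m \<Longrightarrow> (\<lambda>p. h p i) \<in> borel_measurable M" and [measurable]: "u \<in> borel_measurable M"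
  shows "(\<lambda>p. step_weight m (h p) (u p)) \<in> borel_measurable M"
proof -
  have "(\<lambda>p. if norm (u p - h p i) < norm (h p i - h p (Suc i)) then b (u p - h p i) else 1) \<in> borel_measurable M"
    if "i < m" for i
  proof -
    have [measurable]: "(\<lambda>p. h p i) \<in> borel_measurable M" "(\<lambda>p. h p (Suc i)) \<in> borel_measurable M"
      using that by (auto intro: assms(1))
    show ?thesis by measurable
  qed
  then have [measurable]: "(\<lambda>p. history_weight m (h p) (u p)) \<in> borel_measurable M"
    unfolding history_weight_def by (intro borel_measurable_prod) auto
  have [measurable]: "(\<lambda>p. h p m) \<in> borel_measurable M" by (auto intro: assms(1))
  show ?thesis unfolding step_weight_def by measurable
qed

definition extend_history :: "nat \<Rightarrow> (nat \<Rightarrow> 'a) \<Rightarrow> (nat \<Rightarrow> 'a) \<Rightarrow> nat \<Rightarrow> 'a" where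
  "extend_history m h x = (\<lambda>i. if i \<le> m then h i else x i)"

lemma extend_history_measurable:
  assumes "\<And>i. i \<le> m \<Longrightarrow> (\<lambda>p. h p i) \<in> borel_measurable M" and "l \<le> m + j"
  shows "(\<lambda>z. extend_history m (h (fst z)) (snd z) l) \<in> borel_measurable (M \<Otimes>\<^sub>M PiM {Suc m..m + j} (\<lambda>_. lborel))"
proof (cases "l \<le> m")
  case True
  then show ?thesis unfolding extend_history_def using measurable_compose[OF measurable_fst assms(1)[OF True]] by simp
next
  case False
  then have "l \<in> {Suc m..m + j}" using assms by auto
  then have "(\<lambda>x. x l) \<in> PiM {Suc m..m + j} (\<lambda>_. lborel) \<rightarrow>\<^sub>M (lborel :: 'a measure)"
    by (rule measurable_component_singleton)
  then show ?thesis unfolding extend_history_def using False measurable_compose[OF measurable_snd] by simp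
qed

abbreviation walk_weight :: "nat \<Rightarrow> nat \<Rightarrow> (nat \<Rightarrow> 'a) \<Rightarrow> real" where
  "walk_weight m j v \<equiv> \<Prod>i\<in>{m..<m + j}. step_weight i v (v (Suc i))"

lemma walk_weight_measurable:
  assumes "\<And>i. i \<le> m \<Longrightarrow> (\<lambda>p. h p i) \<in> borel_measurable M"
  shows "(\<lambda>z. walk_weight m j (extend_history m (h (fst z)) (snd z))) \<in>
    borel_measurable (M \<Otimes>\<^sub>M PiM {Suc m..m + j} (\<lambda>_. lborel))"
  by (intro borel_measurable_prod step_weight_measurable extend_history_measurable assms) auto

text \<open>A fixed history is treated as a family over a dummy parameter space and then
  sliced.\<close>

lemma walk_weight_measurable1:
  "(\<lambda>x. walk_weight m j (extend_history m h x)) \<in> borel_measurable (PiM {Suc m..m + j} (\<lambda>_. lborel))"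
proof -
  have "(\<lambda>z :: (nat \<Rightarrow> 'a) \<times> (nat \<Rightarrow> 'a). walk_weight m j (extend_history m h (snd z))) \<in>
    borel_measurable (count_space UNIV \<Otimes>\<^sub>M PiM {Suc m..m + j} (\<lambda>_. lborel))"
    using walk_weight_measurable[of m "\<lambda>_. h" "count_space UNIV"] by simp
  from measurable_compose[OF measurable_Pair1'[of undefined "count_space UNIV"] this]
  show ?thesis by simp
qed

text \<open>Here the lowest free coordinate \<open>Suc m\<close> is split off, as the walk grows
  forward. For \<open>m = 0\<close> and a history at the origin the right side is V_j.\<close>

lemma walk_integral_eq_integral:
  "walk_integral j m h = (\<integral>\<^sup>+ x. ennreal (walk_weight m j (extend_history m h x)) \<partial>PiM {Suc m..m + j} (\<lambda>_. lborel))"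
proof (induction j arbitrary: m h)
  case 0
  interpret product_sigma_finite "\<lambda>_. lborel :: 'a measure" ..
  have "{Suc m..m + 0} = {}" by simp
  show ?case unfolding \<open>{Suc m..m + 0} = {}\<close> by (subst nn_integral_empty) auto
next
  case (Suc j)
  interpret product_sigma_finite "\<lambda>_. lborel :: 'a measure" ..
  have eq: "{Suc m..m + Suc j} = insert (Suc m) {Suc (Suc m)..Suc m + j}" by auto
  have upd: "extend_history m h (x(Suc m := y)) = extend_history (Suc m) (h(Suc m := y)) x" for x y
    by (auto simp: extend_history_def fun_eq_iff)
  have w: "walk_weight m (Suc j) (extend_history m h (x(Suc m := y))) =
      step_weight m h y * walk_weight (Suc m) j (extend_history (Suc m) (h(Suc m := y)) x)" for x y
  proof -
    have "{m..<m + Suc j} = insert m {Suc m..<Suc m + j}" by auto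
    moreover have "step_weight m (extend_history (Suc m) (h(Suc m := y)) x) y = step_weight m h y"
      by (rule step_weight_cong) (auto simp: extend_history_def)
    ultimately show ?thesis unfolding upd by (simp add: extend_history_def)
  qed
  have "(\<integral>\<^sup>+ x. ennreal (walk_weight m (Suc j) (extend_history m h x)) \<partial>PiM {Suc m..m + Suc j} (\<lambda>_. lborel))
    = (\<integral>\<^sup>+ y. \<integral>\<^sup>+ x. ennreal (walk_weight m (Suc j) (extend_history m h (x(Suc m := y)))) \<partial>PiM {Suc (Suc m)..Suc m + j} (\<lambda>_. lborel) \<partial>lborel)"
    unfolding eq
    by (rule product_nn_integral_insert_rev) (use walk_weight_measurable1[where m=m and j="Suc j" and h=h, unfolded eq] in auto)
  also have "\<dots> = (\<integral>\<^sup>+ y. ennreal (step_weight m h y) * walk_integral j (Suc m) (h(Suc m := y)) \<partial>lborel)"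
    unfolding w Suc.IH
  proof (rule nn_integral_cong)
    fix y
    have m: "(\<lambda>x. ennreal (walk_weight (Suc m) j (extend_history (Suc m) (h(Suc m := y)) x)))
        \<in> borel_measurable (PiM {Suc (Suc m)..Suc m + j} (\<lambda>_. lborel))"
      by (rule measurable_compose[OF walk_weight_measurable1 measurable_ennreal])
    show "(\<integral>\<^sup>+ x. ennreal (step_weight m h y * walk_weight (Suc m) j (extend_history (Suc m) (h(Suc m := y)) x))
        \<partial>PiM {Suc (Suc m)..Suc m + j} (\<lambda>_. lborel))
      = ennreal (step_weight m h y) * (\<integral>\<^sup>+ x. ennreal (walk_weight (Suc m) j (extend_history (Suc m) (h(Suc m := y)) x))
        \<partial>PiM {Suc (Suc m)..Suc m + j} (\<lambda>_. lborel))"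
      unfolding nn_integral_cmult[OF m, symmetric]
      by (intro nn_integral_cong ennreal_mult step_weight_nonneg prod_nonneg)
  qed
  finally show ?case by simp
qed

lemma walk_integral_measurable:
  assumes "\<And>i. i \<le> m \<Longrightarrow> (\<lambda>p. h p i) \<in> borel_measurable M"
  shows "(\<lambda>p. walk_integral j m (h p)) \<in> borel_measurable M"
proof -
  interpret product_sigma_finite "\<lambda>_. lborel :: 'a measure" ..
  interpret C: sigma_finite_measure "PiM {Suc m..m + j} (\<lambda>_. lborel :: 'a measure)" by (rule sigma_finite) simp
  show ?thesis unfolding walk_integral_eq_integral
    by (intro C.borel_measurable_nn_integral, unfold split_beta)
      (intro measurable_compose[OF walk_weight_measurable[OF assms] measurable_ennreal])
qed

lemma walk_integral_integrand_measurable: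
  "(\<lambda>w. ennreal (step_weight m h w) * walk_integral j (Suc m) (h(Suc m := w))) \<in> borel_measurable lborel"
proof (intro borel_measurable_times_ennreal walk_integral_measurable measurable_compose[OF step_weight_measurable measurable_ennreal])
  show "(\<lambda>w. (h(Suc m := w)) i) \<in> borel_measurable lborel" for i
    by (cases "i = Suc m") auto
qed auto

text \<open>Weights depend only on differences of vertices. This lets a walk restart at an arbitrary
  point with the same V_k.\<close>

lemma walk_integral_translate: "walk_integral j m (\<lambda>i. h i + c) = walk_integral j m h"
proof (induction j arbitrary: m h)
  case (Suc j)
  have sw: "step_weight m (\<lambda>i. h i + c) (c + w) = step_weight m h w" for w
    unfolding step_weight_def history_weight_def by (intro arg_cong2[of _ _ _ _ "(*)"] prod.cong) (auto simp: algebra_simps)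
  have upd: "(\<lambda>i. h i + c)(Suc m := c + w) = (\<lambda>i. (h(Suc m := w)) i + c)" for w
    by (auto simp: add.commute)
  have "walk_integral (Suc j) m (\<lambda>i. h i + c) =
    (\<integral>\<^sup>+ w. ennreal (step_weight m (\<lambda>i. h i + c) w) * walk_integral j (Suc m) ((\<lambda>i. h i + c)(Suc m := w)) \<partial>distr lborel borel ((+) c))"
    unfolding lborel_distr_plus walk_integral.simps ..
  also have "\<dots> = (\<integral>\<^sup>+ w. ennreal (step_weight m h w) * walk_integral j (Suc m) (h(Suc m := w)) \<partial>lborel)"
    by (subst nn_integral_distr)
      (use walk_integral_integrand_measurable[of m "\<lambda>i. h i + c" j] in \<open>simp_all add: sw upd Suc.IH del: fun_upd_apply\<close>)
  finally show ?case by simp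
qed simp

text \<open>Each step stays within distance \<open>R\<close> of the previous vertex, so every
  integration costs at most the volume of a ball. Finiteness matters because \<open>enn2real\<close>
  in the connective constant would send infinity to 0.\<close>

lemma walk_integral_finite: "walk_integral j m h < \<infinity>"
proof -
  define C where "C = ennreal (unit_ball_vol (real DIM('a)) * R ^ DIM('a))"
  have "walk_integral j m h \<le> C ^ j"
  proof (induction j arbitrary: m h)
    case (Suc j)
    have "walk_integral (Suc j) m h \<le> (\<integral>\<^sup>+ w. indicator (ball (h m) R) w * C ^ j \<partial>lborel)"
      unfolding walk_integral.simps
    proof (intro nn_integral_mono mult_mono Suc.IH)
      fix w
      have "step_weight m h w \<le> 1 * (1 - b (w - h m))"
        unfolding step_weight_def using history_weight_bounds[of m h w] b_le_1 by (intro mult_right_mono) auto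
      then show "ennreal (step_weight m h w) \<le> indicator (ball (h m) R) w"
        using b_range[of "w - h m"] b_nonneg[of "w - h m"]
        by (auto simp: indicator_def dist_norm norm_minus_commute ennreal_le_1 ennreal_eq_0_iff not_less)
    qed auto
    also have "\<dots> = C ^ Suc j"
      using R_pos by (subst nn_integral_multc) (auto simp: emeasure_ball C_def intro!: borel_measurable_indicator)
    finally show ?case .
  qed simp
  also have "C ^ j < \<infinity>" unfolding C_def using R_pos by (subst ennreal_power) auto
  finally show ?thesis .
qed

section \<open>Iterating the contraction along the history of a walk\<close>

definition history_activity :: "('a \<Rightarrow> ennreal) \<Rightarrow> nat \<Rightarrow> (nat \<Rightarrow> 'a) \<Rightarrow> 'a \<Rightarrow> ennreal" where
  "history_activity a m h x = a x * ennreal (history_weight m h x)"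

text \<open>Branching at the current end of a walk towards \<open>w\<close> amounts to appending
  \<open>w\<close> to the history: the cut radius around \<open>h m\<close> is the distance to its
  successor. By this identity the iterated recursion runs over exactly the walks weighted in
  V_k.\<close>

lemma history_activity_branch: "branch (history_activity a m h) (h m) w = history_activity a (Suc m) (h(Suc m := w))"
proof
  fix x
  have "history_weight (Suc m) (h(Suc m := w)) x = history_weight m h x * (if norm (x - h m) < norm (h m - w) then b (x - h m) else 1)"
    using history_weight_cong[of m "h(Suc m := w)" h x] unfolding history_weight_def by simp
  moreover have "B (h m) x = ennreal (b (x - h m))" by (subst B_commute) (rule B_def)
  ultimately show "branch (history_activity a m h) (h m) w x = history_activity a (Suc m) (h(Suc m := w)) x"
    using history_weight_bounds b_nonneg
    by (simp add: branch_def cut_def history_activity_def ennreal_mult mult.assoc norm_minus_commute)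
qed

lemma history_weight_measurable: "history_weight m h \<in> borel_measurable borel"
  unfolding history_weight_def[abs_def] by measurable

lemma bounded_activity_history: "bounded_activity lam a \<Longrightarrow> bounded_activity lam (history_activity a m h)"
  by (rule bounded_activity_mono)
    (auto simp: history_activity_def[abs_def] bounded_activity_def activity_def ennreal_le_1 history_weight_bounds
      intro!: measurable_compose[OF history_weight_measurable measurable_ennreal] intro: mult_left_mono[of _ 1 "a _", simplified]  borel_measurable_times_ennreal)

text \<open>The recursion is unfolded \<open>j\<close> times and \<open>D\<close> is inserted at the
  ends of the walks. A generation uses up \<open>R\<close> of the radius of agreement, because
  \<open>mayer\<close> vanishes beyond \<open>R\<close>; it contributes \<open>lam\<close> from the
  activity, \<open>exp (- 1)\<close> from the contraction and one step weight of the walk.\<close>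

lemma sqrt_ratio_iterate:
  assumes a: "bounded_activity lam a" and a': "bounded_activity lam a'" and lam: "0 \<le> lam"
    and r: "0 \<le> r" and D: "\<And>c c' v. bounded_activity lam c \<Longrightarrow> bounded_activity lam c' \<Longrightarrow> agree c c' v r \<Longrightarrow>
      ennreal ((sqrt_ratio c v - sqrt_ratio c' v)\<^sup>2) \<le> D"
    and ag: "agree a a' (h m) (real j * R + r)"
  shows "ennreal ((sqrt_ratio (history_activity a m h) (h m) - sqrt_ratio (history_activity a' m h) (h m))\<^sup>2) \<le>
    ennreal (lam * exp (- 1)) ^ j * walk_integral j m h * D"
  using ag
proof (induction j arbitrary: m h)
  case 0
  then have "agree (history_activity a m h) (history_activity a' m h) (h m) r" by (simp add: agree_def history_activity_def)
  then show ?case using D[OF bounded_activity_history[OF a] bounded_activity_history[OF a']] by simp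
next
  case (Suc j)
  let ?e = "ennreal (exp (- 1))" and ?q = "ennreal (lam * exp (- 1)) ^ j"
  have "R \<le> real (Suc j) * R + r" using R_pos r by (simp add: algebra_simps)
  then have "agree (history_activity a m h) (history_activity a' m h) (h m) R"
    using Suc.prems by (auto simp: agree_def history_activity_def)
  then have "ennreal ((sqrt_ratio (history_activity a m h) (h m) - sqrt_ratio (history_activity a' m h) (h m))\<^sup>2) \<le> ?e *
    (\<integral>\<^sup>+ w. history_activity a m h w * mayer (h m) w * ennreal ((sqrt_ratio (history_activity a (Suc m) (h(Suc m := w))) w - sqrt_ratio (history_activity a' (Suc m) (h(Suc m := w))) w)\<^sup>2) \<partial>lborel)"
    using sqrt_ratio_contraction[OF bounded_activity_history[of lam a m h, OF a] bounded_activity_history[of lam a' m h, OF a'] lam, where v="h m"]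
    unfolding history_activity_branch by blast
  also have "\<dots> \<le> ?e * (\<integral>\<^sup>+ w. ennreal lam * ?q * D * (ennreal (step_weight m h w) * walk_integral j (Suc m) (h(Suc m := w))) \<partial>lborel)"
  proof (intro mult_left_mono nn_integral_mono_AE)
    have "AE w in lborel. a w \<le> ennreal lam" using a by (simp add: bounded_activity_def)
    then show "AE w in lborel. history_activity a m h w * mayer (h m) w * ennreal ((sqrt_ratio (history_activity a (Suc m) (h(Suc m := w))) w - sqrt_ratio (history_activity a' (Suc m) (h(Suc m := w))) w)\<^sup>2)
      \<le> ennreal lam * ?q * D * (ennreal (step_weight m h w) * walk_integral j (Suc m) (h(Suc m := w)))"
    proof eventually_elim
      case (elim w)
      show ?case
      proof (cases "norm (w - h m) < R")
        case False
        then show ?thesis by (simp add: mayer_range not_less)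
      next
        case True
        have "agree a a' w (real j * R + r)"
          unfolding agree_def
        proof (intro allI impI)
          fix x assume "norm (x - w) < real j * R + r"
          moreover have "norm (x - h m) \<le> norm (x - w) + norm (w - h m)"
            using norm_triangle_ineq[of "x - w" "w - h m"] by simp
          ultimately have "norm (x - h m) < real (Suc j) * R + r" using True by (simp add: algebra_simps)
          with Suc.prems show "a x = a' x" by (simp add: agree_def)
        qed
        then have IH: "ennreal ((sqrt_ratio (history_activity a (Suc m) (h(Suc m := w))) w - sqrt_ratio (history_activity a' (Suc m) (h(Suc m := w))) w)\<^sup>2)
          \<le> ?q * walk_integral j (Suc m) (h(Suc m := w)) * D"
          using Suc.IH[of "h(Suc m := w)" "Suc m"] unfolding fun_upd_same by blast
        have "history_activity a m h w * mayer (h m) w \<le> ennreal lam * ennreal (step_weight m h w)"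
        proof -
          have "b (h m - w) = b (w - h m)" using b_minus[of "w - h m"] by simp
          then have "ennreal (history_weight m h w) * mayer (h m) w = ennreal (step_weight m h w)"
            unfolding mayer_def step_weight_def using history_weight_bounds b_le_1 by (simp add: ennreal_mult)
          then show ?thesis unfolding history_activity_def mult.assoc using elim by (simp add: mult_right_mono)
        qed
        from mult_mono[OF this IH] show ?thesis by (simp add: mult_ac)
      qed
    qed
  qed simp
  also have "\<dots> = ?e * (ennreal lam * ?q * D * walk_integral (Suc j) m h)"
    unfolding walk_integral.simps by (subst nn_integral_cmult[OF walk_integral_integrand_measurable]) simp
  also have "\<dots> = ennreal (lam * exp (- 1)) ^ Suc j * walk_integral (Suc j) m h * D"
    using lam by (simp add: ennreal_mult mult_ac del: walk_integral.simps)
  finally show ?case .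
qed

text \<open>Walks are cut into blocks of \<open>k\<close> steps. At the end of a block the damped
  activities are regarded as arbitrary new bounded activities and the history is forgotten, so each
  block costs one factor \<open>q\<close> and the distance \<open>k * R\<close>.\<close>

lemma sqrt_ratio_decay:
  assumes lam: "0 \<le> lam" and q: "(lam * exp (- 1)) ^ k * enn2real (walk_integral k 0 (\<lambda>_. 0)) \<le> q" "0 \<le> q"
  shows "bounded_activity lam a \<Longrightarrow> bounded_activity lam a' \<Longrightarrow> agree a a' v (real n * (real k * R)) \<Longrightarrow>
    (sqrt_ratio a v - sqrt_ratio a' v)\<^sup>2 \<le> q ^ n"
proof (induction n arbitrary: a a' v)
  case 0
  then have "0 \<le> sqrt_ratio a v" "sqrt_ratio a v \<le> 1" "0 \<le> sqrt_ratio a' v" "sqrt_ratio a' v \<le> 1"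
    using sqrt_ratio_bounds by (auto simp: bounded_activity_def)
  then have "\<bar>sqrt_ratio a v - sqrt_ratio a' v\<bar> \<le> 1" by linarith
  then show ?case by (simp add: abs_square_le_1)
next
  case (Suc n)
  have h0: "history_activity c 0 h = c" for c h by (auto simp: history_activity_def history_weight_def)
  have T0: "walk_integral k 0 (\<lambda>_. v) = ennreal (enn2real (walk_integral k 0 (\<lambda>_. 0)))"
    using walk_integral_translate[of k 0 "\<lambda>_. 0" v] walk_integral_finite[of k 0 "\<lambda>_. 0"] by simp
  have "ennreal ((sqrt_ratio (history_activity a 0 (\<lambda>_. v)) v - sqrt_ratio (history_activity a' 0 (\<lambda>_. v)) v)\<^sup>2) \<le>
    ennreal (lam * exp (- 1)) ^ k * walk_integral k 0 (\<lambda>_. v) * ennreal (q ^ n)"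
  proof (rule sqrt_ratio_iterate[OF Suc.prems(1,2) lam, of "real n * (real k * R)" _ "\<lambda>_. v"])
    show "agree a a' v (real k * R + real n * (real k * R))"
      using Suc.prems(3) by (simp add: algebra_simps)
    show "ennreal ((sqrt_ratio c w - sqrt_ratio c' w)\<^sup>2) \<le> ennreal (q ^ n)"
      if "bounded_activity lam c" "bounded_activity lam c'" "agree c c' w (real n * (real k * R))" for c c' w
      using Suc.IH[OF that] by (rule ennreal_leI)
  qed (use R_pos in auto)
  also have "\<dots> = ennreal ((lam * exp (- 1)) ^ k * enn2real (walk_integral k 0 (\<lambda>_. 0)) * q ^ n)"
    unfolding T0 using lam q(2) by (subst (1 2) ennreal_mult) (auto simp: ennreal_power)
  finally have "(sqrt_ratio a v - sqrt_ratio a' v)\<^sup>2 \<le> (lam * exp (- 1)) ^ k * enn2real (walk_integral k 0 (\<lambda>_. 0)) * q ^ n"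
    unfolding h0 using lam q by (subst (asm) ennreal_le_iff) auto
  also have "\<dots> \<le> q * q ^ n" using q by (intro mult_right_mono) auto
  finally show ?case by simp
qed

lemma ratio_decay:
  assumes lam: "0 \<le> lam" and q: "(lam * exp (- 1)) ^ k * enn2real (walk_integral k 0 (\<lambda>_. 0)) \<le> q" "0 \<le> q"
    and a: "bounded_activity lam a" and a': "bounded_activity lam a'" and ag: "agree a a' v (real n * (real k * R))"
  shows "\<bar>ratio a v - ratio a' v\<bar> \<le> 2 * sqrt q ^ n"
proof -
  have act: "activity a" "activity a'" using a a' by (auto simp: bounded_activity_def)
  have sq: "ratio a v = (sqrt_ratio a v)\<^sup>2" "ratio a' v = (sqrt_ratio a' v)\<^sup>2"
    using ratio_nonneg[OF act(1), of v] ratio_nonneg[OF act(2), of v] by (auto simp: sqrt_ratio_def)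
  have "\<bar>sqrt_ratio a v - sqrt_ratio a' v\<bar> = sqrt ((sqrt_ratio a v - sqrt_ratio a' v)\<^sup>2)" by simp
  also have "\<dots> \<le> sqrt (q ^ n)" using sqrt_ratio_decay[OF lam q a a' ag] by (intro real_sqrt_le_mono)
  finally have d: "\<bar>sqrt_ratio a v - sqrt_ratio a' v\<bar> \<le> sqrt q ^ n" by (simp add: real_sqrt_power)
  have "\<bar>ratio a v - ratio a' v\<bar> = (sqrt_ratio a v + sqrt_ratio a' v) * \<bar>sqrt_ratio a v - sqrt_ratio a' v\<bar>"
    unfolding sq using sqrt_ratio_bounds act by (simp add: power2_eq_square square_diff_square_factored abs_mult)
  also have "\<dots> \<le> 2 * sqrt q ^ n"
    using d sqrt_ratio_bounds[OF act(1), of v] sqrt_ratio_bounds[OF act(2), of v] by (intro mult_mono) auto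
  finally show ?thesis .
qed

subsection \<open>Local total variation\<close>

lemma nn_integral_restrict_le:
  assumes a: "bounded_activity lam a" and lam: "0 \<le> lam" and C: "C \<in> sets borel" "bounded C"
  shows "(\<integral>\<^sup>+ x. a x * indicator C x \<partial>lborel) \<le> ennreal (lam * measure lborel C)"
proof -
  have "(\<integral>\<^sup>+ x. a x * indicator C x \<partial>lborel) \<le> (\<integral>\<^sup>+ x. ennreal lam * indicator C x \<partial>lborel)"
    using a unfolding bounded_activity_def
    by (intro nn_integral_mono_AE) (auto elim!: eventually_mono intro: mult_right_mono)
  also have "\<dots> = ennreal lam * emeasure lborel C" using C by (simp add: nn_integral_cmult_indicator)
  also have "\<dots> = ennreal (lam * measure lborel C)"
    using emeasure_bounded_finite[OF C(2)] lam by (simp add: emeasure_eq_ennreal_measure ennreal_mult)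
  finally show ?thesis .
qed

lemma expec_close_to_empty:
  assumes a: "bounded_activity lam a" and lam: "0 \<le> lam" and L: "L \<in> sets borel" "bounded L"
    and h: "measurable_functional h" and h1: "\<And>\<eta>. h \<eta> \<le> 1" and dep: "\<And>\<eta>. h \<eta> = h (\<eta> \<inter> L)"
  shows "\<bar>expec a h - enn2real (h {})\<bar> \<le> lam * measure lborel L"
proof -
  define \<mu> where "\<mu> = lam * measure lborel L"
  define c where "c x = a x * indicator (- L) x" for x
  define m where "m x = a x * indicator L x" for x
  have act: "activity a" using a by (simp add: bounded_activity_def)
  note [measurable] = act L(1)
  have cm: "activity c" "activity m" unfolding c_def m_def
    by (rule activity_mono[OF act]; auto simp: indicator_def intro!: borel_measurable_times_ennreal borel_measurable_indicator)+
  have eq: "a = (\<lambda>x. c x + m x)" by (auto simp: c_def m_def indicator_def)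
  have mu: "(\<integral>\<^sup>+ x. m x \<partial>lborel) \<le> ennreal \<mu>" "0 \<le> \<mu>"
    unfolding m_def \<mu>_def using nn_integral_restrict_le[OF a lam L] lam by auto
  have e: "expec c h = enn2real (h {})"
    by (rule expec_const_on_support[where L=L and h=h, OF cm(1) _ dep]) (auto simp: c_def)
  have h0: "0 \<le> enn2real (h {})" "enn2real (h {}) \<le> 1"
    using expec_nonneg[OF cm(1), of h] expec_le_1[OF cm(1), of h, OF h1] e by auto
  have up: "partition_sum a * expec a h \<le> partition_sum c * enn2real (h {}) + \<mu> * partition_sum a"
    using partition_sum_expec_add_le[OF cm mu h h1] unfolding eq[symmetric] e .
  have lo: "partition_sum c * enn2real (h {}) \<le> partition_sum a * expec a h"
  proof -
    have "partition_sum c * expec c h \<le> partition_sum c * (expec c h + (LINT w|density lborel m. ratio c w * expec (damp c w) (add_point h w)))"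
      using partition_sum_expec_expand(3)[OF cm mu h h1] partition_sum_pos[OF cm(1)] by (intro mult_left_mono) auto
    also have "\<dots> \<le> partition_sum a * expec a h"
      using partition_sum_expec_expand(1)[OF cm mu h h1] unfolding eq[symmetric] .
    finally show ?thesis unfolding e .
  qed
  have Pc: "partition_sum c \<le> partition_sum a" "partition_sum a \<le> partition_sum c + \<mu> * partition_sum a"
    using partition_sum_add_le[OF cm mu] unfolding eq[symmetric] by (auto intro!: partition_sum_mono act cm simp: c_def indicator_def)
  have pos: "0 < partition_sum a" by (rule partition_sum_pos[OF act])
  have "partition_sum a * expec a h \<le> partition_sum a * enn2real (h {}) + \<mu> * partition_sum a"
    using up mult_right_mono[OF Pc(1) h0(1)] by linarith
  then have "partition_sum a * expec a h \<le> partition_sum a * (enn2real (h {}) + \<mu>)" by (simp add: algebra_simps)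
  then have 1: "expec a h \<le> enn2real (h {}) + \<mu>" using pos by simp
  have "partition_sum a * enn2real (h {}) \<le> (partition_sum c + \<mu> * partition_sum a) * enn2real (h {})"
    using Pc(2) h0(1) by (rule mult_right_mono)
  also have "\<dots> \<le> partition_sum a * expec a h + \<mu> * partition_sum a * 1"
    using lo h0 mu(2) pos mult_left_mono[of "enn2real (h {})" 1 "\<mu> * partition_sum a"] by (simp add: algebra_simps)
  finally have "partition_sum a * enn2real (h {}) \<le> partition_sum a * (expec a h + \<mu>)" by (simp add: algebra_simps)
  then have "enn2real (h {}) \<le> expec a h + \<mu>" using pos by simp
  with 1 show ?thesis unfolding \<mu>_def by linarith
qed

lemma bounded_activity_mult:
  assumes "bounded_activity lam l" "f \<in> borel_measurable borel" "\<And>x. f x \<le> 1"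
  shows "bounded_activity lam (\<lambda>x. l x * f x)"
  using assms by (intro bounded_activity_mono[OF assms(1)] borel_measurable_times_ennreal)
    (auto simp: bounded_activity_def activity_def intro: mult_left_mono[of _ 1 "l _", simplified])

text \<open>
  Induction over the cells still to be revealed: \<open>g\<close> carries both the removal of the revealed cells and
  the damping by the points found there.
\<close>

lemma expec_diff_cells:
  fixes C :: "nat \<Rightarrow> 'a set"
  assumes l: "bounded_activity lam l" and l': "bounded_activity lam l'" and lam: "0 \<le> lam"
    and eq: "\<And>x. x \<in> L \<Longrightarrow> l x = l' x"
    and C: "\<And>i. C i \<in> sets borel" "\<And>i. bounded (C i)" "\<And>i. C i \<subseteq> L" "\<And>i. lam * measure lborel (C i) \<le> 1/2"
    and \<epsilon>: "0 \<le> \<epsilon>" "\<And>g w. g \<in> borel_measurable borel \<Longrightarrow> (\<And>x. g x \<le> 1) \<Longrightarrow> w \<in> L \<Longrightarrow>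
      \<bar>ratio (\<lambda>x. l x * g x) w - ratio (\<lambda>x. l' x * g x) w\<bar> \<le> \<epsilon>"
    and g: "g \<in> borel_measurable borel" "\<And>x. g x \<le> 1" "\<And>x. x \<in> L - (\<Union>j<i. C j) \<Longrightarrow> g x = 0"
    and h: "measurable_functional h" "\<And>\<eta>. h \<eta> \<le> 1" "\<And>\<eta>. h \<eta> = h (\<eta> \<inter> L)"
  shows "\<bar>expec (\<lambda>x. l x * g x) h - expec (\<lambda>x. l' x * g x) h\<bar> \<le>
    (\<Sum>j<i. \<epsilon> * (lam * measure lborel (C j)) + 6 * (lam * measure lborel (C j))\<^sup>2)"
  using g h
proof (induction i arbitrary: g h)
  case 0
  note bm = bounded_activity_mult[OF l 0(1,2)] bounded_activity_mult[OF l' 0(1,2)]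
  have "expec (\<lambda>x. l x * g x) h = enn2real (h {})" "expec (\<lambda>x. l' x * g x) h = enn2real (h {})"
    using bm 0 by (auto intro!: expec_const_on_support[of _ L] simp: bounded_activity_def simp del: h(3))
  then show ?case by simp
next
  case (Suc i)
  note [measurable] = Suc.prems(1) C(1)
  define \<mu> where "\<mu> = lam * measure lborel (C i)"
  define g' where "g' x = g x * indicator (- C i) x" for x
  define m where "m x = l x * g x * indicator (C i) x" for x
  let ?S = "\<Sum>j<i. \<epsilon> * (lam * measure lborel (C j)) + 6 * (lam * measure lborel (C j))\<^sup>2"
  note bm = bounded_activity_mult[OF l] bounded_activity_mult[OF l']
  have g': "g' \<in> borel_measurable borel" "\<And>x. g' x \<le> 1" "\<And>x. x \<in> L - (\<Union>j<i. C j) \<Longrightarrow> g' x = 0"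
  proof -
    show "g' \<in> borel_measurable borel" unfolding g'_def[abs_def] by measurable
    show "g' x \<le> 1" for x using Suc.prems(2) by (simp add: g'_def indicator_def)
    show "g' x = 0" if "x \<in> L - (\<Union>j<i. C j)" for x
      using that Suc.prems(3)[of x] by (cases "x \<in> C i") (auto simp: g'_def lessThan_Suc)
  qed
  \<comment> \<open>Both activities lose the same \<open>m\<close>, since \<open>l\<close> and
    \<open>l'\<close> agree on \<open>L\<close> and the cell lies in \<open>L\<close>.\<close>
  have split: "(\<lambda>x. l x * g x) = (\<lambda>x. l x * g' x + m x)" "(\<lambda>x. l' x * g x) = (\<lambda>x. l' x * g' x + m x)"
    using eq C(3)[of i] by (auto simp: g'_def m_def indicator_def fun_eq_iff)
  have gC: "(\<lambda>x. g x * indicator (C i) x) \<in> borel_measurable borel" "\<And>x. g x * indicator (C i) x \<le> 1"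
    using Suc.prems(2) by (auto simp: indicator_def)
  have m: "activity m" "(\<integral>\<^sup>+ x. m x \<partial>lborel) \<le> ennreal \<mu>"
    using bm(1)[OF gC] nn_integral_restrict_le[OF bm(1)[OF Suc.prems(1,2)] lam C(1,2), of i]
    unfolding m_def \<mu>_def by (auto simp: bounded_activity_def mult.assoc)
  have mL: "w \<in> L" if "m w \<noteq> 0" for w
    using that C(3)[of i] unfolding m_def by (auto split: split_indicator_asm)
  have "\<bar>expec (\<lambda>x. l x * g' x + m x) h - expec (\<lambda>x. l' x * g' x + m x) h\<bar> \<le> ?S + \<epsilon> * \<mu> + 6 * \<mu>\<^sup>2"
  proof (rule expec_reveal_cell[OF _ _ m])
    show "activity (\<lambda>x. l x * g' x)" "activity (\<lambda>x. l' x * g' x)"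
      using bm[OF g'(1,2)] by (auto simp: bounded_activity_def)
    show "\<bar>expec (\<lambda>x. l x * g' x) h - expec (\<lambda>x. l' x * g' x) h\<bar> \<le> ?S"
      by (rule Suc.IH) fact+
    fix w assume "m w \<noteq> 0"
    then have w: "w \<in> L" by (rule mL)
    show "\<bar>ratio (\<lambda>x. l x * g' x) w - ratio (\<lambda>x. l' x * g' x) w\<bar> \<le> \<epsilon>"
      by (rule \<epsilon>(2)[OF g'(1,2) w])
    have fam: "measurable_family lborel (\<lambda>w. add_point h w)"
      by (rule measurable_family_insert[OF measurable_family_const]) (use Suc.prems in auto)
    have "\<bar>expec (\<lambda>x. l x * damp g' w x) (add_point h w) - expec (\<lambda>x. l' x * damp g' w x) (add_point h w)\<bar> \<le> ?S"
    proof (rule Suc.IH)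
      show "damp g' w \<in> borel_measurable borel" using g'(1) by measurable
      show "damp g' w x \<le> 1" for x using damp_le[of g' x w] g'(2)[of x] by (rule order_trans)
      show "measurable_functional (add_point h w)" using measurable_family_at[OF fam, of w] by simp
      show "h (insert w \<eta>) = h (insert w (\<eta> \<inter> L))" for \<eta>
      proof -
        have "insert w \<eta> \<inter> L = insert w (\<eta> \<inter> L) \<inter> L" by auto
        then show ?thesis
          using Suc.prems(6)[of "insert w \<eta>"] Suc.prems(6)[of "insert w (\<eta> \<inter> L)"] by (simp only:)
      qed
    qed (use g'(3) Suc.prems(5) in auto)
    then show "\<bar>expec (damp (\<lambda>x. l x * g' x) w) (add_point h w) - expec (damp (\<lambda>x. l' x * g' x) w) (add_point h w)\<bar> \<le> ?S"
      by (simp only: mult.assoc)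
  qed (use lam C(4) \<epsilon>(1) Suc.prems in \<open>auto simp: \<mu>_def\<close>)
  then show ?case unfolding split \<mu>_def by simp
qed

lemma expec_diff_le:
  assumes l: "bounded_activity lam l" and l': "bounded_activity lam l'" and lam: "0 \<le> lam"
    and L: "L \<in> sets borel" "bounded L"
    and eq: "\<And>x. x \<in> L \<Longrightarrow> l x = l' x"
    and \<epsilon>: "0 \<le> \<epsilon>" "\<And>g w. g \<in> borel_measurable borel \<Longrightarrow> (\<And>x. g x \<le> 1) \<Longrightarrow> w \<in> L \<Longrightarrow>
      \<bar>ratio (\<lambda>x. l x * g x) w - ratio (\<lambda>x. l' x * g x) w\<bar> \<le> \<epsilon>"
    and h: "measurable_functional h" "\<And>\<eta>. h \<eta> \<le> 1" "\<And>\<eta>. h \<eta> = h (\<eta> \<inter> L)"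
  shows "\<bar>expec l h - expec l' h\<bar> \<le> \<epsilon> * (lam * measure lborel L)"
proof (rule field_le_epsilon)
  fix e :: real assume e: "0 < e"
  define V where "V = measure lborel L"
  have V: "0 \<le> V" unfolding V_def by simp
  \<comment> \<open>The first term keeps the mass of a cell below \<open>1/2\<close>; the second
    brings the quadratic errors, in total at most \<open>6 * lam\<^sup>2 * V * \<delta>\<close>,
    below \<open>e\<close>. Adding 1 keeps the denominators positive.\<close>
  define \<delta> where "\<delta> = min (1 / (2 * lam + 1)) (e / (6 * lam\<^sup>2 * V + 1))"
  have pos: "0 < 6 * lam\<^sup>2 * V + 1" "0 < 2 * lam + 1" using V lam by (auto intro: add_nonneg_pos)
  have \<delta>: "0 < \<delta>" "\<delta> \<le> 1 / (2 * lam + 1)" "\<delta> \<le> e / (6 * lam\<^sup>2 * V + 1)"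
    unfolding \<delta>_def using e pos by auto
  obtain C and n :: nat where C: "\<And>i. C i \<in> sets borel" "\<And>i. C i \<subseteq> L" "\<And>i. measure lborel (C i) \<le> \<delta>"
      "L = (\<Union>i<n. C i)" "disjoint_family C"
    using small_partition[OF L \<delta>(1)] by metis
  have "lam * \<delta> \<le> 1/2"
  proof -
    have "lam * \<delta> \<le> lam * (1 / (2 * lam + 1))" using \<delta> lam by (intro mult_left_mono) auto
    also have "\<dots> \<le> 1/2" using lam by (simp add: field_simps)
    finally show ?thesis .
  qed
  then have half: "lam * measure lborel (C i) \<le> 1/2" for i
    using mult_left_mono[OF C(3)[of i] lam] by linarith
  have bC: "bounded (C i)" for i using C(2) L(2) bounded_subset by blast
  have "\<bar>expec (\<lambda>x. l x * 1) h - expec (\<lambda>x. l' x * 1) h\<bar> \<le>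
      (\<Sum>j<n. \<epsilon> * (lam * measure lborel (C j)) + 6 * (lam * measure lborel (C j))\<^sup>2)"
    by (rule expec_diff_cells[OF l l' lam eq C(1) bC C(2) half \<epsilon>]) (use C(4) h in auto)
  also have "\<dots> \<le> (\<Sum>j<n. (\<epsilon> * lam + 6 * lam\<^sup>2 * \<delta>) * measure lborel (C j))"
  proof (rule sum_mono)
    fix j
    have "6 * lam\<^sup>2 * measure lborel (C j) * measure lborel (C j) \<le> 6 * lam\<^sup>2 * \<delta> * measure lborel (C j)"
      using C(3)[of j] by (intro mult_right_mono mult_left_mono) auto
    then show "\<epsilon> * (lam * measure lborel (C j)) + 6 * (lam * measure lborel (C j))\<^sup>2 \<le> (\<epsilon> * lam + 6 * lam\<^sup>2 * \<delta>) * measure lborel (C j)"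
      by (simp add: power2_eq_square algebra_simps)
  qed
  also have "\<dots> = (\<epsilon> * lam + 6 * lam\<^sup>2 * \<delta>) * V"
  proof -
    have "V = (\<Sum>j<n. measure lborel (C j))"
      unfolding V_def C(4) using C(1) C(5) emeasure_bounded_finite[OF bC, THEN less_imp_neq]
      by (intro measure_finite_Union) (auto simp: disjoint_family_on_def)
    then show ?thesis by (simp add: sum_distrib_left)
  qed
  also have "\<dots> = \<epsilon> * (lam * V) + (6 * lam\<^sup>2 * V) * \<delta>" by (simp add: algebra_simps)
  also have "(6 * lam\<^sup>2 * V) * \<delta> \<le> (6 * lam\<^sup>2 * V + 1) * \<delta>" using \<delta>(1) by (intro mult_right_mono) auto
  also have "(6 * lam\<^sup>2 * V + 1) * \<delta> \<le> e" using \<delta>(3) pos by (simp add: pos_le_divide_eq mult.commute)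
  finally show "\<bar>expec l h - expec l' h\<bar> \<le> \<epsilon> * (lam * measure lborel L) + e"
    unfolding V_def by simp
qed

end

subsection \<open>Strong spatial mixing\<close>

text \<open>Coordinates may coincide while the image forgets multiplicity. Counting each point at
  its first occurrence expresses the cardinality by measurable conditions on the
  coordinates.\<close>

lemma card_image_Int_eq_sum:
  "card ((x :: nat \<Rightarrow> 'a) ` {..<k} \<inter> B) = (\<Sum>i<k. if x i \<in> B \<and> (\<forall>j\<in>{..<i}. x j \<noteq> x i) then 1 else 0)"
proof (induction k)
  case (Suc k)
  have "x ` {..<Suc k} \<inter> B = (if x k \<in> B then insert (x k) (x ` {..<k} \<inter> B) else x ` {..<k} \<inter> B)"
    by (auto simp: less_Suc_eq)
  moreover have "x k \<notin> x ` {..<k} \<longleftrightarrow> (\<forall>j\<in>{..<k}. x j \<noteq> x k)" unfolding image_iff by metis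
  ultimately show ?case using Suc by (simp add: card_insert_if)
qed simp

lemma measurable_card_image:
  fixes B :: "'a::euclidean_space set"
  assumes [measurable]: "B \<in> sets borel"
  shows "{x \<in> space (conf_space k). card (x ` {..<k} \<inter> B) = n} \<in> sets (conf_space k)"
proof -
  have "(\<lambda>x. if x i \<in> B \<and> (\<forall>j\<in>{..<i}. x j \<noteq> x i) then 1 else 0 :: real) \<in> borel_measurable (conf_space k)" if "i < k" for i
  proof -
    have c: "(\<lambda>x. x j :: 'a) \<in> borel_measurable (conf_space k)" if "j \<le> i" for j
    proof -
      have "(\<lambda>x. x j) \<in> conf_space k \<rightarrow>\<^sub>M (lborel :: 'a measure)"
        using that \<open>i < k\<close> by (intro measurable_component_singleton) auto
      then show ?thesis by simp
    qed
    have [measurable]: "(\<lambda>x. x i :: 'a) \<in> borel_measurable (conf_space k)" by (rule c) simp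
    have "Measurable.pred (conf_space k) (\<lambda>x. (x j :: 'a) \<noteq> x i)" if "j \<in> {..<i}" for j
    proof -
      have "(\<lambda>x. x j :: 'a) \<in> borel_measurable (conf_space k)" by (rule c) (use that in simp)
      then have [measurable]: "Measurable.pred (conf_space k) (\<lambda>x. (x j :: 'a) = x i)"
        unfolding pred_def by (rule measurable_equality_set[OF _ c]) simp
      show ?thesis by measurable
    qed
    then have [measurable]: "Measurable.pred (conf_space k) (\<lambda>x. \<forall>j\<in>{..<i}. (x j :: 'a) \<noteq> x i)"
      by (intro pred_intros_finite) auto
    show ?thesis by measurable
  qed
  then have [measurable]: "(\<lambda>x. real (card (x ` {..<k} \<inter> B))) \<in> borel_measurable (conf_space k)"
    unfolding card_image_Int_eq_sum of_nat_sum of_nat_0_eq_iff by (intro borel_measurable_sum) (auto simp: if_distrib[of real] cong: if_cong)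
  have "{x \<in> space (conf_space k). real (card (x ` {..<k} \<inter> B)) = real n} \<in> sets (conf_space k)"
    by measurable
  then show ?thesis by simp
qed

text \<open>Traces are taken on the Borel set \<open>S\<close>, although the event lives on
  \<open>\<Lambda>\<close>: counting in \<open>B\<close> then becomes counting in the Borel set
  \<open>S \<inter> B\<close>, and the traces are still point sets in
  \<open>\<Lambda>\<close>.\<close>

lemma measurable_functional_local_event:
  fixes S \<Lambda> :: "'a::euclidean_space set"
  assumes S: "S \<in> sets borel" "S \<subseteq> \<Lambda>" and A: "A \<in> sets (point_sets \<Lambda>)"
  shows "measurable_functional (indicator {\<eta>. \<eta> \<inter> S \<in> A} :: 'a set \<Rightarrow> ennreal)"
proof
  fix k
  have sub: "{{\<eta>. finite \<eta> \<and> \<eta> \<subseteq> \<Lambda> \<and> card (\<eta> \<inter> B) = n} | B n. B \<in> sets borel} \<subseteq> Pow {\<eta>. finite \<eta> \<and> \<eta> \<subseteq> \<Lambda>}"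
    by auto
  have "(\<lambda>x. x ` {..<k} \<inter> S) \<in> conf_space k \<rightarrow>\<^sub>M point_sets \<Lambda>"
    unfolding point_sets_def
  proof (rule measurable_measure_of[OF sub])
    show "(\<lambda>x. x ` {..<k} \<inter> S) \<in> space (conf_space k) \<rightarrow> {\<eta>. finite \<eta> \<and> \<eta> \<subseteq> \<Lambda>}"
      using S by auto
    fix y assume "y \<in> {{\<eta>. finite \<eta> \<and> \<eta> \<subseteq> \<Lambda> \<and> card (\<eta> \<inter> B) = n} | B n. B \<in> sets borel}"
    then obtain B n where y: "y = {\<eta>. finite \<eta> \<and> \<eta> \<subseteq> \<Lambda> \<and> card (\<eta> \<inter> B) = n}" and B: "B \<in> sets borel" by blast
    have "(\<lambda>x. x ` {..<k} \<inter> S) -` y \<inter> space (conf_space k) = {x \<in> space (conf_space k). card (x ` {..<k} \<inter> (S \<inter> B)) = n}"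
      unfolding y using S by (auto simp: Int_assoc)
    then show "(\<lambda>x. x ` {..<k} \<inter> S) -` y \<inter> space (conf_space k) \<in> sets (conf_space k)"
      using measurable_card_image[of "S \<inter> B" k n] S B by simp
  qed
  then have "(\<lambda>x. x ` {..<k} \<inter> S) -` A \<inter> space (conf_space k) \<in> sets (conf_space k)"
    using A by (rule measurable_sets)
  then have "(indicator ((\<lambda>x. x ` {..<k} \<inter> S) -` A \<inter> space (conf_space k)) :: _ \<Rightarrow> ennreal) \<in> borel_measurable (conf_space k)"
    by (rule borel_measurable_indicator)
  then show "(\<lambda>x. indicator {\<eta>. \<eta> \<inter> S \<in> A} (x ` {..<k}) :: ennreal) \<in> borel_measurable (conf_space k)"
    by (rule measurable_cong[THEN iffD1, rotated]) (auto simp: indicator_def)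
qed

text \<open>
  \<open>\<Lambda>\<close> is only Lebesgue measurable; the next two lemmas allow replacing it by a Borel subset of full measure.
\<close>

lemma AE_conf_space_avoid:
  fixes N :: "'a::euclidean_space set"
  assumes N: "N \<in> null_sets lborel"
  shows "AE x in conf_space k. \<forall>i<k. x i \<notin> N"
proof -
  interpret product_sigma_finite "\<lambda>_. lborel :: 'a measure" ..
  have "AE x in conf_space k. x i \<notin> N" if i: "i < k" for i
  proof (rule AE_I')
    let ?A = "\<lambda>j. if j = i then N else UNIV"
    have s: "?A j \<in> sets lborel" for j using N by auto
    have "emeasure (conf_space k) (PiE {..<k} ?A) = (\<Prod>j<k. emeasure lborel (?A j))"
      using s by (intro emeasure_PiM) auto
    also have "\<dots> = 0"
      using i N by (intro prod_zero) auto
    finally show "PiE {..<k} ?A \<in> null_sets (conf_space k)"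
      using s by (intro null_setsI sets_PiM_I_finite) auto
    show "{x \<in> space (conf_space k). \<not> x i \<notin> N} \<subseteq> PiE {..<k} ?A"
      by (auto simp: space_PiM PiE_def Pi_def)
  qed
  then have "AE x in conf_space k. \<forall>i\<in>{..<k}. x i \<notin> N" by (subst AE_finite_all) auto
  then show ?thesis by (rule eventually_mono) auto
qed

lemma gibbs_weight_null_cong:
  assumes N: "N \<in> null_sets lborel" and AA': "\<And>\<eta>. \<eta> \<inter> N = {} \<Longrightarrow> \<eta> \<in> A \<longleftrightarrow> \<eta> \<in> A'"
  shows "gibbs_weight \<phi> l A = gibbs_weight \<phi> l A'"
  unfolding gibbs_weight_def
proof (intro suminf_cong arg_cong[where f="\<lambda>x. _ * x"] nn_integral_cong_AE)
  fix k
  show "AE x in conf_space k. indicator A (x ` {..<k}) * ennreal (\<Prod>i<k. l (x i)) *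
      ennreal (\<Prod>i<k. \<Prod>j\<in>{i<..<k}. boltz \<phi> (x i - x j)) = indicator A' (x ` {..<k}) *
      ennreal (\<Prod>i<k. l (x i)) * ennreal (\<Prod>i<k. \<Prod>j\<in>{i<..<k}. boltz \<phi> (x i - x j))"
    using AE_conf_space_avoid[OF N, of k]
  proof eventually_elim
    case (elim x)
    then have "x ` {..<k} \<inter> N = {}" by auto
    then have "x ` {..<k} \<in> A \<longleftrightarrow> x ` {..<k} \<in> A'" by (rule AA')
    then show ?case by (auto simp: indicator_def)
  qed
qed

section \<open>From the potential to the abstract Boltzmann factor\<close>

lemma finite_range_boltzmann_boltz:
  assumes "pair_potential \<phi>" and "0 \<le> r" and r: "\<And>x. norm x > r \<Longrightarrow> \<phi> x = 0"
  shows "finite_range_boltzmann (boltz \<phi>) (r + 1)"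
proof
  have [measurable]: "\<phi> \<in> borel_measurable borel" using assms by (simp add: pair_potential_def)
  show "boltz \<phi> \<in> borel_measurable borel" unfolding boltz_def[abs_def] by measurable
  show "boltz \<phi> (- x) = boltz \<phi> x" for x using assms by (simp add: pair_potential_def boltz_def)
  show "boltz \<phi> x = 1" if "r + 1 \<le> norm x" for x using r[of x] that by (simp add: boltz_def)
qed (use assms(2) in \<open>auto simp: boltz_def\<close>)

lemma walk_V_eq_walk_integral:
  assumes "finite_range_boltzmann (boltz \<phi>) R"
  shows "walk_V \<phi> k = finite_range_boltzmann.walk_integral (boltz \<phi>) k 0 (\<lambda>_. 0)"
proof -
  interpret finite_range_boltzmann "boltz \<phi>" R by fact
  have w: "walk_weight 0 k v = (\<Prod>j\<in>{1..k}. (\<Prod>i\<in>{0..<j-1}.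
            (if norm (v j - v i) < norm (v i - v (Suc i)) then boltz \<phi> (v j - v i) else 1))
          * (1 - boltz \<phi> (v j - v (j - 1))))" for v
    unfolding step_weight_def history_weight_def
    by (simp add: prod.atLeast1_atMost_eq atLeast0LessThan)
  have m: "extend_history 0 (\<lambda>_. 0) x = (\<lambda>j. if j = 0 then 0 else x j)" for x by (simp add: extend_history_def)
  show ?thesis
    unfolding walk_integral_eq_integral unfolding w unfolding walk_V_def m Let_def add_0 One_nat_def ..
qed

lemma gibbs_weight_eq_Z:
  assumes "finite_range_boltzmann (boltz \<phi>) R" and "l \<in> borel_measurable borel" "\<And>x. 0 \<le> l x"
    and h: "measurable_functional (indicator A :: 'a::euclidean_space set \<Rightarrow> ennreal)"
  shows "gibbs_weight \<phi> l A = boltzmann_factor.Z (boltz \<phi>) (\<lambda>x. ennreal (l x)) (indicator A)"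
proof -
  interpret finite_range_boltzmann "boltz \<phi>" R by fact
  have [measurable]: "l \<in> borel_measurable borel" by fact
  have "W k (\<lambda>x. ennreal (l x)) (indicator A) = (\<integral>\<^sup>+ x. indicator A (x ` {..<k}) * ennreal (\<Prod>i<k. l (x i)) *
      ennreal (\<Prod>i<k. \<Prod>j\<in>{i<..<k}. boltz \<phi> (x i - x j)) \<partial>conf_space k)" for k
    by (subst W_eq_integral[OF _ h])
      (auto simp: B_def prod_ennreal assms(3) prod_nonneg b_nonneg)
  then show ?thesis unfolding gibbs_weight_def Z_def by simp
qed

text \<open>An infimum below exp 1 / \<open>lam\<close> is undercut at a single \<open>k\<close>,
  and raising to the power \<open>k\<close> gives the claim. For \<open>lam = 0\<close>, where the
  quotient is meaningless, \<open>k = 1\<close> serves.\<close>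

lemma connective_const_witness:
  assumes "0 \<le> lam" "lam * connective_const \<phi> < exp 1"
  obtains k where "1 \<le> k" "(lam * exp (- 1)) ^ k * enn2real (walk_V \<phi> k) < 1"
proof (cases "lam = 0")
  case True
  then show ?thesis using that[of 1] by simp
next
  case False
  then have lam: "0 < lam" using assms by simp
  then have "connective_const \<phi> < exp 1 / lam"
    using assms by (simp add: pos_less_divide_eq mult.commute)
  then obtain k :: nat where k: "1 \<le> k" "enn2real (walk_V \<phi> k) powr (1 / real k) < exp 1 / lam"
    unfolding connective_const_def using cInf_lessD[of "(\<lambda>k. enn2real (walk_V \<phi> k) powr (1 / real k)) ` {1..}"] by auto
  define V where "V = enn2real (walk_V \<phi> k)"
  have "V = (V powr (1 / real k)) ^ k"
    using k(1) by (cases "V = 0") (auto simp: V_def powr_power)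
  also have "\<dots> < (exp 1 / lam) ^ k"
    using k by (intro power_strict_mono) (auto simp: V_def)
  finally have "(lam * exp (- 1)) ^ k * V < (lam * exp (- 1)) ^ k * (exp 1 / lam) ^ k"
    using lam by (intro mult_strict_left_mono) auto
  also have "\<dots> = 1" using lam by (simp add: power_mult_distrib[symmetric] exp_minus)
  finally show ?thesis using that[OF k(1)] unfolding V_def by simp
qed

theorem theorem2:
  fixes \<phi> :: "'a::euclidean_space \<Rightarrow> ennreal" and lam :: real
  assumes "pair_potential \<phi>" and "finite_range \<phi>"
    and "0 \<le> lam" and "lam * connective_const \<phi> < exp 1"
  shows "\<exists>\<alpha>>0. \<exists>\<beta>>0. \<forall>\<Lambda> l l'.
     \<Lambda> \<in> sets lebesgue \<longrightarrow> bounded \<Lambda> \<longrightarrow>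
     activity_bounded l lam \<longrightarrow> bounded {x. l x \<noteq> 0} \<longrightarrow>
     activity_bounded l' lam \<longrightarrow> bounded {x. l' x \<noteq> 0} \<longrightarrow>
     tv_local \<phi> l l' \<Lambda> \<le>
       \<alpha> * measure lebesgue \<Lambda> * exp (- \<beta> * setdist \<Lambda> {x. l x - l' x \<noteq> 0})"
proof -
  obtain r where r: "0 \<le> r" "\<And>x. norm x > r \<Longrightarrow> \<phi> x = 0"
    using assms(2) by (auto simp: finite_range_def)
  \<comment> \<open>The range \<open>r\<close> may be 0 while \<open>R\<close> must be positive;
    moreover \<open>R \<le> norm x\<close> has to imply the strict inequality
    \<open>r < norm x\<close>.\<close>
  define R where "R = r + 1"
  have frb: "finite_range_boltzmann (boltz \<phi>) R"
    unfolding R_def by (rule finite_range_boltzmann_boltz[OF assms(1) r])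
  interpret finite_range_boltzmann "boltz \<phi>" R by (rule frb)
  obtain k where k: "1 \<le> k" "(lam * exp (- 1)) ^ k * enn2real (walk_V \<phi> k) < 1"
    using connective_const_witness[OF assms(3,4)] by blast
  \<comment> \<open>The maximum with \<open>1/4\<close> keeps \<open>q\<close> positive, so that
    \<open>ln p\<close> and division by \<open>p\<close> make sense; any number strictly between 0
    and 1 would do.\<close>
  define q where "q = max (1/4) ((lam * exp (- 1)) ^ k * enn2real (walk_V \<phi> k))"
  have q: "(lam * exp (- 1)) ^ k * enn2real (walk_integral k 0 (\<lambda>_. 0)) \<le> q" "0 < q" "q < 1"
    unfolding q_def walk_V_eq_walk_integral[OF frb, symmetric] using k(2) by auto
  define p where "p = sqrt q"
  have p: "0 < p" "p < 1" unfolding p_def using q by auto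
  define s where "s = real k * R"
  have s: "0 < s" unfolding s_def using k(1) R_pos by simp
  \<comment> \<open>Chosen so that \<open>p\<close> to the power \<open>d / s\<close> equals
    \<open>exp (- \<beta> * d)\<close>. In \<open>\<alpha>\<close>, the term
    \<open>2 * lam / p\<close> pays for rounding \<open>d / s\<close> down to an integer,
    \<open>2 * lam\<close> covers distance zero, and 1 keeps \<open>\<alpha>\<close> positive when
    \<open>lam = 0\<close>.\<close>
  define \<beta> where "\<beta> = - ln p / s"
  define \<alpha> where "\<alpha> = 2 * lam / p + 2 * lam + 1"
  have \<beta>: "0 < \<beta>" unfolding \<beta>_def using p s by (intro divide_pos_pos) (auto simp: ln_less_zero)
  have \<alpha>: "0 < \<alpha>" unfolding \<alpha>_def using p assms(3) by (intro add_nonneg_pos add_nonneg_nonneg) auto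
  have main: "tv_local \<phi> l l' \<Lambda> \<le> \<alpha> * measure lebesgue \<Lambda> * exp (- \<beta> * setdist \<Lambda> {x. l x - l' x \<noteq> 0})"
    if \<Lambda>: "\<Lambda> \<in> sets lebesgue" "bounded \<Lambda>" and l: "activity_bounded l lam" and l': "activity_bounded l' lam" for \<Lambda> l l'
  proof -
    define d where "d = setdist \<Lambda> {x. l x - l' x \<noteq> 0}"
    obtain S N N' where SN: "\<Lambda> = S \<union> N" "N \<subseteq> N'" "N' \<in> null_sets lborel" "S \<in> sets lborel"
      using \<Lambda>(1) by (elim sets_completionE) auto
    have S: "S \<in> sets borel" "S \<subseteq> \<Lambda>" "bounded S"
      using SN \<Lambda>(2) by (auto intro: bounded_subset)
    have mS: "measure lborel S = measure lebesgue \<Lambda>"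
    proof -
      have "N \<in> null_sets lebesgue" using SN by (auto intro: null_sets_completion_subset null_sets_completionI)
      then have "measure lebesgue (S \<union> N) = measure lebesgue S"
        using SN(4) by (intro measure_Un_null_set) auto
      then show ?thesis using SN by simp
    qed
    define a a' where "a = (\<lambda>x. ennreal (l x))" and "a' = (\<lambda>x. ennreal (l' x))"
    have bnd: "bounded_activity lam (\<lambda>x. ennreal (m x)) \<and> m \<in> borel_measurable borel \<and> (\<forall>x. 0 \<le> m x)"
      if m: "activity_bounded m lam" for m
    proof -
      have "integrable lborel m" using m by (simp add: activity_bounded_def)
      then have "m \<in> borel_measurable borel" "(\<integral>\<^sup>+ x. ennreal (m x) \<partial>lborel) < \<infinity>"
        using m by (auto simp: activity_bounded_def nn_integral_eq_integral)
      moreover have "AE x in lborel. ennreal (m x) \<le> ennreal lam"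
        using m by (auto simp: activity_bounded_def elim!: eventually_mono intro: ennreal_leI)
      ultimately show ?thesis using m by (auto simp: bounded_activity_def activity_def activity_bounded_def)
    qed
    have ba: "bounded_activity lam a" "bounded_activity lam a'"
      unfolding a_def a'_def using bnd l l' by auto
    have UNIV_indicator: "(indicator UNIV :: 'a set \<Rightarrow> ennreal) = (\<lambda>_. 1)" by (auto simp: fun_eq_iff)
    have prob: "gibbs_prob \<phi> m {\<eta>. \<eta> \<inter> \<Lambda> \<in> A} = expec (\<lambda>x. ennreal (m x)) (indicator {\<eta>. \<eta> \<inter> S \<in> A})"
      if m: "activity_bounded m lam" and A: "A \<in> sets (point_sets \<Lambda>)" for m A
    proof -
      have bm: "m \<in> borel_measurable borel" "\<And>x. 0 \<le> m x" using bnd[OF m] by auto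
      have "gibbs_weight \<phi> m {\<eta>. \<eta> \<inter> \<Lambda> \<in> A} = gibbs_weight \<phi> m {\<eta>. \<eta> \<inter> S \<in> A}"
      proof (rule gibbs_weight_null_cong[OF SN(3)])
        fix \<eta> :: "'a set" assume "\<eta> \<inter> N' = {}"
        then have "\<eta> \<inter> \<Lambda> = \<eta> \<inter> S" using SN by auto
        then show "\<eta> \<in> {\<eta>. \<eta> \<inter> \<Lambda> \<in> A} \<longleftrightarrow> \<eta> \<in> {\<eta>. \<eta> \<inter> S \<in> A}" by simp
      qed
      also have "\<dots> = Z (\<lambda>x. ennreal (m x)) (indicator {\<eta>. \<eta> \<inter> S \<in> A})"
        by (rule gibbs_weight_eq_Z[OF frb bm measurable_functional_local_event[OF S(1,2) A]])
      moreover have "gibbs_weight \<phi> m UNIV = Z1 (\<lambda>x. ennreal (m x))"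
        using gibbs_weight_eq_Z[OF frb bm, of UNIV] unfolding UNIV_indicator by simp
      ultimately show ?thesis
        unfolding gibbs_prob_def partition_fn_def expec_def partition_sum_def by simp
    qed
    have bound: "\<bar>expec a (indicator {\<eta>. \<eta> \<inter> S \<in> A}) - expec a' (indicator {\<eta>. \<eta> \<inter> S \<in> A})\<bar>
        \<le> \<alpha> * measure lborel S * exp (- \<beta> * d)" if A: "A \<in> sets (point_sets \<Lambda>)" for A
    proof -
      define h :: "'a set \<Rightarrow> ennreal" where "h = indicator {\<eta>. \<eta> \<inter> S \<in> A}"
      have h: "measurable_functional h" "\<And>\<eta>. h \<eta> \<le> 1" "\<And>\<eta>. h \<eta> = h (\<eta> \<inter> S)"
        unfolding h_def using measurable_functional_local_event[OF S(1,2) A]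
        by (simp, simp add: indicator_def, simp add: indicator_def Int_assoc)
      define V where "V = measure lborel S"
      have V: "0 \<le> V" by (simp add: V_def)
      have "\<bar>expec a h - expec a' h\<bar> \<le> \<alpha> * V * exp (- \<beta> * d)"
      \<comment> \<open>\<open>setdist\<close> is 0 also if one of the sets is empty, in particular
        for equal activities; the estimate without decay covers that case too.\<close>
      proof (cases "d = 0")
        case True
        have "\<bar>expec a h - expec a' h\<bar> \<le> 2 * (lam * V)"
          using expec_close_to_empty[OF ba(1) assms(3) S(1,3) h] expec_close_to_empty[OF ba(2) assms(3) S(1,3) h]
          unfolding V_def by linarith
        also have "\<dots> = (2 * lam) * V" by simp
        also have "\<dots> \<le> \<alpha> * V" using V p assms(3) unfolding \<alpha>_def by (intro mult_right_mono) auto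
        finally show ?thesis using True by simp
      next
        case False
        then have d: "0 < d" using setdist_pos_le[of \<Lambda> "{x. l x - l' x \<noteq> 0}"] unfolding d_def by linarith
        have near: "l x = l' x" if "w \<in> S" "norm (x - w) < d" for x w
        proof (rule ccontr)
          assume "l x \<noteq> l' x"
          then have "d \<le> dist w x"
            unfolding d_def using that S(2) by (intro setdist_le_dist) auto
          with that show False by (simp add: dist_norm norm_minus_commute)
        qed
        \<comment> \<open>The number of complete blocks of \<open>k\<close> generations, each
          reaching no further than \<open>s = k * R\<close>, that fit into the distance
          \<open>d\<close>.\<close>
        define n where "n = nat \<lfloor>d / s\<rfloor>"
        have n: "real n \<le> d / s" "d / s - 1 \<le> real n"
          unfolding n_def using d s by (auto simp: of_nat_nat)
        have ns: "real n * s \<le> d" using n(1) s by (simp add: pos_le_divide_eq)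
        have "\<bar>expec a h - expec a' h\<bar> \<le> (2 * p ^ n) * (lam * V)"
          unfolding V_def
        proof (rule expec_diff_le[OF ba assms(3) S(1,3)])
          show "a x = a' x" if "x \<in> S" for x
            using near[OF that, of x] d by (simp add: a_def a'_def)
          show "0 \<le> 2 * p ^ n" using p by simp
          fix g :: "'a \<Rightarrow> ennreal" and w assume g: "g \<in> borel_measurable borel" "\<And>x. g x \<le> (1 :: ennreal)" and w: "w \<in> S"
          show "\<bar>ratio (\<lambda>x. a x * g x) w - ratio (\<lambda>x. a' x * g x) w\<bar> \<le> 2 * p ^ n"
            unfolding p_def
          proof (rule ratio_decay[OF assms(3) q(1) less_imp_le[OF q(2)]])
            show "bounded_activity lam (\<lambda>x. a x * g x)"
              by (rule bounded_activity_mult[OF ba(1) g])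
            show "bounded_activity lam (\<lambda>x. a' x * g x)"
              by (rule bounded_activity_mult[OF ba(2) g])
            show "agree (\<lambda>x. a x * g x) (\<lambda>x. a' x * g x) w (real n * (real k * R))"
              using near[OF w] ns unfolding agree_def s_def a_def a'_def by auto
          qed
        qed (use h in auto)
        also have "p ^ n \<le> exp (- \<beta> * d) / p"
        proof -
          have "p ^ n = exp (real n * ln p)" using p by (simp add: exp_of_nat_mult)
          also have "\<dots> \<le> exp ((d / s - 1) * ln p)"
            using n(2) p by (intro exp_mono mult_right_mono_neg) (auto simp: ln_le_zero_iff)
          also have "(d / s - 1) * ln p = - \<beta> * d - ln p" unfolding \<beta>_def by (simp add: algebra_simps)
          also have "exp \<dots> = exp (- \<beta> * d) / p" using p by (simp add: exp_diff)
          finally show ?thesis .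
        qed
        then have "(2 * p ^ n) * (lam * V) \<le> (2 * (exp (- \<beta> * d) / p)) * (lam * V)"
          using V assms(3) by (intro mult_right_mono mult_left_mono) auto
        also have "\<dots> = (2 * lam / p) * (V * exp (- \<beta> * d))" by simp
        also have "\<dots> \<le> \<alpha> * (V * exp (- \<beta> * d))"
          using V assms(3) unfolding \<alpha>_def by (intro mult_right_mono) auto
        finally show ?thesis by (simp only: mult.assoc)
      qed
      then show ?thesis unfolding h_def V_def .
    qed
    have "tv_local \<phi> l l' \<Lambda> \<le> \<alpha> * measure lborel S * exp (- \<beta> * d)"
      unfolding tv_local_def
    proof (rule cSUP_least)
      show "sets (point_sets \<Lambda>) \<noteq> {}" using sets.top[of "point_sets \<Lambda>"] by blast
      show "\<bar>gibbs_prob \<phi> l {\<eta>. \<eta> \<inter> \<Lambda> \<in> A} - gibbs_prob \<phi> l' {\<eta>. \<eta> \<inter> \<Lambda> \<in> A}\<bar> \<le> \<alpha> * measure lborel S * exp (- \<beta> * d)"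
        if A: "A \<in> sets (point_sets \<Lambda>)" for A
        using bound[OF A] unfolding prob[OF l A] prob[OF l' A] a_def a'_def .
    qed
    then show ?thesis unfolding mS d_def .
  qed
  show ?thesis using \<alpha> \<beta> main by blast
qed

end
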